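(* Let $1\leq q_1,q_2\leq \infty$ and $0<r<\infty$ with $\frac{1}r =\frac 1 {q_1}+\frac 1 {q_2}$. Suppose that $a\in S^{m}_{\varrho,\delta}(n,2)$ with $0<\varrho\leq 1$, $0\le\delta\leq \varrho$, $\delta<1$, and \[ m<n(\varrho-1)\left[\max\left(\frac{1}{2},\,\frac{1}{q_1},\, \frac{1}{q_2},\, 1-\frac{1}{r}\right)+\frac{1}{2}\max\left(\frac{1}{r}-1,0\right)\right]. \] Then the bilinear pseudodifferential operator $T_{a} (f,g)(x)= \iint a(x,\xi,\eta)\, e^{ i \langle x,\xi+\eta\rangle} \widehat{ f}(\xi) \widehat{g}(\eta)\,d \xi\, d\eta$ satisfies $\|T_a(f,g)\|_{L^r}\lesssim \|f\|_{L^{q_1}}\|g\|_{L^{q_2}}$ for $f,g\in\mathcal{S}$.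
   Context: $S^m_{\varrho,\delta}(n,2)$ (for $\varrho,\delta\in[0,1]$): functions $a\in C^\infty(\mathbb{R}^n\times\mathbb{R}^{2n})$ with $|\partial_x^\beta\partial_{\xi}^{\alpha_1}\partial_{\eta}^{\alpha_2}a(x,\xi,\eta)|\le C_{\alpha_1,\alpha_2,\beta}(1+|\xi|+|\eta|)^{m-\varrho(|\alpha_1|+|\alpha_2|)+\delta|\beta|}$ for all multi-indices. *)

theory Defs
  imports "HOL-Analysis.Analysis" "HOL-Probability.Essential_Supremum"
begin

definition dirderiv :: "'a::real_normed_vector \<Rightarrow> ('a \<Rightarrow> 'b::real_normed_vector) \<Rightarrow> 'a \<Rightarrow> 'b" where
  "dirderiv v F z = vector_derivative (\<lambda>t::real. F (z + t *\<^sub>R v)) (at 0)"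

(* iterated partial derivatives: the list of (basis) directions encodes a multi-index *)
fun iderv :: "'a::real_normed_vector list \<Rightarrow> ('a \<Rightarrow> 'b::real_normed_vector) \<Rightarrow> 'a \<Rightarrow> 'b" where
  "iderv [] F = F"
| "iderv (v # vs) F = dirderiv v (iderv vs F)"

definition smooth :: "('a::euclidean_space \<Rightarrow> 'b::real_normed_vector) \<Rightarrow> bool" where
  "smooth F \<longleftrightarrow> (\<forall>vs \<in> lists Basis. continuous_on UNIV (iderv vs F) \<and>
      (\<forall>v \<in> Basis. \<forall>z. (\<lambda>t::real. iderv vs F (z + t *\<^sub>R v)) differentiable (at 0)))"

definition schwartz :: "(real^'n \<Rightarrow> complex) \<Rightarrow> bool" where
  "schwartz f \<longleftrightarrow> smooth f \<and>
     (\<forall>vs \<in> lists Basis. \<forall>N::nat. \<exists>C. \<forall>x. (1 + norm x) ^ N * norm (iderv vs f x) \<le> C)"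

definition bisymbol :: "real \<Rightarrow> real \<Rightarrow> real \<Rightarrow>
    (real^'n \<Rightarrow> real^'n \<Rightarrow> real^'n \<Rightarrow> complex) \<Rightarrow> bool" where
  "bisymbol m \<rho> \<delta> a \<longleftrightarrow>
     (let A = (\<lambda>(x, \<xi>, \<eta>). a x \<xi> \<eta>) in
      smooth A \<and>
      (\<forall>vs \<in> lists (Basis :: ((real^'n) \<times> (real^'n) \<times> (real^'n)) set).
         \<exists>C. \<forall>x \<xi> \<eta>.
           norm (iderv vs A (x, \<xi>, \<eta>)) \<le>
             C * (1 + norm \<xi> + norm \<eta>) powr
               (m - \<rho> * real (length (filter (\<lambda>v. fst (snd v) \<noteq> 0) vs)
                             + length (filter (\<lambda>v. snd (snd v) \<noteq> 0) vs))
                  + \<delta> * real (length (filter (\<lambda>v. fst v \<noteq> 0) vs)))))"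

(* Fourier transform (normalisation constants are irrelevant for the estimate) *)
definition fourier :: "(real^'n \<Rightarrow> complex) \<Rightarrow> real^'n \<Rightarrow> complex" where
  "fourier f \<xi> = (LINT x|lborel. exp (- \<i> * complex_of_real (x \<bullet> \<xi>)) * f x)"

definition bipsido :: "(real^'n \<Rightarrow> real^'n \<Rightarrow> real^'n \<Rightarrow> complex) \<Rightarrow>
    (real^'n \<Rightarrow> complex) \<Rightarrow> (real^'n \<Rightarrow> complex) \<Rightarrow> real^'n \<Rightarrow> complex" where
  "bipsido a f g x = (LINT \<xi>|lborel. LINT \<eta>|lborel.
      a x \<xi> \<eta> * exp (\<i> * complex_of_real (x \<bullet> (\<xi> + \<eta>))) * fourier f \<xi> * fourier g \<eta>)"

definition Lnorm :: "ereal \<Rightarrow> ('a::euclidean_space \<Rightarrow> 'b::real_normed_vector) \<Rightarrow> ennreal" where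
  "Lnorm p F =
     (if p = \<infinity> then esssup lborel (\<lambda>x. ennreal (norm (F x)))
      else (let I = (\<integral>\<^sup>+ x. ennreal (norm (F x) powr real_of_ereal p) \<partial>lborel)
            in if I = \<infinity> then \<infinity> else ennreal (enn2real I powr (1 / real_of_ereal p))))"

definition recip :: "ereal \<Rightarrow> real" where
  "recip q = (if q = \<infinity> then 0 else 1 / real_of_ereal q)"

end

theory Submission
  imports Defs "HOL-Probability.Sinc_Integral"
begin

text \<open>
  Cut the symbol into dyadic pieces \<open>|\<xi>| + |\<eta>| \<approx> 2 ^ j\<close> and rescale \<open>x\<close> by \<open>2 powr (j * \<rho>)\<close>. Since
  \<open>\<delta> \<le> \<rho>\<close>, all derivatives of the rescaled piece are bounded by \<open>2 powr (j * m)\<close>, and it lives on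
  frequencies of size at most \<open>R = 2 powr (j * (1 - \<rho>))\<close>. Its kernel is localised at unit distance,
  so on a unit cube \<open>f\<close> and \<open>g\<close> may be replaced by rapidly decaying localisations. There one has, for a
  piece bounded by 1, the estimate \<open>L\<^sup>2 \<times> L\<^sup>2 \<rightarrow> L\<^sup>2\<close> with norm \<open>R powr (n/2)\<close>, because
  the \<open>x\<close>-integral of \<open>|T (f, g)|\<^sup>2\<close> makes two frequency sums nearly equal, and the trivial
  \<open>L\<^sup>2 \<times> L\<^sup>2 \<rightarrow> L\<^sup>\<infinity>\<close> bound \<open>R ^ n\<close>. Bernstein's inequality for \<open>q < 2\<close>, Hoelder's inequality on
  the cube for \<open>q > 2\<close>, and interpolation of the two target norms for \<open>r > 2\<close> give a power of \<open>R\<close> that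
  never exceeds the exponent in the hypothesis on \<open>m\<close>; the strict inequality there makes the pieces
  summable for every \<open>r > 0\<close>.
\<close>

subsection \<open>Decay weight and bounds on derivatives\<close>

text \<open>All L^2 information comes from one identity, the symmetry in F and G of the integral of
  \<open>F * ft G\<close>; tested against a cutoff it gives a Bessel inequality on boxes. Pointwise
  Young and threshold inequalities then do the work of interpolation and of Hoelder on cubes. They
  survive for r < 1, where the target is not normed and duality arguments break down. Regularity is
  counted: 6n derivatives in all. Two in each of the 2n frequency variables allow f and g to be
  divided by \<open>pw\<close>; two in each of the n space variables make the x-integral of a
  product of two phases decay in the difference of their frequency sums. Finitely smooth, piecewise
  polynomial cutoffs are therefore enough. The weight is a product over coordinates because it has
  to split over the pair (\<xi>, \<eta>), be integrable, and be the modulus of the reciprocal of a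
  Fourier multiplier of a differential operator. The power of R: fixing the frequency sum leaves n
  of the 2n frequency dimensions free, which costs R^n in the squared L^2 bound, and each input with
  q < 2 costs a further R^(n(1/q - 1/2)).\<close>

definition wt :: "'a::euclidean_space \<Rightarrow> real" where
  "wt x = (\<Prod>b\<in>Basis. 1 / (1 + (x \<bullet> b)\<^sup>2))"

lemma one_plus_square_pos: "0 < 1 + (t::real)\<^sup>2"
  by (simp add: add_pos_nonneg)

lemma one_plus_square_nz [simp]: "1 + (t::real)\<^sup>2 \<noteq> 0"
  using one_plus_square_pos[of t] by linarith

lemma wt_pos [simp]: "0 < wt x"
  unfolding wt_def by (intro prod_pos) (simp add: one_plus_square_pos)

lemma wt_nonneg [simp]: "0 \<le> wt x"
  using wt_pos[of x] by linarith

lemma wt_le_one: "wt x \<le> 1"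
  unfolding wt_def by (intro prod_le_1) (simp add: divide_le_eq_1 one_plus_square_pos)

lemma wt_zero [simp]: "wt 0 = 1"
  by (simp add: wt_def)

lemma wt_minus [simp]: "wt (- x) = wt x"
  by (simp add: wt_def)

lemma wt_minus_commute: "wt (x - y) = wt (y - x)"
  using wt_minus[of "x - y"] by simp

lemma continuous_on_wt [continuous_intros]:
  "continuous_on S f \<Longrightarrow> continuous_on S (\<lambda>x. wt (f x))"
  unfolding wt_def by (intro continuous_intros ballI) auto

lemma borel_measurable_wt [measurable]: "wt \<in> borel_measurable borel"
  by (intro borel_measurable_continuous_onI continuous_intros)

lemma wt_Pair: "wt (x, y) = wt x * wt y"
proof -
  have "wt (x, y) = (\<Prod>b\<in>(\<lambda>u. (u, 0)) ` Basis. 1 / (1 + ((x, y) \<bullet> b)\<^sup>2)) *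
      (\<Prod>b\<in>(\<lambda>v. (0, v)) ` Basis. 1 / (1 + ((x, y) \<bullet> b)\<^sup>2))"
    unfolding wt_def Basis_prod_def by (rule prod.union_disjoint) auto
  also have "\<dots> = wt x * wt y"
    by (simp add: wt_def prod.reindex inj_on_def)
  finally show ?thesis .
qed

lemma integrable_wt_real: "integrable lborel (\<lambda>t::real. 1 / (1 + t\<^sup>2))"
  using integrable_inverse_1_plus_square
  by (simp add: set_integrable_def einterval_def divide_inverse)

lemma integrable_wt: "integrable lborel (wt :: 'a::euclidean_space \<Rightarrow> real)"
proof -
  have "(\<integral>\<^sup>+x. ennreal (norm (wt (x::'a))) \<partial>lborel) =
      (\<integral>\<^sup>+x. (\<Prod>b\<in>(Basis::'a set). ennreal (1 / (1 + (x \<bullet> b)\<^sup>2))) \<partial>lborel)"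
    unfolding wt_def
    by (intro nn_integral_cong) (simp add: prod_ennreal prod_nonneg less_imp_le one_plus_square_pos)
  also have "\<dots> = (\<Prod>b\<in>(Basis::'a set). (\<integral>\<^sup>+t. ennreal (1 / (1 + t\<^sup>2)) \<partial>lborel))"
    by (rule nn_integral_lborel_prod) auto
  also have "\<dots> < \<infinity>"
  proof -
    have "(\<integral>\<^sup>+t. ennreal (1 / (1 + t\<^sup>2)) \<partial>lborel) = ennreal (\<integral>t. 1 / (1 + (t::real)\<^sup>2) \<partial>lborel)"
      by (rule nn_integral_eq_integral[OF integrable_wt_real])
         (simp add: less_imp_le one_plus_square_pos)
    then show ?thesis by (simp add: ennreal_power ennreal_less_top)
  qed
  finally show ?thesis
    by (intro integrableI_bounded) auto
qed

lemma wt_mult_self_le: "wt x * wt x \<le> wt x"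
  by (simp add: mult_left_le wt_le_one)

text \<open>Only the factor in the direction \<open>v\<close> changes. The bound makes difference
  quotients with steps up to 1 dominated by the weight at their base point.\<close>

lemma wt_shift:
  fixes x v :: "'a::euclidean_space"
  assumes "v \<in> Basis" "\<bar>t\<bar> \<le> 1"
  shows "wt (x + t *\<^sub>R v) \<le> 3 * wt x"
proof -
  have *: "1 / (1 + (s + t)\<^sup>2) \<le> 3 * (1 / (1 + s\<^sup>2))" for s :: real
  proof -
    have "t\<^sup>2 \<le> 1" using assms(2) by (simp add: abs_square_le_1)
    \<comment> \<open>Right side minus left side is the square of \<open>s + 2 * t\<close>.\<close>
    moreover have "s\<^sup>2 \<le> 2 * (s + t)\<^sup>2 + 2 * t\<^sup>2"
      using zero_le_power2[of "s + 2 * t"] by (simp add: power2_eq_square algebra_simps)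
    ultimately have "s\<^sup>2 \<le> 2 * (s + t)\<^sup>2 + 2"
      by linarith
    then have "1 + s\<^sup>2 \<le> 3 * (1 + (s + t)\<^sup>2)"
      using zero_le_power2[of "s+t"] unfolding distrib_left by linarith
    then show ?thesis
      by (simp add: field_simps one_plus_square_pos)
  qed
  have "wt (x + t *\<^sub>R v) = 1 / (1 + (x \<bullet> v + t)\<^sup>2) * (\<Prod>b\<in>Basis - {v}. 1 / (1 + (x \<bullet> b)\<^sup>2))"
  proof -
    have "wt (x + t *\<^sub>R v) = 1 / (1 + ((x + t *\<^sub>R v) \<bullet> v)\<^sup>2) *
       (\<Prod>b\<in>Basis - {v}. 1 / (1 + ((x + t *\<^sub>R v) \<bullet> b)\<^sup>2))"
      unfolding wt_def using assms(1) by (subst prod.remove[of _ v]) auto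
    also have "(\<Prod>b\<in>Basis - {v}. 1 / (1 + ((x + t *\<^sub>R v) \<bullet> b)\<^sup>2)) =
        (\<Prod>b\<in>Basis - {v}. 1 / (1 + (x \<bullet> b)\<^sup>2))"
      using assms(1) by (intro prod.cong) (auto simp: inner_add_left inner_Basis)
    also have "(x + t *\<^sub>R v) \<bullet> v = x \<bullet> v + t"
      using assms(1) by (simp add: inner_add_left)
    finally show ?thesis .
  qed
  also have "\<dots> \<le> 3 * (1 / (1 + (x \<bullet> v)\<^sup>2)) * (\<Prod>b\<in>Basis - {v}. 1 / (1 + (x \<bullet> b)\<^sup>2))"
    by (intro mult_right_mono * prod_nonneg) (simp add: less_imp_le one_plus_square_pos)
  also have "\<dots> = 3 * wt x"
    unfolding wt_def using assms(1) by (subst (2) prod.remove[of _ v]) auto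
  finally show ?thesis .
qed

section \<open>Directional derivatives and a calculus of pointwise derivative bounds\<close>

definition has_dd :: "'a::real_normed_vector \<Rightarrow> ('a \<Rightarrow> complex) \<Rightarrow> ('a \<Rightarrow> complex) \<Rightarrow> bool" where
  "has_dd v h h' \<longleftrightarrow> (\<forall>z. ((\<lambda>t::real. h (z + t *\<^sub>R v)) has_vector_derivative h' z) (at 0))"

text \<open>The bound may depend on the point, so that it also carries support information.\<close>

primrec ckb :: "nat \<Rightarrow> ('a::euclidean_space \<Rightarrow> real) \<Rightarrow> ('a \<Rightarrow> complex) \<Rightarrow> bool" where
  "ckb 0 M h \<longleftrightarrow> continuous_on UNIV h \<and> (\<forall>z. norm (h z) \<le> M z)"
| "ckb (Suc k) M h \<longleftrightarrow> continuous_on UNIV h \<and> (\<forall>z. norm (h z) \<le> M z) \<and>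
     (\<forall>v\<in>Basis. \<exists>h'. has_dd v h h' \<and> ckb k M h')"

lemma has_dd_unique: "has_dd v h h' \<Longrightarrow> dirderiv v h = h'"
  unfolding has_dd_def dirderiv_def by (auto intro!: ext vector_derivative_at)

text \<open>\<open>has_dd\<close> speaks of parameter 0 but of every base point, so moving the base
  point along the line reaches every parameter.\<close>

lemma has_dd_at:
  assumes "has_dd v h h'"
  shows "((\<lambda>t. h (z + t *\<^sub>R v)) has_vector_derivative h' (z + t *\<^sub>R v)) (at t)"
proof -
  have "((\<lambda>s. h (z + t *\<^sub>R v + s *\<^sub>R v)) has_vector_derivative h' (z + t *\<^sub>R v)) (at (t - t))"
    using assms unfolding has_dd_def by simp
  then have "((\<lambda>s. h (z + t *\<^sub>R v + s *\<^sub>R v)) \<circ> (\<lambda>s. s - t) has_vector_derivative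
      1 *\<^sub>R h' (z + t *\<^sub>R v)) (at t)"
    by (intro vector_diff_chain_at) (auto intro!: derivative_eq_intros)
  moreover have "(\<lambda>s. h (z + t *\<^sub>R v + s *\<^sub>R v)) \<circ> (\<lambda>s. s - t) = (\<lambda>t. h (z + t *\<^sub>R v))"
    by (auto simp: fun_eq_iff algebra_simps)
  ultimately show ?thesis by simp
qed

lemma has_dd_add: "has_dd v f f' \<Longrightarrow> has_dd v g g' \<Longrightarrow> has_dd v (\<lambda>z. f z + g z) (\<lambda>z. f' z + g' z)"
  unfolding has_dd_def by (auto intro!: derivative_eq_intros)

lemma has_dd_mult:
  "has_dd v f f' \<Longrightarrow> has_dd v g g' \<Longrightarrow> has_dd v (\<lambda>z. f z * g z) (\<lambda>z. f z * g' z + f' z * g z)"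
  unfolding has_dd_def
  by (auto intro!: derivative_eq_intros)

lemma has_dd_cmult: "has_dd v f f' \<Longrightarrow> has_dd v (\<lambda>z. c * f z) (\<lambda>z. c * f' z)"
  unfolding has_dd_def by (auto intro!: derivative_eq_intros)

lemma has_dd_cnj: "has_dd v f f' \<Longrightarrow> has_dd v (\<lambda>z. cnj (f z)) (\<lambda>z. cnj (f' z))"
  unfolding has_dd_def by (auto intro!: has_vector_derivative_cnj)

lemma has_dd_const: "has_dd v (\<lambda>z. c) (\<lambda>z. 0)"
  unfolding has_dd_def by auto

text \<open>Only the behaviour of \<open>A\<close> along lines matters: lines in direction
  \<open>v\<close> go to lines in direction \<open>w\<close> at speed \<open>s\<close>. Slices,
  projections, translations and dilations are all of this kind.\<close>

lemma has_dd_comp: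
  assumes "has_dd w f f'" "\<And>x t. A (x + t *\<^sub>R v) = A x + (t * s) *\<^sub>R w"
  shows "has_dd v (\<lambda>z. f (A z)) (\<lambda>z. of_real s * f' (A z))"
  unfolding has_dd_def
proof
  fix z
  have "((\<lambda>t. f (A z + t *\<^sub>R w)) has_vector_derivative f' (A z)) (at (s * 0))"
    using assms(1) by (simp add: has_dd_def)
  then have "((\<lambda>t. f (A z + t *\<^sub>R w)) \<circ> (\<lambda>t. s * t) has_vector_derivative s *\<^sub>R f' (A z)) (at 0)"
    by (intro vector_diff_chain_at) (auto intro!: derivative_eq_intros)
  moreover have "(\<lambda>t. f (A z + t *\<^sub>R w)) \<circ> (\<lambda>t. s * t) = (\<lambda>t. f (A (z + t *\<^sub>R v)))"
    by (auto simp: fun_eq_iff assms(2) mult.commute)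
  ultimately show "((\<lambda>t. f (A (z + t *\<^sub>R v))) has_vector_derivative of_real s * f' (A z)) (at 0)"
    by (simp add: scaleR_conv_of_real)
qed

lemma ckb_continuous: "ckb k M h \<Longrightarrow> continuous_on UNIV h"
  by (cases k) auto

lemma ckb_bound: "ckb k M h \<Longrightarrow> norm (h z) \<le> M z"
  by (cases k) auto

lemma ckb_bound_nonneg: "ckb k M h \<Longrightarrow> 0 \<le> M z"
  using ckb_bound[of k M h z] norm_ge_zero order_trans by blast

lemma ckb_measurable: "ckb k M h \<Longrightarrow> h \<in> borel_measurable borel"
  by (intro borel_measurable_continuous_onI ckb_continuous)

lemma ckb_dirderiv:
  assumes "ckb (Suc k) M h" "v \<in> Basis"
  shows "has_dd v h (dirderiv v h)" "ckb k M (dirderiv v h)"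
proof -
  obtain h' where "has_dd v h h'" "ckb k M h'"
    using assms by auto
  then show "has_dd v h (dirderiv v h)" "ckb k M (dirderiv v h)"
    using has_dd_unique by blast+
qed

lemma ckb_SucI:
  assumes "continuous_on UNIV h" "\<And>z. norm (h z) \<le> M z"
    "\<And>v. v \<in> Basis \<Longrightarrow> has_dd v h (h' v)" "\<And>v. v \<in> Basis \<Longrightarrow> ckb k M (h' v)"
  shows "ckb (Suc k) M h"
  using assms by auto

lemma ckb_mono: "ckb k M h \<Longrightarrow> (\<And>z. M z \<le> N z) \<Longrightarrow> ckb k N h"
proof (induction k arbitrary: h)
  case 0
  then show ?case by (auto intro: order_trans)
next
  case (Suc k)
  then show ?case
    by (auto intro: order_trans) (meson Suc.IH)
qed

lemma ckb_SucD: "ckb (Suc k) M h \<Longrightarrow> ckb k M h"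
proof (induction k arbitrary: h)
  case 0
  then show ?case by auto
next
  case (Suc k)
  show ?case
    by (rule ckb_SucI[where h' = "\<lambda>v. dirderiv v h"])
       (use Suc.prems in \<open>auto intro: ckb_continuous ckb_bound ckb_dirderiv Suc.IH simp del: ckb.simps\<close>)
qed

lemma ckb_le:
  assumes "ckb k M h" "j \<le> k" shows "ckb j M h"
  using assms(2,1)
proof (induction rule: dec_induct)
  case (step k)
  then show ?case using ckb_SucD by blast
qed simp

lemma ckb_add: "ckb k M f \<Longrightarrow> ckb k N g \<Longrightarrow> ckb k (\<lambda>z. M z + N z) (\<lambda>z. f z + g z)"
proof (induction k arbitrary: f g)
  case 0
  then show ?case by (auto intro!: continuous_intros norm_triangle_mono)
next
  case (Suc k)
  show ?case
    by (rule ckb_SucI[where h' = "\<lambda>v z. dirderiv v f z + dirderiv v g z"])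
       (use Suc.prems in \<open>auto intro!: continuous_intros has_dd_add Suc.IH norm_triangle_mono
         intro: ckb_continuous ckb_bound ckb_dirderiv simp del: ckb.simps\<close>)
qed

lemma ckb_cmult: "ckb k M f \<Longrightarrow> ckb k (\<lambda>z. norm c * M z) (\<lambda>z. c * f z)"
proof (induction k arbitrary: f)
  case 0
  then show ?case by (auto intro!: continuous_intros mult_left_mono simp: norm_mult)
next
  case (Suc k)
  show ?case
    by (rule ckb_SucI[where h' = "\<lambda>v z. c * dirderiv v f z"])
       (use Suc.prems in \<open>auto intro!: continuous_intros has_dd_cmult Suc.IH mult_left_mono
         intro: ckb_continuous ckb_bound ckb_dirderiv simp: norm_mult simp del: ckb.simps\<close>)
qed

lemma ckb_cnj: "ckb k M f \<Longrightarrow> ckb k M (\<lambda>z. cnj (f z))"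
proof (induction k arbitrary: f)
  case 0
  then show ?case by (auto intro!: continuous_intros)
next
  case (Suc k)
  show ?case
    by (rule ckb_SucI[where h' = "\<lambda>v z. cnj (dirderiv v f z)"])
       (use Suc.prems in \<open>auto intro!: continuous_intros has_dd_cnj Suc.IH
         intro: ckb_continuous ckb_bound ckb_dirderiv simp del: ckb.simps\<close>)
qed

lemma ckb_zero: "(\<And>z. 0 \<le> M z) \<Longrightarrow> ckb k M (\<lambda>z. 0)"
  by (induction k) (auto intro!: exI[of _ "\<lambda>z. 0"] has_dd_const)

lemma ckb_const: "ckb k (\<lambda>z. norm c) (\<lambda>z. c)"
proof (cases k)
  case (Suc j)
  then show ?thesis
    by (auto intro!: exI[of _ "\<lambda>z. 0"] has_dd_const ckb_zero)
qed auto

text \<open>Each derivative turns a product into two products by the Leibniz rule, whence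
  \<open>2^k\<close>. Since the bounds are pointwise, the supports of the two factors are
  intersected automatically.\<close>

lemma ckb_mult: "ckb k M f \<Longrightarrow> ckb k N g \<Longrightarrow> ckb k (\<lambda>z. 2^k * (M z * N z)) (\<lambda>z. f z * g z)"
proof (induction k arbitrary: f g)
  case 0
  then show ?case
    by (auto intro!: continuous_intros mult_mono simp: norm_mult)
       (meson norm_ge_zero order_trans)
next
  case (Suc k)
  have MN: "0 \<le> M z * N z" for z
    using Suc.prems by (auto intro!: mult_nonneg_nonneg intro: ckb_bound_nonneg simp del: ckb.simps)
  have b: "norm (f z * g z) \<le> 1 * (M z * N z)" for z
    using Suc.prems by (auto intro!: mult_mono intro: ckb_bound ckb_bound_nonneg simp: norm_mult simp del: ckb.simps)
  have b': "1 * (M z * N z) \<le> 2 ^ Suc k * (M z * N z)" for z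
    by (intro mult_right_mono MN one_le_power) simp
  show ?case
  proof (rule ckb_SucI[where h' = "\<lambda>v z. f z * dirderiv v g z + dirderiv v f z * g z"])
    show "continuous_on UNIV (\<lambda>z. f z * g z)"
      using Suc.prems by (auto intro!: continuous_intros intro: ckb_continuous simp del: ckb.simps)
    show "norm (f z * g z) \<le> 2 ^ Suc k * (M z * N z)" for z
      using b b' order_trans by blast
    fix v :: 'a assume v: "v \<in> Basis"
    show "has_dd v (\<lambda>z. f z * g z) (\<lambda>z. f z * dirderiv v g z + dirderiv v f z * g z)"
      by (rule has_dd_mult[OF ckb_dirderiv(1)[OF Suc.prems(1) v] ckb_dirderiv(1)[OF Suc.prems(2) v]])
    have "ckb k (\<lambda>z. 2^k * (M z * N z) + 2^k * (M z * N z))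
        (\<lambda>z. f z * dirderiv v g z + dirderiv v f z * g z)"
      by (intro ckb_add Suc.IH ckb_dirderiv(2)[OF Suc.prems(1) v] ckb_dirderiv(2)[OF Suc.prems(2) v]
          ckb_SucD[OF Suc.prems(1)] ckb_SucD[OF Suc.prems(2)])
    then show "ckb k (\<lambda>z. 2 ^ Suc k * (M z * N z)) (\<lambda>z. f z * dirderiv v g z + dirderiv v f z * g z)"
      by (rule ckb_mono) simp
  qed
qed

lemma ckb_comp:
  fixes A :: "'a::euclidean_space \<Rightarrow> 'b::euclidean_space"
  assumes A: "\<And>v. v \<in> Basis \<Longrightarrow> \<exists>s w. w \<in> Basis \<and> \<bar>s\<bar> \<le> S \<and> (\<forall>x t. A (x + t *\<^sub>R v) = A x + (t * s) *\<^sub>R w)"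
    and S: "1 \<le> S" and cA: "continuous_on UNIV A"
  shows "ckb k M f \<Longrightarrow> ckb k (\<lambda>x. S^k * M (A x)) (\<lambda>x. f (A x))"
proof (induction k arbitrary: f)
  case 0
  then show ?case
    using cA by (auto intro!: continuous_on_compose2[OF _ cA])
next
  case (Suc k)
  obtain s w where sw: "\<And>v. v \<in> Basis \<Longrightarrow> w v \<in> Basis \<and> \<bar>s v\<bar> \<le> S \<and>
      (\<forall>x t. A (x + t *\<^sub>R v) = A x + (t * s v) *\<^sub>R w v)"
    using A by metis
  show ?case
  proof (rule ckb_SucI[where h' = "\<lambda>v x. of_real (s v) * dirderiv (w v) f (A x)"])
    show "continuous_on UNIV (\<lambda>x. f (A x))"
      by (rule continuous_on_compose2[OF ckb_continuous[OF Suc.prems] cA]) auto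
    have "norm (f (A x)) \<le> 1 * M (A x)" for x
      using ckb_bound[OF Suc.prems] by simp
    also have "1 * M (A x) \<le> S ^ Suc k * M (A x)" for x
      using S by (intro mult_right_mono one_le_power ckb_bound_nonneg[OF Suc.prems])
    finally show "norm (f (A x)) \<le> S ^ Suc k * M (A x)" for x .
    fix v :: 'a assume v: "v \<in> Basis"
    show "has_dd v (\<lambda>x. f (A x)) (\<lambda>x. of_real (s v) * dirderiv (w v) f (A x))"
      using sw[OF v] by (intro has_dd_comp[where w = "w v"] ckb_dirderiv(1)[OF Suc.prems]) auto
    have "ckb k (\<lambda>x. norm (of_real (s v) :: complex) * (S ^ k * M (A x))) (\<lambda>x. of_real (s v) * dirderiv (w v) f (A x))"
      using sw[OF v] by (intro ckb_cmult Suc.IH ckb_dirderiv(2)[OF Suc.prems]) auto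
    then show "ckb k (\<lambda>x. S ^ Suc k * M (A x)) (\<lambda>x. of_real (s v) * dirderiv (w v) f (A x))"
    proof (rule ckb_mono)
      fix z
      show "norm (of_real (s v) :: complex) * (S ^ k * M (A z)) \<le> S ^ Suc k * M (A z)"
        using sw[OF v] S
        by (auto simp: mult.assoc intro!: mult_right_mono mult_nonneg_nonneg ckb_bound_nonneg[OF Suc.prems])
    qed
  qed
qed

text \<open>The complement of \<open>S\<close> is open, so a function vanishing there vanishes along
  a short segment around each of its points, and all derivatives inherit the support.\<close>

lemma ckb_supp:
  assumes "closed S"
  shows "ckb k M f \<Longrightarrow> (\<And>z. z \<notin> S \<Longrightarrow> f z = 0) \<Longrightarrow> ckb k (\<lambda>z. M z * indicator S z) f"
proof (induction k arbitrary: f)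
  case 0
  then show ?case by (auto simp: indicator_def)
next
  case (Suc k)
  show ?case
  proof (rule ckb_SucI[where h' = "\<lambda>v. dirderiv v f"])
    show "continuous_on UNIV f" using Suc.prems(1) by (rule ckb_continuous)
    show "norm (f z) \<le> M z * indicator S z" for z
      using ckb_bound[OF Suc.prems(1), of z] Suc.prems(2)[of z] by (auto simp: indicator_def)
    fix v :: 'a assume v: "v \<in> Basis"
    show "has_dd v f (dirderiv v f)" by (rule ckb_dirderiv[OF Suc.prems(1) v])
    show "ckb k (\<lambda>z. M z * indicator S z) (dirderiv v f)"
    proof (rule Suc.IH)
      show "ckb k M (dirderiv v f)" by (rule ckb_dirderiv[OF Suc.prems(1) v])
      fix z assume z: "z \<notin> S"
      have "open ((\<lambda>t::real. z + t *\<^sub>R v) -` (- S))"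
      proof (rule open_vimage)
        show "open (- S)" using assms by (rule open_Compl)
        show "continuous_on UNIV (\<lambda>t::real. z + t *\<^sub>R v)" by (intro continuous_intros)
      qed
      then have "\<forall>\<^sub>F t in nhds 0. z + t *\<^sub>R v \<notin> S"
        unfolding eventually_nhds using z
        by (intro exI[of _ "(\<lambda>t::real. z + t *\<^sub>R v) -` (- S)"]) simp
      then have ev: "\<forall>\<^sub>F t in nhds 0. f (z + t *\<^sub>R v) = 0"
        by (rule eventually_mono) (rule Suc.prems(2))
      have "((\<lambda>t. f (z + t *\<^sub>R v)) has_vector_derivative 0) (at 0)"
      proof (rule has_vector_derivative_cong_ev[where g = "\<lambda>t. 0", THEN iffD2])
        show "\<forall>\<^sub>F t in nhds 0. t \<in> UNIV \<longrightarrow> f (z + t *\<^sub>R v) = 0"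
          using ev by simp
        show "f (z + 0 *\<^sub>R v) = 0"
          using z Suc.prems(2)[of z] by simp
      qed simp
      then show "dirderiv v f z = 0"
        unfolding dirderiv_def by (rule vector_derivative_at)
    qed
  qed
qed

subsection \<open>Integration by parts and the Fourier transform\<close>

lemma nn_integral_lborel_translate:
  fixes c :: "'a::euclidean_space"
  assumes "f \<in> borel_measurable borel"
  shows "(\<integral>\<^sup>+x. f (c + x) \<partial>lborel) = (\<integral>\<^sup>+x. f x \<partial>lborel)"
proof -
  have "(\<integral>\<^sup>+x. f x \<partial>lborel) = (\<integral>\<^sup>+x. f x \<partial>distr lborel borel ((+) c))"
    by (simp add: lborel_distr_plus)
  also have "\<dots> = (\<integral>\<^sup>+x. f (c + x) \<partial>lborel)"
    using assms by (intro nn_integral_distr) auto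
  finally show ?thesis by simp
qed

lemma
  fixes f :: "'a::euclidean_space \<Rightarrow> 'b::{banach, second_countable_topology}" and c :: 'a
  assumes "f \<in> borel_measurable borel"
  shows lborel_integral_translate: "(LINT x|lborel. f (c + x)) = (LINT x|lborel. f x)"
    and lborel_integrable_translate: "integrable lborel (\<lambda>x. f (c + x)) \<longleftrightarrow> integrable lborel f"
proof -
  have "(LINT x|lborel. f x) = (LINT x|distr lborel borel ((+) c). f x)"
    by (simp add: lborel_distr_plus)
  also have "\<dots> = (LINT x|lborel. f (c + x))"
    using assms by (intro integral_distr) auto
  finally show "(LINT x|lborel. f (c + x)) = (LINT x|lborel. f x)" by simp
  have "integrable lborel f \<longleftrightarrow> integrable (distr lborel borel ((+) c)) f"
    by (simp add: lborel_distr_plus)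
  also have "\<dots> \<longleftrightarrow> integrable lborel (\<lambda>x. f (c + x))"
    using assms by (intro integrable_distr_eq) auto
  finally show "integrable lborel (\<lambda>x. f (c + x)) \<longleftrightarrow> integrable lborel f" by simp
qed

lemma nn_integral_lborel_scale:
  fixes f :: "'a::euclidean_space \<Rightarrow> ennreal"
  assumes [measurable]: "f \<in> borel_measurable borel" and "c > 0"
  shows "(\<integral>\<^sup>+x. f x \<partial>lborel) = ennreal (c ^ DIM('a)) * (\<integral>\<^sup>+x. f (c *\<^sub>R x) \<partial>lborel)"
  using assms(2) by (subst lborel_affine[of c 0])
    (simp_all add: nn_integral_density nn_integral_distr nn_integral_cmult)

lemma lborel_integral_scale:
  fixes f :: "'a::euclidean_space \<Rightarrow> 'b::{banach, second_countable_topology}"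
  assumes [measurable]: "f \<in> borel_measurable borel" and "c > 0"
  shows "(LINT x|lborel. f x) = (c ^ DIM('a)) *\<^sub>R (LINT x|lborel. f (c *\<^sub>R x))"
  using assms(2) by (subst lborel_affine[of c 0])
    (simp_all add: integral_density integral_distr)

lemma integrable_wt_bound:
  assumes "\<And>z. norm (h z) \<le> C * wt z" "h \<in> borel_measurable borel"
  shows "integrable lborel (h :: 'a::euclidean_space \<Rightarrow> 'b::{banach, second_countable_topology})"
proof (rule Bochner_Integration.integrable_bound)
  show "integrable lborel (\<lambda>z::'a. C * wt z)" by (intro integrable_mult_right integrable_wt)
  show "AE z in lborel. norm (h z) \<le> norm (C * wt z)"
    using assms(1) order_trans[OF assms(1) abs_ge_self] by (auto simp: real_norm_def)
qed (use assms in simp)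

lemma ckb_integrable: "ckb k (\<lambda>z. C * wt z) h \<Longrightarrow> integrable lborel h"
  by (rule integrable_wt_bound[where C = C]) (auto intro: ckb_bound ckb_measurable simp del: ckb.simps)

lemma has_dd_diff_bound:
  assumes "has_dd v h h'" "\<And>s. s \<in> {0..t} \<Longrightarrow> norm (h' (z + s *\<^sub>R v)) \<le> B" "0 \<le> t"
  shows "norm (h (z + t *\<^sub>R v) - h z) \<le> B * t"
proof -
  have "norm (h (z + t *\<^sub>R v) - h (z + 0 *\<^sub>R v)) \<le> B * norm (t - 0)"
  proof (rule differentiable_bound[where S = "{0..t}" and f = "\<lambda>t. h (z + t *\<^sub>R v)"
        and f' = "\<lambda>s r. r *\<^sub>R h' (z + s *\<^sub>R v)"])
    fix s assume s: "s \<in> {0..t}"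
    show "((\<lambda>t. h (z + t *\<^sub>R v)) has_derivative (\<lambda>r. r *\<^sub>R h' (z + s *\<^sub>R v))) (at s within {0..t})"
      using has_dd_at[OF assms(1), of z s] unfolding has_vector_derivative_def
      by (rule has_derivative_at_withinI)
    show "onorm (\<lambda>r. r *\<^sub>R h' (z + s *\<^sub>R v)) \<le> B"
      using assms(2)[OF s] by (intro onorm_le) (simp add: mult_left_mono mult.commute[of B])
  qed (use assms(3) in auto)
  then show ?thesis using assms(3) by simp
qed

text \<open>By translation invariance every difference quotient of \<open>h\<close> has integral 0;
  dominated convergence carries this over to the derivative.\<close>

lemma integral_dirderiv_zero:
  fixes h :: "'a::euclidean_space \<Rightarrow> complex"
  assumes h: "ckb (Suc 0) (\<lambda>z. C * wt z) h" and v: "v \<in> Basis"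
  shows "(LINT x|lborel. dirderiv v h x) = 0"
proof -
  \<comment> \<open>Step sizes tending to 0 that never exceed 1, so that \<open>wt_shift\<close>
    gives the common majorant \<open>3 * C * wt x\<close>.\<close>
  define e where "e n = inverse (real (Suc n))" for n
  have e: "0 < e n" "e n \<le> 1" for n
    by (auto simp: e_def divide_simps)
  define s where "s n x = (1 / e n) *\<^sub>R (h (x + e n *\<^sub>R v) - h x)" for n x
  have [measurable]: "h \<in> borel_measurable borel" using h by (rule ckb_measurable)
  have dd: "has_dd v h (dirderiv v h)" and ck: "ckb 0 (\<lambda>z. C * wt z) (dirderiv v h)"
    using ckb_dirderiv[OF h v] by auto
  have [measurable]: "dirderiv v h \<in> borel_measurable borel" using ck by (rule ckb_measurable)
  have C: "0 \<le> C" using ckb_bound_nonneg[OF h, of 0] by simp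
  have ih: "integrable lborel h" using h by (rule ckb_integrable)
  have "(LINT x|lborel. s n x) = 0" for n
  proof -
    have "(LINT x|lborel. s n x) =
        (1 / e n) *\<^sub>R ((LINT x|lborel. h (e n *\<^sub>R v + x)) - (LINT x|lborel. h x))"
      unfolding s_def using ih
      by (subst integral_scaleR_right, subst Bochner_Integration.integral_diff)
         (simp_all add: add.commute[of _ "e n *\<^sub>R v"] lborel_integrable_translate)
    then show ?thesis by (simp add: lborel_integral_translate)
  qed
  moreover have "(\<lambda>n. LINT x|lborel. s n x) \<longlonglongrightarrow> (LINT x|lborel. dirderiv v h x)"
  proof (rule integral_dominated_convergence[where w = "\<lambda>x. 3 * C * wt x"])
    show "dirderiv v h \<in> borel_measurable lborel" by simp
    show "s n \<in> borel_measurable lborel" for n unfolding s_def by simp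
    show "integrable lborel (\<lambda>x::'a. 3 * C * wt x)"
      by (intro integrable_mult_right integrable_wt)
    show "AE x in lborel. (\<lambda>n. s n x) \<longlonglongrightarrow> dirderiv v h x"
    proof (rule AE_I2)
      fix x
      have "((\<lambda>t. h (x + t *\<^sub>R v)) has_vector_derivative dirderiv v h x) (at 0)"
        using dd unfolding has_dd_def by blast
      then have "(\<lambda>t. norm (h (x + t *\<^sub>R v) - h x - t *\<^sub>R dirderiv v h x) / norm t) \<midarrow>0\<rightarrow> 0"
        unfolding has_vector_derivative_def has_derivative_at by simp
      moreover have "\<forall>\<^sub>F t in at 0. norm (h (x + t *\<^sub>R v) - h x - t *\<^sub>R dirderiv v h x) / norm t =
          norm ((1 / t) *\<^sub>R (h (x + t *\<^sub>R v) - h x) - dirderiv v h x)"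
      proof -
        have "norm (u - t *\<^sub>R w) / norm t = norm ((1 / t) *\<^sub>R u - w)" if "t \<noteq> 0" for t :: real and u w :: complex
        proof -
          have "norm (u - t *\<^sub>R w) = norm (t *\<^sub>R ((1 / t) *\<^sub>R u - w))"
            using that by (simp add: scaleR_diff_right)
          then show ?thesis using that by simp
        qed
        then show ?thesis by (auto simp: eventually_at_filter)
      qed
      ultimately have "(\<lambda>t. norm ((1 / t) *\<^sub>R (h (x + t *\<^sub>R v) - h x) - dirderiv v h x)) \<midarrow>0\<rightarrow> 0"
        by (simp cong: filterlim_cong add: tendsto_cong)
      then have *: "((\<lambda>t. (1 / t) *\<^sub>R (h (x + t *\<^sub>R v) - h x)) \<longlongrightarrow> dirderiv v h x) (at 0)"
        by (rule Lim_null[THEN iffD2, OF tendsto_norm_zero_cancel])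
      have "filterlim e (at 0) sequentially"
        unfolding filterlim_at e_def using LIMSEQ_inverse_real_of_nat by auto
      from filterlim_compose[OF * this] show "(\<lambda>n. s n x) \<longlonglongrightarrow> dirderiv v h x"
        by (simp add: s_def)
    qed
    show "AE x in lborel. norm (s n x) \<le> 3 * C * wt x" for n
    proof (rule AE_I2)
      fix x
      have "norm (h (x + e n *\<^sub>R v) - h x) \<le> (3 * C * wt x) * e n"
      proof (rule has_dd_diff_bound[OF dd])
        fix t assume t: "t \<in> {0..e n}"
        have "norm (dirderiv v h (x + t *\<^sub>R v)) \<le> C * wt (x + t *\<^sub>R v)"
          by (rule ckb_bound[OF ck])
        also have "\<dots> \<le> C * (3 * wt x)"
          using t e[of n] C v by (intro mult_left_mono wt_shift) auto
        finally show "norm (dirderiv v h (x + t *\<^sub>R v)) \<le> 3 * C * wt x" by simp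
      qed (use e[of n] in simp)
      then show "norm (s n x) \<le> 3 * C * wt x"
        using e[of n] by (simp add: s_def norm_scaleR pos_divide_le_eq del: scaleR_diff_right)
    qed
  qed
  ultimately show ?thesis
    using LIMSEQ_unique by (simp add: LIMSEQ_const_iff)
qed

text \<open>The transform \<open>fourier\<close> on an arbitrary Euclidean space, so that it also
  applies to functions of a pair of variables.\<close>

definition ft :: "('a::euclidean_space \<Rightarrow> complex) \<Rightarrow> 'a \<Rightarrow> complex" where
  "ft f y = (LINT x|lborel. exp (- \<i> * complex_of_real (x \<bullet> y)) * f x)"

lemma norm_exp_i [simp]: "norm (exp (- (\<i> * complex_of_real t))) = 1"
  by (simp add: norm_exp_eq_Re)

lemma norm_exp_i' [simp]: "norm (exp (\<i> * complex_of_real t)) = 1"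
  by (simp add: norm_exp_eq_Re)

lemma has_dd_exp:
  "has_dd v (\<lambda>x. exp (\<i> * complex_of_real (x \<bullet> y))) (\<lambda>x. (\<i> * complex_of_real (v \<bullet> y)) * exp (\<i> * complex_of_real (x \<bullet> y)))"
  unfolding has_dd_def
proof
  fix z
  define d where "d = \<i> * complex_of_real (v \<bullet> y)"
  have "((\<lambda>t. exp (t *\<^sub>R d)) has_vector_derivative exp (0 *\<^sub>R d) * d) (at 0)"
    by (rule exp_scaleR_has_vector_derivative_right)
  then have "((\<lambda>t. exp (\<i> * of_real (z \<bullet> y)) * exp (t *\<^sub>R d)) has_vector_derivative
      exp (\<i> * of_real (z \<bullet> y)) * (exp (0 *\<^sub>R d) * d)) (at 0)"
    by (rule has_vector_derivative_mult_right)
  moreover have "exp (\<i> * of_real (z \<bullet> y)) * exp (t *\<^sub>R d) =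
      exp (\<i> * complex_of_real ((z + t *\<^sub>R v) \<bullet> y))" for t
    unfolding exp_add[symmetric]
    by (simp add: d_def inner_add_left scaleR_conv_of_real algebra_simps)
  ultimately show "((\<lambda>t. exp (\<i> * complex_of_real ((z + t *\<^sub>R v) \<bullet> y))) has_vector_derivative
      \<i> * complex_of_real (v \<bullet> y) * exp (\<i> * complex_of_real (z \<bullet> y))) (at 0)"
    by (simp add: d_def mult.commute)
qed

text \<open>The bound grows with \<open>y\<close>. It serves only to justify integrations by parts
  and never enters the value of an estimate.\<close>

lemma ckb_exp:
  fixes y :: "'a::euclidean_space"
  shows "ckb k (\<lambda>x. (1 + norm y) ^ k) (\<lambda>x. exp (\<i> * complex_of_real (x \<bullet> y)))"
proof (induction k)
  case 0
  show ?case by (auto intro!: continuous_intros)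
next
  case (Suc k)
  show ?case
  proof (rule ckb_SucI)
    show "continuous_on UNIV (\<lambda>x. exp (\<i> * complex_of_real (x \<bullet> y)))"
      by (intro continuous_intros)
    show "norm (exp (\<i> * complex_of_real (x \<bullet> y))) \<le> (1 + norm y) ^ Suc k" for x
      by (simp del: power_Suc)
    show "has_dd v (\<lambda>x. exp (\<i> * complex_of_real (x \<bullet> y))) (\<lambda>x. (\<i> * complex_of_real (v \<bullet> y)) * exp (\<i> * complex_of_real (x \<bullet> y)))" for v
      by (rule has_dd_exp)
    fix v :: 'a assume v: "v \<in> Basis"
    show "ckb k (\<lambda>x. (1 + norm y) ^ Suc k) (\<lambda>x. (\<i> * complex_of_real (v \<bullet> y)) * exp (\<i> * complex_of_real (x \<bullet> y)))"
    proof (rule ckb_mono[OF ckb_cmult[OF Suc]])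
      have "\<bar>v \<bullet> y\<bar> \<le> norm y" using Basis_le_norm[OF v, of y] by (simp add: inner_commute)
      then show "norm (\<i> * complex_of_real (v \<bullet> y)) * (1 + norm y) ^ k \<le> (1 + norm y) ^ Suc k"
        by (simp add: norm_mult)
    qed
  qed
qed

text \<open>The zeroth-order term keeps the multiplier
  \<open>1 + \<i> * of_real (y \<bullet> v)\<close> away from zero, so that it can be divided out;
  its squared modulus is one factor of \<open>1 / wt y\<close>.\<close>

definition dp :: "'a::euclidean_space \<Rightarrow> ('a \<Rightarrow> complex) \<Rightarrow> 'a \<Rightarrow> complex" where
  "dp v h z = h z + dirderiv v h z"

lemma ckb_dp:
  assumes "ckb (Suc k) M h" "v \<in> Basis"
  shows "ckb k (\<lambda>z. 2 * M z) (dp v h)"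
proof -
  have "ckb k (\<lambda>z. M z + M z) (\<lambda>z. h z + dirderiv v h z)"
    by (intro ckb_add ckb_SucD[OF assms(1)] ckb_dirderiv(2)[OF assms])
  then show ?thesis
    by (simp add: dp_def[abs_def])
qed

text \<open>The total derivative of the exponential times \<open>h\<close> integrates to 0, and the
  product rule moves the derivative from \<open>h\<close> to the exponential.\<close>

lemma ft_dp:
  fixes h :: "'a::euclidean_space \<Rightarrow> complex"
  assumes h: "ckb (Suc 0) (\<lambda>z. C * wt z) h" and v: "v \<in> Basis"
  shows "ft (dp v h) y = (1 + \<i> * of_real (y \<bullet> v)) * ft h y"
proof -
  define E where "E x = exp (\<i> * complex_of_real (x \<bullet> (- y)))" for x :: 'a
  define c where "c = \<i> * complex_of_real (v \<bullet> (- y))"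
  have ckE: "ckb k (\<lambda>x. (1 + norm (- y)) ^ k) E" for k
    unfolding E_def[abs_def] by (rule ckb_exp)
  have dE: "has_dd v E (\<lambda>x. c * E x)"
    unfolding E_def[abs_def] c_def by (rule has_dd_exp)
  have dd: "has_dd v h (dirderiv v h)" and ck: "ckb 0 (\<lambda>z. C * wt z) (dirderiv v h)"
    using ckb_dirderiv[OF h v] by auto
  have i1: "integrable lborel (\<lambda>x. E x * h x)"
  proof (rule integrable_wt_bound)
    show "norm (E z * h z) \<le> C * wt z" for z
      using ckb_bound[OF h, of z] by (simp add: norm_mult E_def)
    show "(\<lambda>x. E x * h x) \<in> borel_measurable borel"
      using ckb_measurable[OF h] ckb_measurable[OF ckE] by simp
  qed
  have i2: "integrable lborel (\<lambda>x. E x * dirderiv v h x)"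
  proof (rule integrable_wt_bound)
    show "norm (E z * dirderiv v h z) \<le> C * wt z" for z
      using ckb_bound[OF ck, of z] by (simp add: norm_mult E_def)
    show "(\<lambda>x. E x * dirderiv v h x) \<in> borel_measurable borel"
      using ckb_measurable[OF ck] ckb_measurable[OF ckE] by simp
  qed
  have "has_dd v (\<lambda>x. E x * h x) (\<lambda>x. E x * dirderiv v h x + c * E x * h x)"
    by (rule has_dd_mult[OF dE dd])
  then have eq: "dirderiv v (\<lambda>x. E x * h x) = (\<lambda>x. E x * dirderiv v h x + c * (E x * h x))"
    by (subst has_dd_unique) (auto simp: mult.assoc)
  have "ckb (Suc 0) (\<lambda>z. 2 ^ Suc 0 * ((1 + norm (- y)) ^ Suc 0 * (C * wt z))) (\<lambda>x. E x * h x)"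
    by (rule ckb_mult[OF ckE h])
  then have "ckb (Suc 0) (\<lambda>z. (2 * (1 + norm y) * C) * wt z) (\<lambda>x. E x * h x)"
    by (rule ckb_mono) (simp add: algebra_simps)
  from integral_dirderiv_zero[OF this v]
  have "(LINT x|lborel. E x * dirderiv v h x) + c * (LINT x|lborel. E x * h x) = 0"
    unfolding eq using i1 i2 by simp
  moreover have "ft (dp v h) y = (LINT x|lborel. E x * h x) + (LINT x|lborel. E x * dirderiv v h x)"
    using i1 i2 by (simp add: ft_def dp_def E_def distrib_left)
  moreover have "ft h y = (LINT x|lborel. E x * h x)"
    by (simp add: ft_def E_def)
  moreover have "c = - (\<i> * of_real (y \<bullet> v))" by (simp add: c_def inner_commute)
  ultimately show ?thesis by (simp add: algebra_simps add_eq_0_iff)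
qed

section \<open>The differential operator whose multiplier is the reciprocal weight in
  modulus\<close>

definition basis_list :: "'a::euclidean_space list" where
  "basis_list = (SOME l. distinct l \<and> set l = Basis)"

lemma basis_list: "distinct (basis_list :: 'a::euclidean_space list)" "set (basis_list :: 'a::euclidean_space list) = Basis"
proof -
  obtain l where "distinct l \<and> set l = (Basis :: 'a set)"
    using finite_distinct_list[OF finite_Basis] by blast
  then have "distinct (basis_list :: 'a list) \<and> set (basis_list :: 'a list) = Basis"
    unfolding basis_list_def by (rule someI)
  then show "distinct (basis_list :: 'a list)" "set (basis_list :: 'a list) = Basis" by auto
qed

lemma length_basis_list: "length (basis_list :: 'a::euclidean_space list) = DIM('a)"
  using distinct_card[OF basis_list(1)] basis_list(2) by metis

text \<open>\<open>lop\<close> has the Fourier multiplier \<open>pw\<close>, whose modulus is \<open>1 / wt\<close>.\<close>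

definition lop :: "('a::euclidean_space \<Rightarrow> complex) \<Rightarrow> 'a \<Rightarrow> complex" where
  "lop h = foldr dp (basis_list @ basis_list) h"

definition pw :: "'a::euclidean_space \<Rightarrow> complex" where
  "pw y = (\<Prod>b\<in>Basis. (1 + \<i> * of_real (y \<bullet> b))\<^sup>2)"

lemma ckb_foldr_dp:
  "ckb (length bs + k) M h \<Longrightarrow> set bs \<subseteq> Basis \<Longrightarrow> ckb k (\<lambda>z. 2 ^ length bs * M z) (foldr dp bs h)"
proof (induction bs arbitrary: k)
  case Nil
  then show ?case by simp
next
  case (Cons b bs)
  have "ckb (Suc k) (\<lambda>z. 2 ^ length bs * M z) (foldr dp bs h)"
    using Cons.prems by (intro Cons.IH) (simp_all del: ckb.simps)
  then have "ckb k (\<lambda>z. 2 * (2 ^ length bs * M z)) (dp b (foldr dp bs h))"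
    by (rule ckb_dp) (use Cons.prems in auto)
  then show ?case by (simp add: mult.assoc)
qed

lemma ft_foldr_dp:
  "ckb (length bs) (\<lambda>z. C * wt z) h \<Longrightarrow> set bs \<subseteq> Basis \<Longrightarrow>
    ft (foldr dp bs h) y = prod_list (map (\<lambda>b. 1 + \<i> * of_real (y \<bullet> b)) bs) * ft h y"
proof (induction bs)
  case Nil
  then show ?case by simp
next
  case (Cons b bs)
  have "ckb (Suc 0) (\<lambda>z. 2 ^ length bs * (C * wt z)) (foldr dp bs h)"
    using Cons.prems by (intro ckb_foldr_dp) (simp_all del: ckb.simps)
  then have "ckb (Suc 0) (\<lambda>z. (2 ^ length bs * C) * wt z) (foldr dp bs h)"
    by (simp only: mult.assoc)
  then have "ft (dp b (foldr dp bs h)) y = (1 + \<i> * of_real (y \<bullet> b)) * ft (foldr dp bs h) y"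
    by (rule ft_dp) (use Cons.prems in auto)
  also have "ft (foldr dp bs h) y = prod_list (map (\<lambda>b. 1 + \<i> * of_real (y \<bullet> b)) bs) * ft h y"
    using Cons.prems by (intro Cons.IH, intro ckb_SucD[of "length bs"]) (simp_all del: ckb.simps)
  finally show ?case by (simp add: mult.assoc)
qed

lemma ckb_lop:
  fixes h :: "'a::euclidean_space \<Rightarrow> complex"
  assumes "ckb (2 * DIM('a) + k) M h"
  shows "ckb k (\<lambda>z. 4 ^ DIM('a) * M z) (lop h)"
proof -
  have "ckb k (\<lambda>z. 2 ^ length (basis_list @ basis_list :: 'a list) * M z) (lop h)"
    unfolding lop_def using assms by (intro ckb_foldr_dp) (simp_all add: length_basis_list basis_list mult_2)
  then show ?thesis
    by (simp add: length_basis_list power_add power_mult_distrib[symmetric])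
qed

lemma pw_prod_list: "pw (y :: 'a::euclidean_space) =
    prod_list (map (\<lambda>b. 1 + \<i> * of_real (y \<bullet> b)) (basis_list @ basis_list))"
proof -
  have "(\<Prod>b\<in>Basis. 1 + \<i> * of_real (y \<bullet> b)) = prod_list (map (\<lambda>b. 1 + \<i> * of_real (y \<bullet> b)) basis_list)"
    using prod.distinct_set_conv_list[OF basis_list(1), of "\<lambda>b. 1 + \<i> * of_real (y \<bullet> b)"]
    by (simp add: basis_list)
  then show ?thesis
    by (simp add: pw_def power2_eq_square prod.distrib)
qed

lemma norm_pw: "norm (pw y) = 1 / wt y"
proof -
  have "(norm (1 + \<i> * complex_of_real t))\<^sup>2 = 1 + t\<^sup>2" for t
    by (simp add: cmod_power2)
  then show ?thesis
    by (simp add: pw_def wt_def prod_norm[symmetric] norm_power prod_dividef)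
qed

lemma pw_nz [simp]: "pw y \<noteq> 0"
  using norm_pw[of y] wt_pos[of y] by (auto simp del: wt_pos)

lemma continuous_on_pw [continuous_intros]: "continuous_on S f \<Longrightarrow> continuous_on S (\<lambda>x. pw (f x))"
  unfolding pw_def by (intro continuous_intros)

lemma pw_measurable [measurable]: "pw \<in> borel_measurable borel"
  by (intro borel_measurable_continuous_onI continuous_intros)

lemma pw_Pair: "pw (x, y) = pw x * pw y"
proof -
  have "pw (x, y) = (\<Prod>b\<in>(\<lambda>u. (u, 0)) ` Basis. (1 + \<i> * of_real ((x, y) \<bullet> b))\<^sup>2) *
      (\<Prod>b\<in>(\<lambda>v. (0, v)) ` Basis. (1 + \<i> * of_real ((x, y) \<bullet> b))\<^sup>2)"
    unfolding pw_def Basis_prod_def by (rule prod.union_disjoint) auto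
  also have "\<dots> = pw x * pw y"
    by (simp add: pw_def prod.reindex inj_on_def)
  finally show ?thesis .
qed

lemma ft_lop:
  fixes h :: "'a::euclidean_space \<Rightarrow> complex"
  assumes "ckb (2 * DIM('a)) (\<lambda>z. C * wt z) h"
  shows "ft (lop h) y = pw y * ft h y"
  unfolding lop_def pw_prod_list
  using assms by (intro ft_foldr_dp) (simp_all add: length_basis_list basis_list mult_2 del: ckb.simps)

lemma norm_ft_le:
  fixes f :: "'a::euclidean_space \<Rightarrow> complex"
  assumes "\<And>x. norm (f x) \<le> M x" "integrable lborel M"
  shows "norm (ft f y) \<le> (LINT x|lborel. M x)"
proof -
  have "norm (ft f y) \<le> (LINT x|lborel. norm (exp (- \<i> * complex_of_real (x \<bullet> y)) * f x))"
    unfolding ft_def by (rule integral_norm_bound)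
  also have "\<dots> \<le> (LINT x|lborel. M x)"
    using assms by (intro integral_mono') (auto simp: norm_mult intro: order_trans[OF norm_ge_zero])
  finally show ?thesis .
qed

text \<open>The transform of \<open>lop h\<close> is \<open>pw\<close> times that of
  \<open>h\<close> and is bounded by an L^1 norm. The constant \<open>C\<close> only secures
  integrability; the estimate contains the integral of \<open>M\<close>, so a small support of
  \<open>h\<close> is rewarded.\<close>

lemma ft_decay:
  fixes h :: "'a::euclidean_space \<Rightarrow> complex"
  assumes h: "ckb (2 * DIM('a)) M h" and M: "\<And>z. M z \<le> C * wt z" "M \<in> borel_measurable borel"
  shows "norm (ft h y) \<le> 4 ^ DIM('a) * (LINT x|lborel. M x) * wt y"
proof -
  have M0: "0 \<le> M z" for z using ckb_bound_nonneg[OF h] .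
  have iM: "integrable lborel M"
    by (rule integrable_wt_bound[where C = C]) (use M M0 in auto)
  have "ckb 0 (\<lambda>z. 4 ^ DIM('a) * M z) (lop h)"
    using h by (intro ckb_lop) (simp only: add_0_right)
  then have "norm (ft (lop h) y) \<le> (LINT x|lborel. 4 ^ DIM('a) * M x)"
    using iM by (intro norm_ft_le) auto
  moreover have "ft (lop h) y = pw y * ft h y"
    by (rule ft_lop[where C = C]) (rule ckb_mono[OF h M(1)])
  ultimately have "norm (ft h y) / wt y \<le> 4 ^ DIM('a) * (LINT x|lborel. M x)"
    by (simp add: norm_mult norm_pw)
  then show ?thesis
    by (simp only: pos_divide_le_eq[OF wt_pos])
qed

subsection \<open>Cutoffs on boxes\<close>

text \<open>A ball of the sup norm: membership of a pair splits into membership of its components,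
  and the volume is explicit.\<close>

definition qbox :: "real \<Rightarrow> 'a::euclidean_space set" where
  "qbox R = {z. \<forall>b\<in>Basis. \<bar>z \<bullet> b\<bar> \<le> R}"

lemma qbox_cbox: "qbox R = cbox (- R *\<^sub>R One) (R *\<^sub>R One)"
  by (auto simp: qbox_def mem_box abs_le_iff minus_le_iff)

lemma closed_qbox: "closed (qbox R)" and compact_qbox: "compact (qbox R)"
  by (simp_all only: qbox_cbox closed_cbox compact_cbox)

lemma qbox_measurable [measurable]: "qbox R \<in> sets borel"
  by (simp add: qbox_cbox)

lemma emeasure_qbox: "0 \<le> R \<Longrightarrow> emeasure lborel (qbox R :: 'a::euclidean_space set) = ennreal ((2 * R) ^ DIM('a))"
proof -
  assume R: "0 \<le> R"
  have "(\<Prod>b\<in>(Basis :: 'a set). (R *\<^sub>R One - - R *\<^sub>R One) \<bullet> b) = (\<Prod>b\<in>(Basis :: 'a set). 2 * R)"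
    by (rule prod.cong) (auto simp: inner_add_left)
  then show ?thesis
    unfolding qbox_cbox using R by (subst emeasure_lborel_cbox) auto
qed

lemma qbox_mono: "R \<le> R' \<Longrightarrow> qbox R \<subseteq> qbox R'"
  by (auto simp: qbox_def)

lemma mem_qbox_scale: "0 < c \<Longrightarrow> c *\<^sub>R z \<in> qbox R \<longleftrightarrow> z \<in> qbox (R / c)"
  by (simp add: qbox_def abs_mult field_simps)

lemma mem_qbox_Pair: "(x, y) \<in> qbox R \<longleftrightarrow> x \<in> qbox R \<and> y \<in> qbox R"
proof -
  have "(x, y) \<in> qbox R \<longleftrightarrow> (\<forall>b\<in>(\<lambda>u. (u, 0)) ` Basis \<union> (\<lambda>v. (0, v)) ` Basis. \<bar>(x, y) \<bullet> b\<bar> \<le> R)"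
    by (simp only: qbox_def Basis_prod_def mem_Collect_eq)
  also have "\<dots> \<longleftrightarrow> x \<in> qbox R \<and> y \<in> qbox R"
    by (simp add: qbox_def ball_Un)
  finally show ?thesis .
qed

lemma indicator_qbox_le_wt:
  fixes z :: "'a::euclidean_space"
  shows "indicator (qbox R) z \<le> (1 + R\<^sup>2) ^ DIM('a) * wt z"
proof (cases "z \<in> qbox R")
  case True
  have "(\<Prod>b\<in>(Basis::'a set). 1 / (1 + R\<^sup>2)) \<le> wt z"
    unfolding wt_def
  proof (intro prod_mono conjI)
    fix b :: 'a assume "b \<in> Basis"
    then have "\<bar>z \<bullet> b\<bar>\<^sup>2 \<le> R\<^sup>2" using True by (intro power_mono) (auto simp: qbox_def)
    then show "1 / (1 + R\<^sup>2) \<le> 1 / (1 + (z \<bullet> b)\<^sup>2)"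
      by (intro divide_left_mono) (auto simp: one_plus_square_pos)
  qed (simp add: less_imp_le one_plus_square_pos)
  then have "1 / (1 + R\<^sup>2) ^ DIM('a) \<le> wt z" by (simp add: power_divide)
  then show ?thesis using True by (simp add: pos_divide_le_eq one_plus_square_pos mult.commute)
qed simp

text \<open>Each of the finitely many derivatives is continuous and vanishes off \<open>S\<close>,
  hence is bounded. Smoothness of a cutoff can thus be proved with an arbitrary bound
  \<open>M\<close>, which is replaced by a constant at the very end.\<close>

lemma ckb_compact:
  assumes "compact S"
  shows "ckb k M h \<Longrightarrow> (\<And>z. z \<notin> S \<Longrightarrow> h z = 0) \<Longrightarrow> \<exists>C\<ge>0. ckb k (\<lambda>z. C * indicator S z) h"
proof -
  have bdd: "\<exists>C\<ge>0. \<forall>z. norm (h z) \<le> C * indicator S z"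
    if "continuous_on UNIV h" "\<And>z. z \<notin> S \<Longrightarrow> h z = 0" for h :: "'a \<Rightarrow> complex"
  proof -
    have "bounded (h ` S)"
      using that(1) assms by (intro compact_imp_bounded compact_continuous_image) (rule continuous_on_subset, auto)
    then obtain C where "\<forall>z\<in>S. norm (h z) \<le> C" unfolding bounded_iff by auto
    then have "norm (h z) \<le> max 0 C * indicator S z" for z
      using that(2)[of z] by (cases "z \<in> S") (auto simp: le_max_iff_disj)
    then show ?thesis by (intro exI[of _ "max 0 C"]) simp
  qed
  show "ckb k M h \<Longrightarrow> (\<And>z. z \<notin> S \<Longrightarrow> h z = 0) \<Longrightarrow> \<exists>C\<ge>0. ckb k (\<lambda>z. C * indicator S z) h"
  proof (induction k arbitrary: h)
    case 0
    then show ?case using bdd[of h] by simp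
  next
    case (Suc k)
    have "\<exists>C\<ge>0. ckb k (\<lambda>z. C * indicator S z) (dirderiv v h)" if v: "v \<in> Basis" for v
    proof (rule Suc.IH)
      have "ckb (Suc k) (\<lambda>z. M z * indicator S z) h"
        using assms Suc.prems by (intro ckb_supp compact_imp_closed)
      then have *: "ckb k (\<lambda>z. M z * indicator S z) (dirderiv v h)"
        using v by (rule ckb_dirderiv(2))
      show "ckb k M (dirderiv v h)" by (rule ckb_dirderiv(2)[OF Suc.prems(1) v])
      show "dirderiv v h z = 0" if "z \<notin> S" for z
        using ckb_bound[OF *, of z] that by simp
    qed
    then obtain C where C: "\<And>v. v \<in> Basis \<Longrightarrow> 0 \<le> C v \<and> ckb k (\<lambda>z. C v * indicator S z) (dirderiv v h)"
      by metis
    obtain C0 where C0: "0 \<le> C0" "\<And>z. norm (h z) \<le> C0 * indicator S z"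
      using bdd[OF ckb_continuous[OF Suc.prems(1)] Suc.prems(2)] by blast
    define D where "D = C0 + sum C Basis"
    have D: "C0 \<le> D" "0 \<le> D" "\<And>v. v \<in> Basis \<Longrightarrow> C v \<le> D"
      using C C0(1) member_le_sum[of _ Basis C] by (auto simp: D_def intro!: sum_nonneg add_nonneg_nonneg add_increasing)
    have "ckb (Suc k) (\<lambda>z. D * indicator S z) h"
    proof (rule ckb_SucI[where h' = "\<lambda>v. dirderiv v h"])
      show "continuous_on UNIV h" using Suc.prems(1) by (rule ckb_continuous)
      show "norm (h z) \<le> D * indicator S z" for z
        using C0(2)[of z] mult_right_mono[OF D(1), of "indicator S z"] by simp
      fix v :: 'a assume v: "v \<in> Basis"
      show "has_dd v h (dirderiv v h)" by (rule ckb_dirderiv(1)[OF Suc.prems(1) v])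
      show "ckb k (\<lambda>z. D * indicator S z) (dirderiv v h)"
        by (rule ckb_mono[OF C[OF v, THEN conjunct2]]) (intro mult_right_mono D(3) v, simp)
    qed
    then show ?case using D(2) by blast
  qed
qed

section \<open>A step function of finite smoothness on the line and the product cutoff\<close>

lemma has_dd_real:
  assumes "\<And>t. (f has_real_derivative f' t) (at t)"
  shows "has_dd (1::real) (\<lambda>t. of_real (f t)) (\<lambda>t. of_real (f' t))"
  unfolding has_dd_def
proof
  fix z :: real
  have "(f has_real_derivative f' (0 + z)) (at (0 + z))" using assms by simp
  then have "((\<lambda>t. f (t + z)) has_real_derivative f' (0 + z)) (at 0)"
    unfolding DERIV_shift .
  then show "((\<lambda>t. complex_of_real (f (z + t *\<^sub>R 1))) has_vector_derivative complex_of_real (f' z)) (at 0)"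
    by (intro has_vector_derivative_of_real) (simp add: add.commute)
qed

lemma ckb_real_SucI:
  assumes "\<And>t. (f has_real_derivative f' t) (at t)" "ckb k M (\<lambda>t. of_real (f' t))"
  shows "ckb (Suc k) (\<lambda>t. \<bar>f t\<bar> + M t) (\<lambda>t. complex_of_real (f t))"
proof (rule ckb_SucI[where h' = "\<lambda>v t. of_real (f' t)"])
  show "continuous_on UNIV (\<lambda>t. complex_of_real (f t))"
    using assms(1) by (intro continuous_intros DERIV_continuous_on) auto
  show "norm (complex_of_real (f z)) \<le> \<bar>f z\<bar> + M z" for z
    using ckb_bound_nonneg[OF assms(2), of z] by simp
  show "has_dd v (\<lambda>t. of_real (f t)) (\<lambda>t. of_real (f' t))" if "v \<in> Basis" for v :: real
    using that has_dd_real[OF assms(1)] by simp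
  show "ckb k (\<lambda>t. \<bar>f t\<bar> + M t) (\<lambda>t. complex_of_real (f' t))"
    by (rule ckb_mono[OF assms(2)]) simp
qed

text \<open>The exponent is at least 2, so the difference quotient at the kink \<open>s = 0\<close>
  is at most a positive power of the step and tends to 0.\<close>

lemma DERIV_max_power:
  "((\<lambda>s::real. max 0 s ^ (n + 2)) has_real_derivative (real (n + 2) * max 0 s ^ (n + 1))) (at s)"
proof (cases s "0::real" rule: linorder_cases)
  case less
  have "((\<lambda>s::real. 0) has_real_derivative 0) (at s)" by simp
  moreover have "\<forall>\<^sub>F x in nhds s. 0 = max 0 x ^ (n + 2)"
    using eventually_nhds_in_open[of "{..<0}" s] less by (auto elim!: eventually_mono)
  ultimately have "((\<lambda>s::real. max 0 s ^ (n + 2)) has_real_derivative 0) (at s)"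
    by (rule DERIV_cong_ev[THEN iffD1, OF refl _ refl, rotated])
  then show ?thesis using less by simp
next
  case greater
  have "((\<lambda>s::real. s ^ (n + 2)) has_real_derivative real (n + 2) * s ^ (n + 1)) (at s)"
    using DERIV_pow[of "n + 2" s UNIV] by simp
  moreover have "\<forall>\<^sub>F x in nhds s. x ^ (n + 2) = max 0 x ^ (n + 2)"
    using eventually_nhds_in_open[of "{0<..}" s] greater by (auto elim!: eventually_mono)
  ultimately have "((\<lambda>s::real. max 0 s ^ (n + 2)) has_real_derivative real (n + 2) * s ^ (n + 1)) (at s)"
    by (rule DERIV_cong_ev[THEN iffD1, OF refl _ refl, rotated])
  then show ?thesis using greater by simp
next
  case equal
  have "(\<lambda>h::real. max 0 h ^ (n + 2) / h) \<midarrow>0\<rightarrow> 0"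
  proof (rule Lim_null_comparison)
    show "\<forall>\<^sub>F h in at 0. norm (max 0 h ^ (n + 2) / h) \<le> \<bar>h\<bar> ^ (n + 1)"
    proof (intro always_eventually allI)
      fix h :: real
      show "norm (max 0 h ^ (n + 2) / h) \<le> \<bar>h\<bar> ^ (n + 1)"
        by (cases "h > 0") (auto simp: mult_nonpos_nonneg)
    qed
    show "(\<lambda>h::real. \<bar>h\<bar> ^ (n + 1)) \<midarrow>0\<rightarrow> 0"
      by (rule tendsto_eq_intros | simp)+
  qed
  then show ?thesis by (simp add: equal DERIV_def)
qed

text \<open>A piecewise polynomial bump of class C^k: \<open>t - t^2\<close> is positive exactly on
  the open unit interval. The derivative of \<open>bump (Suc k)\<close> is \<open>bump k\<close>
  times a linear factor, which drives the induction on smoothness.\<close>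

definition bump :: "nat \<Rightarrow> real \<Rightarrow> real" where
  "bump k t = max 0 (t - t\<^sup>2) ^ (k + 1)"

lemma continuous_bump: "continuous_on S (bump k)"
  unfolding bump_def by (intro continuous_intros)

lemma DERIV_bump: "(bump (Suc k) has_real_derivative (real (k + 2) * bump k t * (1 - 2 * t))) (at t)"
proof -
  have "((\<lambda>s::real. max 0 s ^ (k + 2)) has_real_derivative (real (k + 2) * max 0 (t - t\<^sup>2) ^ (k + 1))) (at (t - t\<^sup>2))"
    by (rule DERIV_max_power)
  moreover have "((\<lambda>t. t - t\<^sup>2) has_real_derivative (1 - 2 * t)) (at t)"
    by (auto intro!: derivative_eq_intros)
  ultimately have "((\<lambda>t. max 0 (t - t\<^sup>2) ^ (k + 2)) has_real_derivative
     (real (k + 2) * max 0 (t - t\<^sup>2) ^ (k + 1)) * (1 - 2 * t)) (at t)"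
    by (rule DERIV_chain2)
  then show ?thesis by (simp add: bump_def[abs_def])
qed

lemma ckb_bump: "\<exists>M. ckb k M (\<lambda>t. complex_of_real (bump k t))"
proof (induction k)
  case 0
  show ?case
    by (intro exI[of _ "\<lambda>t. \<bar>bump 0 t\<bar>"]) (auto intro!: continuous_intros continuous_bump)
next
  case (Suc k)
  then obtain M where M: "ckb k M (\<lambda>t. complex_of_real (bump k t))" by blast
  have lin: "\<exists>N. ckb k N (\<lambda>t. complex_of_real (1 - 2 * t))"
  proof (cases k)
    case 0
    then show ?thesis
      by (intro exI[of _ "\<lambda>t. \<bar>1 - 2 * t\<bar>"]) (auto intro!: continuous_intros simp del: of_real_diff of_real_mult)
  next
    case (Suc j)
    have "ckb (Suc j) (\<lambda>t. \<bar>1 - 2 * t\<bar> + norm (complex_of_real (- 2))) (\<lambda>t. complex_of_real (1 - 2 * t))"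
      by (rule ckb_real_SucI[where f' = "\<lambda>t. - 2", OF _ ckb_const]) (auto intro!: derivative_eq_intros)
    then show ?thesis using Suc by blast
  qed
  then obtain N where N: "ckb k N (\<lambda>t. complex_of_real (1 - 2 * t))" by blast
  have "ckb k (\<lambda>z. 2 ^ k * (norm (complex_of_real (real (k + 2))) * M z * N z))
      (\<lambda>t. complex_of_real (real (k + 2)) * complex_of_real (bump k t) * complex_of_real (1 - 2 * t))"
    by (rule ckb_mult[OF ckb_cmult[OF M] N])
  then have "ckb k (\<lambda>z. 2 ^ k * (norm (complex_of_real (real (k + 2))) * M z * N z))
      (\<lambda>t. complex_of_real (real (k + 2) * bump k t * (1 - 2 * t)))"
    by (simp only: of_real_mult)
  from ckb_real_SucI[OF DERIV_bump this] show ?case by blast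
qed

lemma smooth_step:
  "\<exists>(S::real \<Rightarrow> real) M. ckb k M (\<lambda>t. complex_of_real (S t)) \<and> (\<forall>t\<le>0. S t = 0) \<and> (\<forall>t\<ge>1. S t = 1) \<and>
      (\<forall>t. 0 \<le> S t \<and> S t \<le> 1)"
proof -
  \<comment> \<open>The lower limit -1 leaves room to the left of 0: for t < 0 the function vanishes
    near t, and for t >= 0 the point t is interior to the interval on which the fundamental theorem
    of calculus is applied.\<close>
  define S where "S t = integral {-1..t} (bump k)" for t
  have bump0: "bump k t = 0" if "t \<le> 0 \<or> 1 \<le> t" for t
  proof -
    have "t * (1 - t) \<le> 0" using that by (auto simp: mult_le_0_iff)
    then show ?thesis by (simp add: bump_def power2_eq_square algebra_simps max_def)
  qed
  have bump_nonneg: "0 \<le> bump k t" for t by (simp add: bump_def)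
  have bump_pos: "0 < bump k t" if "0 < t" "t < 1" for t
  proof -
    have "0 < t * (1 - t)" using that by simp
    then have "0 < t - t\<^sup>2" by (simp add: power2_eq_square algebra_simps)
    then show ?thesis by (simp add: bump_def)
  qed
  have S0: "S t = 0" if "t \<le> 0" for t
  proof -
    have "S t = integral {-1..t} (\<lambda>x. 0)"
      unfolding S_def by (rule integral_cong) (use that bump0 in auto)
    then show ?thesis by simp
  qed
  have DS: "(S has_real_derivative bump k t) (at t)" for t
  proof (cases "t < 0")
    case True
    have "((\<lambda>t. 0) has_real_derivative 0) (at t)" by simp
    moreover have "\<forall>\<^sub>F x in nhds t. 0 = S x"
      using eventually_nhds_in_open[of "{..<0}" t] True S0 by (auto elim!: eventually_mono)
    ultimately have "(S has_real_derivative 0) (at t)"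
      by (rule DERIV_cong_ev[THEN iffD1, OF refl _ refl, rotated])
    then show ?thesis using bump0 True by simp
  next
    case False
    have "((\<lambda>u. integral {-1..u} (bump k)) has_vector_derivative bump k t) (at t within {-1..t+1})"
      using False by (intro integral_has_vector_derivative continuous_bump) auto
    then have "(S has_vector_derivative bump k t) (at t)"
      using False by (subst (asm) at_within_interior) (auto simp: S_def[abs_def])
    then show ?thesis by (simp add: has_real_derivative_iff_has_vector_derivative)
  qed
  have mono: "S s \<le> S t" if "s \<le> t" for s t
    using that DS bump_nonneg by (intro DERIV_nonneg_imp_nondecreasing[of s t S]) blast+
  have S1: "S t = S 1" if "1 \<le> t" for t
  proof (rule antisym)
    show "S t \<le> S 1"
      using that by (rule DERIV_nonpos_imp_nonincreasing[of 1 t S]) (use DS bump0 in fastforce)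
    show "S 1 \<le> S t" using that by (rule mono)
  qed
  have pos: "0 < S 1"
  proof -
    obtain z where "0 < z" "z < 1" "S 1 - S 0 = (1 - 0) * bump k z"
      using MVT2[of 0 1 S "bump k"] DS by auto
    then show ?thesis using bump_pos[of z] S0[of 0] by simp
  qed
  define T where "T t = (1 / S 1) * S t" for t
  obtain M where M: "ckb k M (\<lambda>t. complex_of_real (bump k t))" using ckb_bump by blast
  \<comment> \<open>Integration gains one order of smoothness over \<open>bump k\<close>; only
    \<open>k\<close> derivatives are kept.\<close>
  have "ckb k (\<lambda>t. \<bar>S t\<bar> + M t) (\<lambda>t. complex_of_real (S t))"
    by (rule ckb_SucD[OF ckb_real_SucI[OF DS M]])
  then have "ckb k (\<lambda>t. norm (complex_of_real (1 / S 1)) * (\<bar>S t\<bar> + M t)) (\<lambda>t. complex_of_real (1 / S 1) * complex_of_real (S t))"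
    by (rule ckb_cmult)
  then have ckT: "ckb k (\<lambda>t. norm (complex_of_real (1 / S 1)) * (\<bar>S t\<bar> + M t)) (\<lambda>t. complex_of_real (T t))"
    by (simp only: T_def of_real_mult)
  have "0 \<le> T t \<and> T t \<le> 1" for t
  proof -
    have "0 \<le> S t" using mono[of 0 t] S0[of t] S0[of 0] by (cases "t \<le> 0") auto
    moreover have "S t \<le> S 1" using mono[of t 1] S1[of t] by (cases "t \<le> 1") auto
    ultimately show ?thesis using pos by (simp add: T_def)
  qed
  moreover have "T t = 0" if "t \<le> 0" for t using S0[OF that] by (simp add: T_def)
  moreover have "T t = 1" if "1 \<le> t" for t using S1[OF that] pos by (simp add: T_def)
  ultimately show ?thesis using ckT by blast
qed

lemma ckb_affine_real:
  assumes "ckb k M f" "s = 1 \<or> s = -1"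
  shows "ckb k (\<lambda>t. 1 ^ k * M (c + s * t)) (\<lambda>t::real. f (c + s * t))"
proof (rule ckb_comp[where A = "\<lambda>t. c + s * t" and S = 1, OF _ _ _ assms(1)])
  show "\<exists>s' w. w \<in> Basis \<and> \<bar>s'\<bar> \<le> 1 \<and> (\<forall>x t. c + s * (x + t *\<^sub>R v) = c + s * x + (t * s') *\<^sub>R w)"
    if "v \<in> Basis" for v :: real
    using assms(2) that by (intro exI[of _ s] exI[of _ 1]) (auto simp: algebra_simps)
qed (auto intro!: continuous_intros)

lemma ckb_prod:
  assumes "finite I" "\<And>i. i \<in> I \<Longrightarrow> \<exists>M. ckb k M (f i)"
  shows "\<exists>M. ckb k M (\<lambda>z. \<Prod>i\<in>I. f i z)"
  using assms
proof (induction I rule: finite_induct)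
  case empty
  then show ?case using ckb_const[of k 1] by auto
next
  case (insert i I)
  then obtain M N where "ckb k M (f i)" "ckb k N (\<lambda>z. \<Prod>i\<in>I. f i z)" by blast
  from ckb_mult[OF this] show ?case using insert.hyps by auto
qed

lemma box_cutoff:
  "\<exists>(\<phi>::'a::euclidean_space \<Rightarrow> real) C. 0 \<le> C \<and> ckb k (\<lambda>z. C * indicator (qbox 2) z) (\<lambda>z. complex_of_real (\<phi> z)) \<and>
      (\<forall>z\<in>qbox 1. \<phi> z = 1) \<and> (\<forall>z. z \<notin> qbox 2 \<longrightarrow> \<phi> z = 0) \<and> (\<forall>z. 0 \<le> \<phi> z \<and> \<phi> z \<le> 1)"
proof -
  obtain S :: "real \<Rightarrow> real" and M where S: "ckb k M (\<lambda>t. complex_of_real (S t))" "\<And>t. t \<le> 0 \<Longrightarrow> S t = 0"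
      "\<And>t. 1 \<le> t \<Longrightarrow> S t = 1" "\<And>t. 0 \<le> S t" "\<And>t. S t \<le> 1"
    using smooth_step[of k] by blast
  \<comment> \<open>One factor switches off for t >= 2, the other for t <= -2, and both equal 1 when
    t has modulus at most 1.\<close>
  define \<theta> where "\<theta> t = S (2 + (-1) * t) * S (2 + 1 * t)" for t
  define \<phi> where "\<phi> z = (\<Prod>b\<in>Basis. \<theta> (z \<bullet> b))" for z :: 'a
  have "ckb k (\<lambda>t. 2 ^ k * ((1 ^ k * M (2 + (-1) * t)) * (1 ^ k * M (2 + 1 * t))))
      (\<lambda>t. complex_of_real (S (2 + (-1) * t)) * complex_of_real (S (2 + 1 * t)))"
    by (intro ckb_mult ckb_affine_real[OF S(1)]) auto
  then obtain N where N: "ckb k N (\<lambda>t. complex_of_real (\<theta> t))"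
    unfolding \<theta>_def of_real_mult by blast
  have "\<exists>M. ckb k M (\<lambda>z::'a. complex_of_real (\<theta> (z \<bullet> b)))" if b: "b \<in> Basis" for b
  proof -
    have "ckb k (\<lambda>z. 1 ^ k * N (z \<bullet> b)) (\<lambda>z::'a. complex_of_real (\<theta> (z \<bullet> b)))"
    proof (rule ckb_comp[where A = "\<lambda>z. z \<bullet> b", OF _ _ _ N])
      show "\<exists>s w. w \<in> Basis \<and> \<bar>s\<bar> \<le> 1 \<and> (\<forall>x t. (x + t *\<^sub>R v) \<bullet> b = x \<bullet> b + (t * s) *\<^sub>R w)"
        if "v \<in> Basis" for v :: 'a
        using that b by (intro exI[of _ "v \<bullet> b"] exI[of _ 1]) (auto simp: inner_add_left inner_Basis)
    qed (auto intro!: continuous_intros)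
    then show ?thesis by blast
  qed
  then have "\<exists>M. ckb k M (\<lambda>z::'a. \<Prod>b\<in>Basis. complex_of_real (\<theta> (z \<bullet> b)))"
    by (intro ckb_prod finite_Basis)
  then obtain M' where M': "ckb k M' (\<lambda>z. complex_of_real (\<phi> z))"
    unfolding \<phi>_def of_real_prod by blast
  have \<theta>: "0 \<le> \<theta> t" "\<theta> t \<le> 1" for t
    using S(4,5) by (auto simp: \<theta>_def intro!: mult_le_one)
  have out: "\<phi> z = 0" if z: "z \<notin> qbox 2" for z
  proof -
    obtain b where b: "b \<in> Basis" "2 < \<bar>z \<bullet> b\<bar>" using z unfolding qbox_def by force
    then have "\<theta> (z \<bullet> b) = 0"
      using S(2)[of "2 - z \<bullet> b"] S(2)[of "2 + z \<bullet> b"] by (cases "z \<bullet> b \<ge> 0") (auto simp: \<theta>_def)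
    then show ?thesis using b(1) unfolding \<phi>_def by (intro prod_zero) auto
  qed
  have one: "\<phi> z = 1" if "z \<in> qbox 1" for z
    using that unfolding \<phi>_def by (intro prod.neutral) (auto simp: qbox_def \<theta>_def S(3) abs_le_iff)
  have rng: "0 \<le> \<phi> z \<and> \<phi> z \<le> 1" for z
    unfolding \<phi>_def using \<theta> by (auto intro!: prod_nonneg prod_le_1)
  \<comment> \<open>The bound \<open>M'\<close> obtained from the product is unspecified; compact
    support turns it into a constant times the indicator of the box.\<close>
  from ckb_compact[OF compact_qbox M', of 2] out
  obtain C where "0 \<le> C" "ckb k (\<lambda>z. C * indicator (qbox 2) z) (\<lambda>z. complex_of_real (\<phi> z))"
    by auto
  then show ?thesis using out one rng by blast
qed

subsection \<open>Local Bessel inequality\<close>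

lemma nn_norm_integral: "ennreal (norm (LINT x|M. f x)) \<le> (\<integral>\<^sup>+x. ennreal (norm (f x)) \<partial>M)"
  \<comment> \<open>A non-integrable function has Bochner integral 0, so the bound is trivial in
    that case.\<close>
  by (cases "integrable M f") (auto intro: integral_norm_bound_ennreal simp: not_integrable_integral_eq)

lemma borel_measurable_cnj [measurable]: "cnj \<in> borel_measurable borel"
  by (intro borel_measurable_continuous_onI continuous_intros)

lemma integrable_tensor_kernel:
  fixes F :: "'a::euclidean_space \<Rightarrow> complex" and G :: "'b::euclidean_space \<Rightarrow> complex"
  assumes F: "integrable lborel F" and G: "integrable lborel G"
    and k[measurable]: "(\<lambda>(x, y). k x y) \<in> borel_measurable (borel \<Otimes>\<^sub>M borel)" "\<And>x y. norm (k x y) \<le> c"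
  shows "integrable (lborel \<Otimes>\<^sub>M lborel) (\<lambda>(x, y). F x * (k x y * G y))"
proof (rule integrableI_bounded)
  have [measurable]: "F \<in> borel_measurable borel" "G \<in> borel_measurable borel"
    using F G by (auto dest: borel_measurable_integrable)
  show m: "(\<lambda>(x, y). F x * (k x y * G y)) \<in> borel_measurable (lborel \<Otimes>\<^sub>M lborel)"
    by measurable
  have "(\<integral>\<^sup>+z. ennreal (norm (case z of (x, y) \<Rightarrow> F x * (k x y * G y))) \<partial>(lborel \<Otimes>\<^sub>M lborel)) =
      (\<integral>\<^sup>+x. (\<integral>\<^sup>+y. ennreal (norm (F x * (k x y * G y))) \<partial>lborel) \<partial>lborel)"
    by (subst lborel.nn_integral_fst[symmetric]) auto
  also have "\<dots> \<le> (\<integral>\<^sup>+x. (\<integral>\<^sup>+y. ennreal (norm (F x)) * (ennreal c * ennreal (norm (G y))) \<partial>lborel) \<partial>lborel)"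
    using k(2) order_trans[OF norm_ge_zero k(2)] by (intro nn_integral_mono)
      (auto simp: norm_mult ennreal_mult[symmetric] intro!: ennreal_leI mult_left_mono mult_right_mono)
  also have "\<dots> = (\<integral>\<^sup>+x. ennreal (norm (F x)) \<partial>lborel) * (ennreal c * (\<integral>\<^sup>+y. ennreal (norm (G y)) \<partial>lborel))"
    by (simp add: nn_integral_cmult nn_integral_multc)
  also have "\<dots> < \<infinity>"
    using F G by (auto simp: integrable_iff_bounded ennreal_mult_less_top)
  finally show "(\<integral>\<^sup>+z. ennreal (norm (case z of (x, y) \<Rightarrow> F x * (k x y * G y))) \<partial>(lborel \<Otimes>\<^sub>M lborel)) < \<infinity>" .
qed

lemma fubini_kernel:
  fixes F :: "'a::euclidean_space \<Rightarrow> complex" and G :: "'b::euclidean_space \<Rightarrow> complex"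
  assumes F: "integrable lborel F" and G: "integrable lborel G"
    and k: "(\<lambda>(x, y). k x y) \<in> borel_measurable (borel \<Otimes>\<^sub>M borel)" "\<And>x y. norm (k x y) \<le> c"
  shows "(LINT x|lborel. F x * (LINT y|lborel. k x y * G y)) = (LINT y|lborel. G y * (LINT x|lborel. k x y * F x))"
proof -
  have "(LINT x|lborel. F x * (LINT y|lborel. k x y * G y)) = (LINT x|lborel. LINT y|lborel. F x * (k x y * G y))"
    by simp
  also have "\<dots> = (LINT y|lborel. LINT x|lborel. F x * (k x y * G y))"
    by (rule lborel_pair.Fubini_integral[symmetric]) (use integrable_tensor_kernel[OF F G k] in simp)
  also have "\<dots> = (LINT y|lborel. LINT x|lborel. G y * (k x y * F x))"
    by (simp only: ac_simps)
  finally show ?thesis by simp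
qed

lemma ft_measurable [measurable]:
  assumes [measurable]: "f \<in> borel_measurable borel"
  shows "ft f \<in> borel_measurable borel"
  unfolding ft_def[abs_def] by measurable

lemma ft_kernel_measurable:
  "(\<lambda>(x, y). exp (- \<i> * complex_of_real (x \<bullet> (y::'a::euclidean_space)))) \<in> borel_measurable (borel \<Otimes>\<^sub>M borel)"
  by measurable

text \<open>Fubini for the symmetric kernel of the transform. Used with \<open>G\<close> built from
  the conjugate of a transform, it produces squares of transforms.\<close>

lemma ft_multiplication:
  fixes F G :: "'a::euclidean_space \<Rightarrow> complex"
  assumes "integrable lborel F" "integrable lborel G"
  shows "(LINT x|lborel. F x * ft G x) = (LINT x|lborel. G x * ft F x)"
proof -
  have "(LINT x|lborel. F x * (LINT y|lborel. exp (- \<i> * complex_of_real (x \<bullet> y)) * G y)) =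
      (LINT y|lborel. G y * (LINT x|lborel. exp (- \<i> * complex_of_real (x \<bullet> y)) * F x))"
    by (rule fubini_kernel[OF assms ft_kernel_measurable, of 1]) simp
  then show ?thesis by (simp add: ft_def inner_commute)
qed

lemma integrable_div_pw:
  assumes "integrable lborel f"
  shows "integrable lborel (\<lambda>x. f x / pw x)"
proof (rule Bochner_Integration.integrable_bound[OF assms])
  show "(\<lambda>x. f x / pw x) \<in> borel_measurable lborel"
    using borel_measurable_integrable[OF assms] by simp
  show "AE x in lborel. norm (f x / pw x) \<le> norm (f x)"
    by (intro AE_I2) (simp add: norm_divide norm_pw mult_left_le wt_le_one)
qed

text \<open>Since \<open>ft \<phi>\<close> only enters through its pairing with a smooth function, decay can be put onto
  \<open>\<phi>\<close> at the cost of two derivatives in each variable.\<close>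

lemma ft_weight_transfer:
  fixes H \<phi> :: "'a::euclidean_space \<Rightarrow> complex"
  assumes H: "ckb (2 * DIM('a)) (\<lambda>z. C * wt z) H" and \<phi>: "integrable lborel \<phi>"
  shows "(LINT x|lborel. H x * ft \<phi> x) = (LINT x|lborel. lop H x * ft (\<lambda>x. \<phi> x / pw x) x)"
proof -
  have iH: "integrable lborel H" using H by (rule ckb_integrable)
  have "ckb 0 (\<lambda>z. 4 ^ DIM('a) * (C * wt z)) (lop H)"
    by (rule ckb_lop) (use H in \<open>simp only: add_0_right\<close>)
  then have "ckb 0 (\<lambda>z. (4 ^ DIM('a) * C) * wt z) (lop H)" by (simp only: mult.assoc)
  then have iL: "integrable lborel (lop H)" by (rule ckb_integrable)
  have "(LINT x|lborel. H x * ft \<phi> x) = (LINT x|lborel. \<phi> x * ft H x)"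
    by (rule ft_multiplication[OF iH \<phi>])
  \<comment> \<open>Inserting \<open>pw x / pw x\<close>: one factor is absorbed by the transform of
    \<open>lop H\<close>, the other stays with \<open>\<phi>\<close>, and the multiplication formula
    is applied a second time.\<close>
  also have "\<dots> = (LINT x|lborel. (\<phi> x / pw x) * ft (lop H) x)"
    by (simp add: ft_lop[OF H])
  also have "\<dots> = (LINT x|lborel. lop H x * ft (\<lambda>x. \<phi> x / pw x) x)"
    by (rule ft_multiplication[OF integrable_div_pw[OF \<phi>] iL])
  finally show ?thesis .
qed

lemma ft_scale:
  fixes f :: "'a::euclidean_space \<Rightarrow> complex"
  assumes [measurable]: "f \<in> borel_measurable borel" and R: "0 < R"
  shows "ft (\<lambda>x. f ((1 / R) *\<^sub>R x)) u = of_real (R ^ DIM('a)) * ft f (R *\<^sub>R u)"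
proof -
  have "ft (\<lambda>x. f ((1 / R) *\<^sub>R x)) u =
     (R ^ DIM('a)) *\<^sub>R (LINT x|lborel. exp (- \<i> * complex_of_real ((R *\<^sub>R x) \<bullet> u)) * f ((1 / R) *\<^sub>R (R *\<^sub>R x)))"
    unfolding ft_def by (rule lborel_integral_scale[OF _ R]) simp
  also have "\<dots> = of_real (R ^ DIM('a)) * ft f (R *\<^sub>R u)"
    using R by (simp add: ft_def scaleR_conv_of_real mult.commute)
  finally show ?thesis .
qed

text \<open>A pointwise form of interpolation between q = 1, where the kernel \<open>r * w\<close>
  is bounded by its supremum \<open>r\<close>, and q = 2, where only its integral in one variable is
  used. Integrated in both variables, the term with both powers gives the first kind of bound and
  the other two terms give the second.\<close>

lemma young_kernel:
  fixes a b r w q t :: real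
  assumes "0 \<le> a" "0 \<le> b" "0 < r" "0 < w" "w \<le> 1" "1 \<le> q" "q \<le> 2" and t: "t = 2 / q - 1"
  shows "a * b * (r * w) \<le> r powr t * (a powr q * b powr q + (a powr q + b powr q) * (r * w))"
proof (cases "a = 0 \<or> b = 0")
  case True
  then show ?thesis using assms by auto
next
  case False
  then have ab: "0 < a" "0 < b" using assms by auto
  have "1 \<le> 2 / q" "2 / q \<le> 2"
    using assms by (simp_all add: pos_le_divide_eq pos_divide_le_eq)
  then have t01: "0 \<le> t" "t \<le> 1" by (simp_all add: t)
  define P Q K where "P = a powr q" and "Q = b powr q" and "K = r * w"
  have pos: "0 < P" "0 < Q" "0 < K" using ab assms by (auto simp: P_def Q_def K_def)
  \<comment> \<open>The geometric mean of \<open>P\<close> and \<open>Q\<close>; it is at most their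
    sum, which separates the two variables in the kernel term.\<close>
  define G where "G = (P * Q) powr (1 / 2)"
  have G: "0 < G" using pos by (simp add: G_def)
  have GPQ: "G \<le> P + Q"
    using pos arith_geo_mean_sqrt[of P Q] by (simp add: G_def powr_half_sqrt)
  have "(P * Q) powr t * (G * K) powr (1 - t) = a * b * K powr (1 - t)"
  proof -
    \<comment> \<open>This is the reason for \<open>t = 2 / q - 1\<close>: the total exponent
      \<open>q * (1 + t) / 2\<close> of each of \<open>a\<close> and \<open>b\<close> is 1.\<close>
    have e: "q * (1 / 2 * (1 - t)) + q * t = 1"
      using assms by (simp add: t field_simps)
    have "(P * Q) powr t * (G * K) powr (1 - t) =
        (P powr (1/2 * (1 - t)) * P powr t) * (Q powr (1/2 * (1 - t)) * Q powr t) * K powr (1 - t)"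
      using pos G by (simp add: G_def powr_mult powr_powr mult_ac)
    also have "P powr (1/2 * (1 - t)) * P powr t = a powr (q * (1 / 2 * (1 - t)) + q * t)"
      by (simp add: P_def powr_powr powr_add)
    also have "Q powr (1/2 * (1 - t)) * Q powr t = b powr (q * (1 / 2 * (1 - t)) + q * t)"
      by (simp add: Q_def powr_powr powr_add)
    finally show ?thesis using ab unfolding e by simp
  qed
  moreover have "(P * Q) powr t * (G * K) powr (1 - t) \<le> t * (P * Q) + (1 - t) * (G * K)"
    using pos G t01 by (intro Youngs_inequality_0) auto
  moreover have "t * (P * Q) + (1 - t) * (G * K) \<le> 1 * (P * Q) + 1 * ((P + Q) * K)"
    using pos G t01 GPQ by (intro add_mono mult_mono) auto
  ultimately have *: "a * b * K powr (1 - t) \<le> P * Q + (P + Q) * K" by linarith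
  have "a * b * K = K powr t * (a * b * K powr (1 - t))"
    using pos powr_add[of K t "1 - t"] by simp
  \<comment> \<open>Here \<open>w \<le> 1\<close> enters: \<open>K\<close> is at most
    \<open>r\<close>, and only its power \<open>t\<close> is estimated in this crude way.\<close>
  also have "\<dots> \<le> r powr t * (a * b * K powr (1 - t))"
    using assms t01 pos ab by (intro mult_right_mono powr_mono2) (auto simp: K_def mult_left_le)
  also have "\<dots> \<le> r powr t * (P * Q + (P + Q) * K)"
    using * by (intro mult_left_mono) auto
  finally show ?thesis by (simp add: P_def Q_def K_def)
qed

lemma nn_integral_wt_scale:
  fixes x :: "'a::euclidean_space"
  assumes R: "0 < R"
  shows "(\<integral>\<^sup>+y. ennreal (R ^ DIM('a) * wt (R *\<^sub>R (x - y))) \<partial>lborel) = ennreal (LINT z|lborel. wt (z::'a))"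
proof -
  have "(\<integral>\<^sup>+y. ennreal (R ^ DIM('a) * wt (R *\<^sub>R (x - y))) \<partial>lborel) =
      (\<integral>\<^sup>+y. ennreal (R ^ DIM('a) * wt (R *\<^sub>R (x - (x + y)))) \<partial>lborel)"
    by (rule nn_integral_lborel_translate[symmetric]) simp
  also have "\<dots> = ennreal (R ^ DIM('a)) * (\<integral>\<^sup>+y. ennreal (wt (R *\<^sub>R (y::'a))) \<partial>lborel)"
    using R by (simp add: ennreal_mult nn_integral_cmult)
  also have "\<dots> = (\<integral>\<^sup>+y. ennreal (wt (y::'a)) \<partial>lborel)"
    by (rule nn_integral_lborel_scale[OF _ R, symmetric]) simp
  also have "\<dots> = ennreal (LINT z|lborel. wt (z::'a))"
    by (rule nn_integral_eq_integral) (auto simp: integrable_wt)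
  finally show ?thesis .
qed

text \<open>The dilated weight has supremum \<open>R ^ DIM('a)\<close> and an integral independent
  of \<open>R\<close>. In the constant, 1 comes from the product of the two unit masses and each
  copy of the weight integral from one of the two kernel terms of
  \<open>young_kernel\<close>.\<close>

lemma kernel_form_bound:
  fixes h :: "'a::euclidean_space \<Rightarrow> complex"
  assumes q: "1 \<le> q" "q \<le> 2" and R: "0 < R" and [measurable]: "h \<in> borel_measurable borel"
    and A: "0 < A" "(\<integral>\<^sup>+x. ennreal (norm (h x) powr q) \<partial>lborel) \<le> ennreal A"
  shows "(\<integral>\<^sup>+x. (\<integral>\<^sup>+y. ennreal (norm (h x) * norm (h y) * (R ^ DIM('a) * wt (R *\<^sub>R (x - y)))) \<partial>lborel) \<partial>lborel)
     \<le> ennreal ((1 + 2 * (LINT z|lborel. wt (z::'a))) * R powr (real DIM('a) * (2 / q - 1)) * A powr (2 / q))"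
proof -
  \<comment> \<open>Normalising by the L^q bound makes \<open>u\<close>, the power of the quotient,
    have integral at most 1, so that all terms can be added without regard to homogeneity.\<close>
  define \<alpha> where "\<alpha> = A powr (1 / q)"
  have \<alpha>: "0 < \<alpha>" "\<alpha> powr q = A" "\<alpha>\<^sup>2 = A powr (2 / q)"
    using A(1) q by (auto simp: \<alpha>_def powr_powr powr_power)
  define t where "t = 2 / q - 1"
  define r where "r = R ^ DIM('a)"
  have r: "0 < r" "r powr t = R powr (real DIM('a) * t)"
    using R by (auto simp: r_def powr_powr powr_realpow[symmetric])
  define w where "w = (LINT z|lborel. wt (z::'a))"
  have w: "0 \<le> w" unfolding w_def by (intro integral_nonneg_AE) simp
  define u where "u x = (norm (h x) / \<alpha>) powr q" for x
  have u0: "0 \<le> u x" for x by (simp add: u_def)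
  have [measurable]: "u \<in> borel_measurable borel" unfolding u_def by measurable
  have iu: "(\<integral>\<^sup>+x. ennreal (u x) \<partial>lborel) \<le> 1"
  proof -
    have "u x = (1 / A) * norm (h x) powr q" for x
      using \<alpha> by (simp add: u_def powr_divide)
    then have "(\<integral>\<^sup>+x. ennreal (u x) \<partial>lborel) =
        (\<integral>\<^sup>+x. ennreal (1 / A) * ennreal (norm (h x) powr q) \<partial>lborel)"
      using A(1) by (intro nn_integral_cong) (simp add: ennreal_mult[symmetric])
    also have "\<dots> = ennreal (1 / A) * (\<integral>\<^sup>+x. ennreal (norm (h x) powr q) \<partial>lborel)"
      by (rule nn_integral_cmult) simp
    also have "\<dots> \<le> ennreal (1 / A) * ennreal A" by (intro mult_left_mono A(2)) simp
    also have "\<dots> = 1" using A(1) by (simp add: ennreal_mult[symmetric])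
    finally show ?thesis .
  qed
  define k where "k x y = r * wt (R *\<^sub>R (x - y))" for x y :: 'a
  have k0: "0 \<le> k x y" for x y using r by (simp add: k_def)
  have [measurable]: "(\<lambda>(x, y). k x y) \<in> borel_measurable (borel \<Otimes>\<^sub>M borel)"
    unfolding k_def by measurable
  have ik: "(\<integral>\<^sup>+y. ennreal (k x y) \<partial>lborel) = ennreal w" for x
    unfolding k_def r_def w_def by (rule nn_integral_wt_scale[OF R])
  have ksym: "k x y = k y x" for x y
    using wt_minus[of "R *\<^sub>R (x - y)"] by (simp add: k_def algebra_simps)
  have "(\<integral>\<^sup>+x. (\<integral>\<^sup>+y. ennreal (norm (h x) * norm (h y) * k x y) \<partial>lborel) \<partial>lborel) \<le>
     (\<integral>\<^sup>+x. (\<integral>\<^sup>+y. ennreal (\<alpha>\<^sup>2 * r powr t) * (ennreal (u x) * ennreal (u y) +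
        (ennreal (u x) * ennreal (k x y) + ennreal (u y) * ennreal (k x y))) \<partial>lborel) \<partial>lborel)"
  proof (intro nn_integral_mono)
    fix x y
    have "norm (h x) / \<alpha> * (norm (h y) / \<alpha>) * (r * wt (R *\<^sub>R (x - y))) \<le>
       r powr t * (u x * u y + (u x + u y) * (r * wt (R *\<^sub>R (x - y))))"
      unfolding u_def using \<alpha>(1) r(1) q by (intro young_kernel[where q = q]) (auto simp: wt_le_one t_def)
    then have "\<alpha>\<^sup>2 * (norm (h x) / \<alpha> * (norm (h y) / \<alpha>) * k x y) \<le> \<alpha>\<^sup>2 * (r powr t * (u x * u y + (u x + u y) * k x y))"
      unfolding k_def by (intro mult_left_mono) auto
    then have "norm (h x) * norm (h y) * k x y \<le> \<alpha>\<^sup>2 * r powr t * (u x * u y + (u x * k x y + u y * k x y))"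
      using \<alpha>(1) by (simp add: power2_eq_square algebra_simps)
    then show "ennreal (norm (h x) * norm (h y) * k x y) \<le> ennreal (\<alpha>\<^sup>2 * r powr t) * (ennreal (u x) * ennreal (u y) +
        (ennreal (u x) * ennreal (k x y) + ennreal (u y) * ennreal (k x y)))"
      using u0 k0 by (simp add: ennreal_mult[symmetric] ennreal_plus[symmetric] ennreal_leI del: ennreal_plus)
  qed
  also have "\<dots> = ennreal (\<alpha>\<^sup>2 * r powr t) * ((\<integral>\<^sup>+x. ennreal (u x) \<partial>lborel) * (\<integral>\<^sup>+x. ennreal (u x) \<partial>lborel) +
       ((\<integral>\<^sup>+x. (\<integral>\<^sup>+y. ennreal (u x) * ennreal (k x y) \<partial>lborel) \<partial>lborel) +
        (\<integral>\<^sup>+x. (\<integral>\<^sup>+y. ennreal (u y) * ennreal (k x y) \<partial>lborel) \<partial>lborel)))"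
    by (simp add: nn_integral_cmult nn_integral_add nn_integral_multc)
  also have "(\<integral>\<^sup>+x. (\<integral>\<^sup>+y. ennreal (u y) * ennreal (k x y) \<partial>lborel) \<partial>lborel) =
      (\<integral>\<^sup>+x. (\<integral>\<^sup>+y. ennreal (u x) * ennreal (k x y) \<partial>lborel) \<partial>lborel)"
    by (subst lborel_pair.Fubini') (simp_all add: ksym)
  also have "(\<integral>\<^sup>+x. (\<integral>\<^sup>+y. ennreal (u x) * ennreal (k x y) \<partial>lborel) \<partial>lborel) = (\<integral>\<^sup>+x. ennreal (u x) \<partial>lborel) * ennreal w"
    by (simp add: nn_integral_cmult nn_integral_multc ik)
  also have "ennreal (\<alpha>\<^sup>2 * r powr t) * ((\<integral>\<^sup>+x. ennreal (u x) \<partial>lborel) * (\<integral>\<^sup>+x. ennreal (u x) \<partial>lborel) +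
       ((\<integral>\<^sup>+x. ennreal (u x) \<partial>lborel) * ennreal w + (\<integral>\<^sup>+x. ennreal (u x) \<partial>lborel) * ennreal w))
     \<le> ennreal (\<alpha>\<^sup>2 * r powr t) * (1 * 1 + (1 * ennreal w + 1 * ennreal w))"
    using iu by (intro mult_left_mono add_mono mult_mono) auto
  also have "\<dots> = ennreal (\<alpha>\<^sup>2 * r powr t) * ennreal (1 + 2 * w)"
  proof -
    have "ennreal (1 + 2 * w) = ennreal 1 + (ennreal w + ennreal w)"
      using w by (simp add: ennreal_plus[symmetric] del: ennreal_plus ennreal_1)
    then show ?thesis by simp
  qed
  also have "\<dots> = ennreal ((1 + 2 * w) * r powr t * \<alpha>\<^sup>2)"
    using w by (subst ennreal_mult[symmetric]) (simp_all add: mult_ac)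
  finally show ?thesis
    by (simp only: k_def r_def[symmetric] r(2) \<alpha>(3) w_def[symmetric] t_def[symmetric])
qed

text \<open>For q = 2 this is a Bessel inequality and for q = 1 the volume bound; between them it is
  Bernstein's inequality in dual form. The square of the transform is tested against a cutoff of the
  box and the multiplication formula turns the integral into a quadratic form in \<open>h\<close>,
  whose kernel is the transform of the cutoff: a dilated weight.\<close>

lemma local_bessel:
  "\<exists>C>0. \<forall>q R A (h :: 'a::euclidean_space \<Rightarrow> complex). 1 \<le> q \<longrightarrow> q \<le> 2 \<longrightarrow> 0 < R \<longrightarrow> 0 < A \<longrightarrow> integrable lborel h \<longrightarrow>
     (\<integral>\<^sup>+x. ennreal (norm (h x) powr q) \<partial>lborel) \<le> ennreal A \<longrightarrow>
     (\<integral>\<^sup>+x. indicator (qbox R) x * ennreal ((norm (ft h x))\<^sup>2) \<partial>lborel) \<le>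
       ennreal (C * R powr (real DIM('a) * (2 / q - 1)) * A powr (2 / q))"
proof -
  obtain \<phi> :: "'a \<Rightarrow> real" and C0 where \<phi>: "0 \<le> C0"
      "ckb (2 * DIM('a)) (\<lambda>z. C0 * indicator (qbox 2) z) (\<lambda>z. complex_of_real (\<phi> z))"
      "\<And>z. z \<in> qbox 1 \<Longrightarrow> \<phi> z = 1" "\<And>z. z \<notin> qbox 2 \<Longrightarrow> \<phi> z = 0" "\<And>z. 0 \<le> \<phi> z" "\<And>z. \<phi> z \<le> 1"
    using box_cutoff[of "2 * DIM('a)"] by blast
  define c where "c z = complex_of_real (\<phi> z)" for z
  have cm [measurable]: "c \<in> borel_measurable borel"
    using ckb_measurable[OF \<phi>(2)] by (simp add: c_def[abs_def])
  define C1 where "C1 = C0 * (1 + 2\<^sup>2) ^ DIM('a)"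
  have C1: "C0 * indicator (qbox 2) z \<le> C1 * wt z" for z :: 'a
    using mult_left_mono[OF indicator_qbox_le_wt[of 2 z] \<phi>(1)] by (simp add: C1_def mult.assoc)
  \<comment> \<open>The modulus and the summand 1 only make \<open>D\<close> positive.\<close>
  define D where "D = \<bar>4 ^ DIM('a) * (LINT x|lborel. C0 * indicator (qbox 2) (x::'a))\<bar> + 1"
  have D: "0 < D" by (simp add: D_def add_nonneg_pos)
  have ftc: "norm (ft c u) \<le> D * wt u" for u
  proof -
    have "norm (ft c u) \<le> 4 ^ DIM('a) * (LINT x|lborel. C0 * indicator (qbox 2) (x::'a)) * wt u"
      unfolding c_def[abs_def] by (rule ft_decay[OF \<phi>(2) C1]) measurable
    also have "\<dots> \<le> D * wt u" by (intro mult_right_mono) (auto simp: D_def)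
    finally show ?thesis .
  qed
  define w where "w = (LINT z|lborel. wt (z::'a))"
  have w: "0 \<le> w" unfolding w_def by (intro integral_nonneg_AE) simp
  show ?thesis
  proof (intro exI[of _ "D * (1 + 2 * w)"] conjI allI impI)
    show "0 < D * (1 + 2 * w)" using D w by simp
    fix q R A :: real and h :: "'a \<Rightarrow> complex"
    assume q: "1 \<le> q" "q \<le> 2" and R: "0 < R" and A: "0 < A" and h: "integrable lborel h"
      and hA: "(\<integral>\<^sup>+x. ennreal (norm (h x) powr q) \<partial>lborel) \<le> ennreal A"
    have hm [measurable]: "h \<in> borel_measurable borel" using h by (auto dest: borel_measurable_integrable)
    define cR where "cR z = c ((1 / R) *\<^sub>R z)" for z
    define pR where "pR z = \<phi> ((1 / R) *\<^sub>R z)" for z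
    have cRp: "cR z = of_real (pR z)" for z by (simp add: cR_def pR_def c_def)
    have [measurable]: "cR \<in> borel_measurable borel" unfolding cR_def by measurable
    have pR: "0 \<le> pR z" "pR z \<le> 1" "z \<in> qbox R \<Longrightarrow> pR z = 1" "z \<notin> qbox (2 * R) \<Longrightarrow> pR z = 0" for z
      using R \<phi>(3,4)[of "(1 / R) *\<^sub>R z"] by (auto simp: pR_def \<phi>(5,6) mem_qbox_scale)
    have cR1: "norm (cR z) \<le> (1 + (2 * R)\<^sup>2) ^ DIM('a) * wt z" for z
    proof -
      have "norm (cR z) \<le> indicator (qbox (2 * R)) z"
        using pR(1,2,4)[of z] by (auto simp: cRp indicator_def)
      then show ?thesis using indicator_qbox_le_wt order_trans by blast
    qed
    have icR: "integrable lborel cR"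
      by (rule integrable_wt_bound[OF cR1]) measurable
    have ftb: "norm (ft h x) \<le> (LINT x|lborel. norm (h x))" for x
      using h by (intro norm_ft_le) auto
    \<comment> \<open>Chosen so that \<open>H z * ft h z\<close> is the cutoff times the squared
      modulus of \<open>ft h z\<close>.\<close>
    define H where "H z = cR z * cnj (ft h z)" for z
    have [measurable]: "H \<in> borel_measurable borel" unfolding H_def by measurable
    have "norm (cR z * cnj (ft h z)) \<le> ((1 + (2 * R)\<^sup>2) ^ DIM('a) * (LINT x|lborel. norm (h x))) * wt z" for z
    proof -
      have "norm (cR z * cnj (ft h z)) \<le> ((1 + (2 * R)\<^sup>2) ^ DIM('a) * wt z) * (LINT x|lborel. norm (h x))"
        unfolding norm_mult complex_mod_cnj using cR1 ftb by (intro mult_mono) auto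
      then show ?thesis by (simp add: mult_ac)
    qed
    then have iH: "integrable lborel H"
      unfolding H_def by (intro integrable_wt_bound) auto
    have ftcR: "ft cR u = of_real (R ^ DIM('a)) * ft c (R *\<^sub>R u)" for u
      unfolding cR_def[abs_def] by (rule ft_scale[OF cm R])
    \<comment> \<open>The transform of a product as a convolution: Fubini places the two
      exponentials side by side, and their product is the exponential at
      \<open>x - y\<close>.\<close>
    have ftH: "ft H x = (LINT y|lborel. cnj (h y) * ft cR (x - y))" for x
    proof -
      have cnjft: "cnj (ft h z) = (LINT y|lborel. exp (\<i> * complex_of_real (z \<bullet> y)) * cnj (h y))" for z
      proof -
        have "cnj (ft h z) = (LINT y|lborel. cnj (exp (- \<i> * complex_of_real (y \<bullet> z)) * h y))"
          unfolding ft_def by (rule Bochner_Integration.integral_cnj[symmetric])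
        then show ?thesis by (simp add: inner_commute exp_cnj)
      qed
      have iE: "integrable lborel (\<lambda>z. exp (- \<i> * complex_of_real (z \<bullet> x)) * cR z)"
        by (rule Bochner_Integration.integrable_bound[OF icR]) (auto simp: norm_mult)
      have "ft H x = (LINT z|lborel. (exp (- \<i> * complex_of_real (z \<bullet> x)) * cR z) *
          (LINT y|lborel. exp (\<i> * complex_of_real (z \<bullet> y)) * cnj (h y)))"
        unfolding ft_def[of H] H_def cnjft by (simp only: mult.assoc)
      also have "\<dots> = (LINT y|lborel. cnj (h y) * (LINT z|lborel. exp (\<i> * complex_of_real (z \<bullet> y)) *
          (exp (- \<i> * complex_of_real (z \<bullet> x)) * cR z)))"
        using h by (intro fubini_kernel[where c = 1] iE) auto
      also have "\<dots> = (LINT y|lborel. cnj (h y) * ft cR (x - y))"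
        unfolding ft_def mult.assoc[symmetric] exp_add[symmetric]
        by (simp add: inner_diff_right algebra_simps)
      finally show ?thesis .
    qed
    have ip: "integrable lborel (\<lambda>x. pR x * (norm (ft h x))\<^sup>2)"
    proof -
      have "integrable lborel (\<lambda>x. norm (H x * ft h x))"
        by (rule Bochner_Integration.integrable_bound[OF integrable_mult_right[OF integrable_norm[OF iH], of "LINT x|lborel. norm (h x)"]])
          (use ftb in \<open>auto simp: norm_mult mult.commute intro!: AE_I2 mult_left_mono\<close>)
      then show ?thesis
        using pR(1) by (simp add: H_def norm_mult cRp power2_eq_square mult.assoc)
    qed
    have "(\<integral>\<^sup>+x. indicator (qbox R) x * ennreal ((norm (ft h x))\<^sup>2) \<partial>lborel) \<le>
        (\<integral>\<^sup>+x. ennreal (pR x * (norm (ft h x))\<^sup>2) \<partial>lborel)"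
      using pR by (intro nn_integral_mono) (auto simp: indicator_def)
    also have "\<dots> = ennreal (LINT x|lborel. pR x * (norm (ft h x))\<^sup>2)"
      using pR(1) by (intro nn_integral_eq_integral ip) auto
    also have "(LINT x|lborel. pR x * (norm (ft h x))\<^sup>2) = norm (LINT x|lborel. h x * ft H x)"
    proof -
      have "complex_of_real (LINT x|lborel. pR x * (norm (ft h x))\<^sup>2) = (LINT x|lborel. H x * ft h x)"
        by (subst integral_complex_of_real[symmetric])
           (simp add: H_def cRp complex_norm_square mult_ac del: of_real_power)
      also have "\<dots> = (LINT x|lborel. h x * ft H x)" by (rule ft_multiplication[OF iH h])
      finally have "norm (complex_of_real (LINT x|lborel. pR x * (norm (ft h x))\<^sup>2)) = norm (LINT x|lborel. h x * ft H x)"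
        by simp
      moreover have "0 \<le> (LINT x|lborel. pR x * (norm (ft h x))\<^sup>2)"
        using pR(1) by (intro integral_nonneg_AE) auto
      ultimately show ?thesis by simp
    qed
    also have "ennreal \<dots> \<le> (\<integral>\<^sup>+x. ennreal (norm (h x * ft H x)) \<partial>lborel)"
      by (rule nn_norm_integral)
    also have "\<dots> \<le> (\<integral>\<^sup>+x. ennreal D * (\<integral>\<^sup>+y. ennreal (norm (h x) * norm (h y) * (R ^ DIM('a) * wt (R *\<^sub>R (x - y)))) \<partial>lborel) \<partial>lborel)"
    proof (intro nn_integral_mono)
      fix x
      have "ennreal (norm (h x * ft H x)) = ennreal (norm (h x)) * ennreal (norm (ft H x))"
        by (simp add: norm_mult ennreal_mult)
      also have "\<dots> \<le> ennreal (norm (h x)) * (\<integral>\<^sup>+y. ennreal (norm (cnj (h y) * ft cR (x - y))) \<partial>lborel)"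
        unfolding ftH by (intro mult_left_mono nn_norm_integral) simp
      also have "\<dots> = (\<integral>\<^sup>+y. ennreal (norm (h x)) * ennreal (norm (cnj (h y) * ft cR (x - y))) \<partial>lborel)"
        by (rule nn_integral_cmult[symmetric]) measurable
      also have "\<dots> \<le> (\<integral>\<^sup>+y. ennreal D * ennreal (norm (h x) * norm (h y) * (R ^ DIM('a) * wt (R *\<^sub>R (x - y)))) \<partial>lborel)"
      proof (intro nn_integral_mono)
        fix y
        have "norm (h x) * (norm (h y) * norm (ft cR (x - y))) \<le>
            norm (h x) * (norm (h y) * (R ^ DIM('a) * (D * wt (R *\<^sub>R (x - y)))))"
          using R ftc by (intro mult_left_mono) (auto simp: ftcR norm_mult norm_power intro!: mult_left_mono)
        then show "ennreal (norm (h x)) * ennreal (norm (cnj (h y) * ft cR (x - y))) \<le>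
            ennreal D * ennreal (norm (h x) * norm (h y) * (R ^ DIM('a) * wt (R *\<^sub>R (x - y))))"
          using R D by (simp add: norm_mult ennreal_mult[symmetric] ennreal_leI mult_ac)
      qed
      also have "\<dots> = ennreal D * (\<integral>\<^sup>+y. ennreal (norm (h x) * norm (h y) * (R ^ DIM('a) * wt (R *\<^sub>R (x - y)))) \<partial>lborel)"
        by (rule nn_integral_cmult) measurable
      finally show "ennreal (norm (h x * ft H x)) \<le> ennreal D *
          (\<integral>\<^sup>+y. ennreal (norm (h x) * norm (h y) * (R ^ DIM('a) * wt (R *\<^sub>R (x - y)))) \<partial>lborel)" .
    qed
    also have "\<dots> = ennreal D * (\<integral>\<^sup>+x. (\<integral>\<^sup>+y. ennreal (norm (h x) * norm (h y) * (R ^ DIM('a) * wt (R *\<^sub>R (x - y)))) \<partial>lborel) \<partial>lborel)"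
      by (rule nn_integral_cmult) measurable
    also have "\<dots> \<le> ennreal D * ennreal ((1 + 2 * w) * R powr (real DIM('a) * (2 / q - 1)) * A powr (2 / q))"
      unfolding w_def by (intro mult_left_mono kernel_form_bound q R hm A hA) simp
    also have "\<dots> = ennreal (D * (1 + 2 * w) * R powr (real DIM('a) * (2 / q - 1)) * A powr (2 / q))"
      using D w by (simp add: ennreal_mult[symmetric] mult.assoc)
    finally show "(\<integral>\<^sup>+x. indicator (qbox R) x * ennreal ((norm (ft h x))\<^sup>2) \<partial>lborel) \<le>
       ennreal (D * (1 + 2 * w) * R powr (real DIM('a) * (2 / q - 1)) * A powr (2 / q))" .
  qed
qed

subsection \<open>Square function bounds for phase integrals\<close>

lemma
  fixes F :: "'a::euclidean_space \<Rightarrow> complex" and G :: "'b::euclidean_space \<Rightarrow> complex"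
  assumes F: "integrable lborel F" and G: "integrable lborel G"
  shows integrable_tensor: "integrable lborel (\<lambda>z. F (fst z) * G (snd z))"
    and integral_tensor: "(LINT z|lborel. F (fst z) * G (snd z)) = (LINT x|lborel. F x) * (LINT y|lborel. G y)"
proof -
  have *: "integrable (lborel \<Otimes>\<^sub>M lborel) (\<lambda>(x, y). F x * (1 * G y))"
    by (rule integrable_tensor_kernel[OF F G, where c = 1]) auto
  then show i: "integrable lborel (\<lambda>z. F (fst z) * G (snd z))"
    by (simp add: lborel_prod case_prod_beta')
  have "(LINT x|lborel. LINT y|lborel. F x * (1 * G y)) = integral\<^sup>L (lborel \<Otimes>\<^sub>M lborel) (\<lambda>(x, y). F x * (1 * G y))"
    by (rule lborel_pair.integral_fst[OF *])
  then show "(LINT z|lborel. F (fst z) * G (snd z)) = (LINT x|lborel. F x) * (LINT y|lborel. G y)"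
    by (simp add: lborel_prod case_prod_beta')
qed

lemma nn_integral_tensor:
  assumes [measurable]: "f \<in> borel_measurable borel" "g \<in> borel_measurable borel"
  shows "(\<integral>\<^sup>+z. f (fst z) * g (snd z) \<partial>lborel) =
    (\<integral>\<^sup>+x. f (x::'a::euclidean_space) \<partial>lborel) * (\<integral>\<^sup>+y. g (y::'b::euclidean_space) \<partial>lborel)"
proof -
  have "(\<integral>\<^sup>+z. f (fst z) * g (snd z) \<partial>lborel) = (\<integral>\<^sup>+z. f (fst z) * g (snd z) \<partial>(lborel \<Otimes>\<^sub>M lborel))"
    by (simp only: lborel_prod)
  also have "\<dots> = (\<integral>\<^sup>+x. (\<integral>\<^sup>+y. f x * g y \<partial>lborel) \<partial>lborel)"
    by (subst lborel.nn_integral_fst[symmetric]) simp_all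
  finally show ?thesis
    by (simp add: nn_integral_cmult nn_integral_multc)
qed

lemma ft_tensor:
  fixes f :: "'a::euclidean_space \<Rightarrow> complex" and g :: "'b::euclidean_space \<Rightarrow> complex"
  assumes f: "integrable lborel f" and g: "integrable lborel g"
  shows "ft (\<lambda>z. f (fst z) * g (snd z)) \<zeta> = ft f (fst \<zeta>) * ft g (snd \<zeta>)"
proof -
  have i: "integrable lborel (\<lambda>x. exp (- \<i> * complex_of_real (x \<bullet> y)) * h x)"
    if h: "integrable lborel h" for h :: "'c::euclidean_space \<Rightarrow> complex" and y
    by (rule Bochner_Integration.integrable_bound[OF h])
       (use borel_measurable_integrable[OF h] in \<open>auto simp: norm_mult\<close>)
  have "ft (\<lambda>z. f (fst z) * g (snd z)) \<zeta> =
     (LINT z|lborel. (exp (- \<i> * complex_of_real (fst z \<bullet> fst \<zeta>)) * f (fst z)) *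
        (exp (- \<i> * complex_of_real (snd z \<bullet> snd \<zeta>)) * g (snd z)))"
    unfolding ft_def by (intro Bochner_Integration.integral_cong refl)
      (simp add: inner_prod_def exp_add[symmetric] algebra_simps exp_diff exp_minus divide_inverse)
  also have "\<dots> = ft f (fst \<zeta>) * ft g (snd \<zeta>)"
    unfolding ft_def by (rule integral_tensor[OF i[OF f] i[OF g]])
  finally show ?thesis .
qed

text \<open>In terms of \<open>\<zeta> = (\<xi>, \<eta>)\<close> the phase \<open>x \<bullet> (\<xi> + \<eta>)\<close> is \<open>\<zeta> \<bullet> (x, x)\<close>.\<close>

abbreviation phase :: "'a::euclidean_space \<Rightarrow> 'a \<times> 'a \<Rightarrow> complex" where
  "phase x \<zeta> \<equiv> exp (\<i> * complex_of_real (\<zeta> \<bullet> (x, x)))"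

text \<open>\<open>phase_dp\<close> is \<^const>\<open>dp\<close> in the frequency variables, conjugated by multiplication with \<open>phase x\<close>.\<close>

definition phase_dp :: "'a::euclidean_space \<times> 'a \<Rightarrow> ('a \<times> 'a \<times> 'a \<Rightarrow> complex) \<Rightarrow> 'a \<times> 'a \<times> 'a \<Rightarrow> complex" where
  "phase_dp e b z = (1 + \<i> * of_real (e \<bullet> (fst z, fst z))) * b z + dirderiv (0, e) b z"

text \<open>The bound is unbounded in the space variable, but this factor always multiplies a symbol
  supported where that variable lies in \<open>qbox 2\<close>.\<close>

lemma ckb_phase_factor:
  fixes e :: "'a::euclidean_space \<times> 'a"
  assumes e: "e \<in> Basis"
  shows "ckb k (\<lambda>z. 2 + \<bar>e \<bullet> (fst z, fst z)\<bar>) (\<lambda>z :: 'a \<times> 'a \<times> 'a. 1 + \<i> * complex_of_real (e \<bullet> (fst z, fst z)))"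
proof -
  have lin: "ckb k (\<lambda>t. \<bar>t\<bar> + 1) (\<lambda>t. complex_of_real t)"
  proof (cases k)
    case 0
    then show ?thesis by (auto intro!: continuous_intros)
  next
    case (Suc j)
    have "ckb (Suc j) (\<lambda>t. \<bar>t\<bar> + norm (complex_of_real 1)) (\<lambda>t. complex_of_real t)"
      by (rule ckb_real_SucI[OF _ ckb_const]) auto
    then show ?thesis using Suc by (simp del: ckb.simps)
  qed
  have "ckb k (\<lambda>t. norm (1::complex) + norm \<i> * (\<bar>t\<bar> + 1)) (\<lambda>t. 1 + \<i> * complex_of_real t)"
    by (intro ckb_add ckb_const ckb_cmult lin)
  then have *: "ckb k (\<lambda>t. 2 + \<bar>t\<bar>) (\<lambda>t. 1 + \<i> * complex_of_real t)"
    by (rule ckb_mono) simp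
  have "ckb k (\<lambda>z. 1 ^ k * (2 + \<bar>e \<bullet> (fst z, fst z)\<bar>)) (\<lambda>z :: 'a \<times> 'a \<times> 'a. 1 + \<i> * complex_of_real (e \<bullet> (fst z, fst z)))"
  proof (rule ckb_comp[where A = "\<lambda>z. e \<bullet> (fst z, fst z)" and S = 1, OF _ _ _ *])
    show "\<exists>s w. w \<in> Basis \<and> \<bar>s\<bar> \<le> 1 \<and>
        (\<forall>x t. e \<bullet> (fst (x + t *\<^sub>R v), fst (x + t *\<^sub>R v)) = e \<bullet> (fst x, fst x) + (t * s) *\<^sub>R w)"
      if "v \<in> Basis" for v :: "'a \<times> 'a \<times> 'a"
      using e that
      by (intro exI[of _ "e \<bullet> (fst v, fst v)"] exI[of _ 1])
         (auto simp: Basis_prod_def inner_prod_def inner_Basis inner_add_right algebra_simps)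
  qed (auto intro!: continuous_intros)
  then show ?thesis by simp
qed

text \<open>On the support the linear factor is at most 4, the Leibniz rule costs
  \<open>2 ^ k\<close>, and the derivative term adds one more: hence 5. Replacing \<open>k\<close>
  by a fixed upper bound \<open>K\<close> gives every step of an iteration the same
  constant.\<close>

lemma ckb_phase_dp:
  assumes b: "ckb (Suc k) (\<lambda>z. B * indicator (qbox 2 \<times> D) z) b" and e: "e \<in> Basis" and B: "0 \<le> B" and k: "k \<le> K"
  shows "ckb k (\<lambda>z. (5 * 2 ^ K) * B * indicator (qbox 2 \<times> D) z) (phase_dp e b)"
proof -
  have "(0, e) \<in> Basis" using e by (simp add: Basis_prod_def)
  note dd = ckb_dirderiv[OF b this]
  have "ckb k (\<lambda>z. 2 ^ k * ((2 + \<bar>e \<bullet> (fst z, fst z)\<bar>) * (B * indicator (qbox 2 \<times> D) z)) + B * indicator (qbox 2 \<times> D) z)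
      (\<lambda>z. (1 + \<i> * of_real (e \<bullet> (fst z, fst z))) * b z + dirderiv (0, e) b z)"
    by (intro ckb_add ckb_mult ckb_phase_factor e ckb_SucD[OF b] dd(2))
  then show ?thesis
    unfolding phase_dp_def[abs_def]
  proof (rule ckb_mono)
    fix z :: "'a \<times> 'a \<times> 'a"
    show "2 ^ k * ((2 + \<bar>e \<bullet> (fst z, fst z)\<bar>) * (B * indicator (qbox 2 \<times> D) z)) + B * indicator (qbox 2 \<times> D) z
       \<le> 5 * 2 ^ K * B * indicator (qbox 2 \<times> D) z"
    proof (cases "z \<in> qbox 2 \<times> D")
      case True
      then have "\<bar>e \<bullet> (fst z, fst z)\<bar> \<le> 2"
        using e by (auto simp: qbox_def Basis_prod_def inner_commute)
      then have "2 ^ k * ((2 + \<bar>e \<bullet> (fst z, fst z)\<bar>) * B) \<le> 2 ^ K * (4 * B)"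
        using B k by (intro mult_mono power_increasing) auto
      moreover have "B \<le> 2 ^ K * B" using B by (intro mult_right_le_one_le[THEN order_trans] mult_le_cancel_right1[THEN iffD2]) auto
      ultimately show ?thesis using True by simp
    qed simp
  qed
qed

lemma ckb_foldr_phase_dp:
  "ckb (length bs + k) (\<lambda>z. B * indicator (qbox 2 \<times> D) z) b \<Longrightarrow> set bs \<subseteq> Basis \<Longrightarrow> 0 \<le> B \<Longrightarrow>
    length bs + k \<le> K \<Longrightarrow>
    ckb k (\<lambda>z. ((5 * 2 ^ K) ^ length bs * B) * indicator (qbox 2 \<times> D) z) (foldr phase_dp bs b)"
proof (induction bs arbitrary: k)
  case Nil
  then show ?case by simp
next
  case (Cons e bs)
  have "ckb (Suc k) (\<lambda>z. ((5 * 2 ^ K) ^ length bs * B) * indicator (qbox 2 \<times> D) z) (foldr phase_dp bs b)"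
    using Cons.prems by (intro Cons.IH) (simp_all del: ckb.simps)
  from ckb_phase_dp[OF this, of e K] Cons.prems show ?case
    by (simp add: mult_ac del: ckb.simps)
qed

lemma dp_phase:
  assumes "has_dd (0, e) b (dirderiv (0, e) b)"
  shows "dp e (\<lambda>\<zeta>. b (x, \<zeta>) * phase x \<zeta>) =
    (\<lambda>\<zeta>. phase_dp e b (x, \<zeta>) * phase x \<zeta>)"
proof -
  have "has_dd e (\<lambda>\<zeta>. b (x, \<zeta>)) (\<lambda>\<zeta>. of_real 1 * dirderiv (0, e) b (x, \<zeta>))"
    using assms by (rule has_dd_comp) simp
  from has_dd_mult[OF this has_dd_exp]
  have "dirderiv e (\<lambda>\<zeta>. b (x, \<zeta>) * phase x \<zeta>) =
     (\<lambda>\<zeta>. b (x, \<zeta>) * (\<i> * complex_of_real (e \<bullet> (x, x)) * phase x \<zeta>) +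
       of_real 1 * dirderiv (0, e) b (x, \<zeta>) * phase x \<zeta>)"
    by (rule has_dd_unique)
  then show ?thesis
    by (simp add: fun_eq_iff dp_def phase_dp_def algebra_simps)
qed

lemma foldr_dp_phase:
  "ckb (length bs) (\<lambda>z. B * indicator (qbox 2 \<times> D) z) b \<Longrightarrow> set bs \<subseteq> Basis \<Longrightarrow> 0 \<le> B \<Longrightarrow>
    foldr dp bs (\<lambda>\<zeta>. b (x, \<zeta>) * phase x \<zeta>) =
    (\<lambda>\<zeta>. foldr phase_dp bs b (x, \<zeta>) * phase x \<zeta>)"
proof (induction bs)
  case Nil
  then show ?case by simp
next
  case (Cons e bs)
  have IH: "foldr dp bs (\<lambda>\<zeta>. b (x, \<zeta>) * phase x \<zeta>) =
    (\<lambda>\<zeta>. foldr phase_dp bs b (x, \<zeta>) * phase x \<zeta>)"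
    using Cons.prems by (intro Cons.IH, intro ckb_SucD[of "length bs"]) (simp_all del: ckb.simps)
  have "ckb (Suc 0) (\<lambda>z. ((5 * 2 ^ Suc (length bs)) ^ length bs * B) * indicator (qbox 2 \<times> D) z) (foldr phase_dp bs b)"
    using Cons.prems by (intro ckb_foldr_phase_dp) (simp_all del: ckb.simps)
  moreover have "(0, e) \<in> Basis" using Cons.prems by (simp add: Basis_prod_def)
  ultimately have "has_dd (0, e) (foldr phase_dp bs b) (dirderiv (0, e) (foldr phase_dp bs b))"
    by (rule ckb_dirderiv(1))
  then show ?case by (simp only: foldr.simps o_apply IH dp_phase)
qed

text \<open>One frequency runs over a cube of volume \<open>(2 * \<rho>) ^ DIM('a)\<close>; the
  other is integrated over the whole space against the weight. Near-equality of frequency sums thus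
  removes half of the dimensions, which is the entire gain of the L^2 bound over the supremum
  bound.\<close>

lemma nn_integral_box_wt:
  fixes \<tau> :: "'a::euclidean_space"
  assumes "0 \<le> \<rho>"
  shows "(\<integral>\<^sup>+\<zeta>. indicator (qbox \<rho>) \<zeta> * ennreal (wt (fst \<zeta> + snd \<zeta> - \<tau>)) \<partial>lborel) \<le>
     ennreal ((2 * \<rho>) ^ DIM('a) * (LINT z|lborel. wt (z::'a)))"
proof -
  have "(\<integral>\<^sup>+\<zeta>. indicator (qbox \<rho>) \<zeta> * ennreal (wt (fst \<zeta> + snd \<zeta> - \<tau>)) \<partial>lborel) =
     (\<integral>\<^sup>+\<zeta>. indicator (qbox \<rho>) \<zeta> * ennreal (wt (fst \<zeta> + snd \<zeta> - \<tau>)) \<partial>(lborel \<Otimes>\<^sub>M lborel))"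
    by (simp only: lborel_prod)
  also have "\<dots> = (\<integral>\<^sup>+x. (\<integral>\<^sup>+y. indicator (qbox \<rho>) (x, y) * ennreal (wt (x + y - \<tau>)) \<partial>lborel) \<partial>lborel)"
  proof (subst lborel.nn_integral_fst[symmetric])
    show "(\<lambda>\<zeta>. indicator (qbox \<rho>) \<zeta> * ennreal (wt (fst \<zeta> + snd \<zeta> - \<tau>))) \<in> borel_measurable (lborel \<Otimes>\<^sub>M lborel)"
    proof -
      have [measurable]: "(\<lambda>\<zeta>. fst \<zeta> + snd \<zeta> - \<tau>) \<in> borel_measurable borel"
        by (intro borel_measurable_continuous_onI continuous_intros)
      show ?thesis unfolding lborel_prod measurable_lborel1 by measurable
    qed
  qed simp
  also have "\<dots> \<le> (\<integral>\<^sup>+x. indicator (qbox \<rho>) x * (\<integral>\<^sup>+y. ennreal (wt ((x - \<tau>) + y)) \<partial>lborel) \<partial>lborel)"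
    by (subst nn_integral_cmult[symmetric])
       (auto intro!: nn_integral_mono simp: indicator_def mem_qbox_Pair algebra_simps)
  also have "\<dots> = (\<integral>\<^sup>+x. indicator (qbox \<rho>) (x::'a) * (\<integral>\<^sup>+y. ennreal (wt (y::'a)) \<partial>lborel) \<partial>lborel)"
    by (subst nn_integral_lborel_translate) simp_all
  also have "\<dots> = emeasure lborel (qbox \<rho> :: 'a set) * ennreal (LINT z|lborel. wt (z::'a))"
    by (subst nn_integral_multc) (simp_all add: nn_integral_eq_integral integrable_wt)
  also have "\<dots> = ennreal ((2 * \<rho>) ^ DIM('a) * (LINT z|lborel. wt (z::'a)))"
    using assms by (subst ennreal_mult) (auto simp: emeasure_qbox intro!: integral_nonneg_AE)
  finally show ?thesis .
qed

text \<open>Cauchy-Schwarz over the frequency box, which has twice the dimension of the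
  space.\<close>

lemma phase_sup_bound:
  fixes b :: "'a::euclidean_space \<times> 'a \<times> 'a \<Rightarrow> complex"
  assumes b: "\<And>z. norm (b z) \<le> B * indicator (qbox 2 \<times> qbox \<rho>) z" and B: "0 \<le> B" and \<rho>: "0 \<le> \<rho>"
    and [measurable]: "\<Phi> \<in> borel_measurable borel"
  shows "ennreal ((norm (LINT \<zeta>|lborel. b (x, \<zeta>) * phase x \<zeta> * \<Phi> \<zeta>))\<^sup>2) \<le>
    ennreal (B\<^sup>2 * (2 * \<rho>) ^ (2 * DIM('a))) * (\<integral>\<^sup>+\<zeta>. indicator (qbox \<rho>) \<zeta> * ennreal ((norm (\<Phi> \<zeta>))\<^sup>2) \<partial>lborel)"
    (is "ennreal ((norm ?U)\<^sup>2) \<le> _")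
proof -
  have "ennreal (norm ?U) \<le> (\<integral>\<^sup>+\<zeta>. ennreal (norm (b (x, \<zeta>) * phase x \<zeta> * \<Phi> \<zeta>)) \<partial>lborel)"
    by (rule nn_norm_integral)
  \<comment> \<open>The indicator is written twice: under Cauchy-Schwarz one copy becomes the volume
    of the box, the other truncates \<open>\<Phi>\<close>.\<close>
  also have "\<dots> \<le> (\<integral>\<^sup>+\<zeta>. ennreal B * (indicator (qbox \<rho>) \<zeta> * (indicator (qbox \<rho>) \<zeta> * ennreal (norm (\<Phi> \<zeta>)))) \<partial>lborel)"
  proof (intro nn_integral_mono)
    fix \<zeta>
    have "norm (b (x, \<zeta>)) * norm (\<Phi> \<zeta>) \<le> B * indicator (qbox \<rho>) \<zeta> * norm (\<Phi> \<zeta>)"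
      using b[of "(x, \<zeta>)"] B by (intro mult_right_mono, cases "x \<in> qbox 2") (auto simp: indicator_def)
    then have "ennreal (norm (b (x, \<zeta>)) * norm (\<Phi> \<zeta>)) \<le> ennreal (B * indicator (qbox \<rho>) \<zeta> * norm (\<Phi> \<zeta>))"
      by (rule ennreal_leI)
    then show "ennreal (norm (b (x, \<zeta>) * phase x \<zeta> * \<Phi> \<zeta>)) \<le>
        ennreal B * (indicator (qbox \<rho>) \<zeta> * (indicator (qbox \<rho>) \<zeta> * ennreal (norm (\<Phi> \<zeta>))))"
      using B by (cases "\<zeta> \<in> qbox \<rho>") (simp_all add: norm_mult ennreal_mult)
  qed
  also have "\<dots> = ennreal B * (\<integral>\<^sup>+\<zeta>. indicator (qbox \<rho>) \<zeta> * (indicator (qbox \<rho>) \<zeta> * ennreal (norm (\<Phi> \<zeta>))) \<partial>lborel)"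
    by (rule nn_integral_cmult) measurable
  finally have "(ennreal (norm ?U))\<^sup>2 \<le>
      (ennreal B * (\<integral>\<^sup>+\<zeta>. indicator (qbox \<rho>) \<zeta> * (indicator (qbox \<rho>) \<zeta> * ennreal (norm (\<Phi> \<zeta>))) \<partial>lborel))\<^sup>2"
    by (intro power_mono) auto
  also have "\<dots> \<le> (ennreal B)\<^sup>2 * ((\<integral>\<^sup>+\<zeta>. (indicator (qbox \<rho>) (\<zeta> :: 'a \<times> 'a))\<^sup>2 \<partial>lborel) *
       (\<integral>\<^sup>+\<zeta>. (indicator (qbox \<rho>) \<zeta> * ennreal (norm (\<Phi> \<zeta>)))\<^sup>2 \<partial>lborel))"
    by (subst power_mult_distrib) (intro mult_left_mono Cauchy_Schwarz_nn_integral; simp)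
  also have "(\<integral>\<^sup>+\<zeta>. (indicator (qbox \<rho>) (\<zeta> :: 'a \<times> 'a))\<^sup>2 \<partial>lborel) = emeasure lborel (qbox \<rho> :: ('a \<times> 'a) set)"
  proof -
    have "(\<integral>\<^sup>+\<zeta>. (indicator (qbox \<rho>) (\<zeta> :: 'a \<times> 'a))\<^sup>2 \<partial>lborel) = (\<integral>\<^sup>+\<zeta>. indicator (qbox \<rho>) (\<zeta> :: 'a \<times> 'a) \<partial>lborel)"
      by (intro nn_integral_cong) (auto simp: indicator_def)
    then show ?thesis by simp
  qed
  also have "\<dots> = ennreal ((2 * \<rho>) ^ (2 * DIM('a)))"
    using emeasure_qbox[OF \<rho>, where ?'a = "'a \<times> 'a"] by (simp add: mult_2[of "DIM('a)"])
  also have "(\<integral>\<^sup>+\<zeta>. (indicator (qbox \<rho>) \<zeta> * ennreal (norm (\<Phi> \<zeta>)))\<^sup>2 \<partial>lborel) =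
      (\<integral>\<^sup>+\<zeta>. indicator (qbox \<rho>) \<zeta> * ennreal ((norm (\<Phi> \<zeta>))\<^sup>2) \<partial>lborel)"
    by (auto intro!: nn_integral_cong simp: indicator_def ennreal_power)
  finally show ?thesis
    using B \<rho> by (simp add: ennreal_power ennreal_mult mult.assoc)
qed

text \<open>Squaring and integrating in x first gives a quadratic form in \<open>\<Phi>\<close>. Its
  kernel is the transform, in x, of a product of two slices of \<open>b\<close>, evaluated at the
  difference of the two frequency sums; two x-derivatives per variable make it decay like the
  weight, and a Schur test with \<open>nn_integral_box_wt\<close> finishes.\<close>

lemma phase_L2_bound:
  fixes b :: "'a::euclidean_space \<times> 'a \<times> 'a \<Rightarrow> complex"
  assumes b: "ckb (2 * DIM('a)) (\<lambda>z. B * indicator (qbox 2 \<times> qbox \<rho>) z) b" and B: "0 \<le> B" and \<rho>: "0 \<le> \<rho>"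
    and \<Phi>m [measurable]: "\<Phi> \<in> borel_measurable borel" and \<Phi>b: "\<And>\<zeta>. norm (\<Phi> \<zeta>) \<le> c\<Phi>"
  shows "(\<integral>\<^sup>+x. ennreal ((norm (LINT \<zeta>|lborel. b (x, \<zeta>) * phase x \<zeta> * \<Phi> \<zeta>))\<^sup>2) \<partial>lborel) \<le>
    ennreal (2 * (4 ^ DIM('a) * (4 ^ DIM('a) * 4 ^ DIM('a))) * B\<^sup>2 * ((2 * \<rho>) ^ DIM('a) * (LINT z|lborel. wt (z::'a)))) *
      (\<integral>\<^sup>+\<zeta>. indicator (qbox \<rho>) \<zeta> * ennreal ((norm (\<Phi> \<zeta>))\<^sup>2) \<partial>lborel)"
proof -
  have bm [measurable]: "b \<in> borel_measurable borel" by (rule ckb_measurable[OF b])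
  have bb: "norm (b z) \<le> B * indicator (qbox 2 \<times> qbox \<rho>) z" for z by (rule ckb_bound[OF b])
  define \<kappa> where "\<kappa> x \<zeta> = b (x, \<zeta>) * phase x \<zeta>" for x and \<zeta> :: "'a \<times> 'a"
  have [measurable]: "(\<lambda>(x, \<zeta>). \<kappa> x \<zeta>) \<in> borel_measurable (borel \<Otimes>\<^sub>M borel)"
    unfolding \<kappa>_def by measurable
  have \<kappa>b: "norm (\<kappa> x \<zeta>) \<le> B * indicator (qbox 2) x * indicator (qbox \<rho>) \<zeta>" for x \<zeta>
    using bb[of "(x, \<zeta>)"] by (simp add: \<kappa>_def norm_mult indicator_times)
  have \<kappa>B: "norm (\<kappa> x \<zeta>) \<le> B" for x \<zeta>
    using \<kappa>b[of x \<zeta>] B by (cases "x \<in> qbox 2"; cases "\<zeta> \<in> qbox \<rho>") auto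
  \<comment> \<open>The truncation changes nothing under the integral, because \<open>b\<close>
    vanishes outside the box, and makes the function integrable, as Fubini demands.\<close>
  define \<Phi>1 where "\<Phi>1 \<zeta> = indicator (qbox \<rho>) \<zeta> * \<Phi> \<zeta>" for \<zeta>
  have [measurable]: "\<Phi>1 \<in> borel_measurable borel" unfolding \<Phi>1_def by measurable
  have c\<Phi>: "0 \<le> c\<Phi>" using \<Phi>b[of 0] norm_ge_zero order_trans by blast
  have i\<Phi>: "integrable lborel \<Phi>1"
  proof (rule integrable_wt_bound)
    fix z :: "'a \<times> 'a"
    have "norm (\<Phi>1 z) \<le> c\<Phi> * indicator (qbox \<rho>) z"
      using \<Phi>b[of z] by (auto simp: \<Phi>1_def indicator_def)
    also have "\<dots> \<le> c\<Phi> * ((1 + \<rho>\<^sup>2) ^ DIM('a \<times> 'a) * wt z)"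
      using indicator_qbox_le_wt c\<Phi> by (intro mult_left_mono)
    finally show "norm (\<Phi>1 z) \<le> (c\<Phi> * (1 + \<rho>\<^sup>2) ^ DIM('a \<times> 'a)) * wt z" by (simp only: mult.assoc)
  qed measurable
  define U where "U x = (LINT \<zeta>|lborel. \<kappa> x \<zeta> * \<Phi>1 \<zeta>)" for x
  have U: "(LINT \<zeta>|lborel. b (x, \<zeta>) * phase x \<zeta> * \<Phi> \<zeta>) = U x" for x
    unfolding U_def
  proof (intro Bochner_Integration.integral_cong refl)
    fix \<zeta>
    show "b (x, \<zeta>) * phase x \<zeta> * \<Phi> \<zeta> = \<kappa> x \<zeta> * \<Phi>1 \<zeta>"
      using bb[of "(x, \<zeta>)"] by (cases "\<zeta> \<in> qbox \<rho>") (auto simp: \<Phi>1_def \<kappa>_def)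
  qed
  have Um [measurable]: "U \<in> borel_measurable borel"
    unfolding U_def by measurable
  have Ub: "norm (U x) \<le> (LINT \<zeta>|lborel. norm (\<Phi>1 \<zeta>)) * B * indicator (qbox 2) x" for x
  proof -
    have "norm (U x) \<le> (LINT \<zeta>|lborel. norm (\<kappa> x \<zeta> * \<Phi>1 \<zeta>))"
      unfolding U_def by (rule integral_norm_bound)
    also have "\<dots> \<le> (LINT \<zeta>|lborel. (B * indicator (qbox 2) x) * norm (\<Phi>1 \<zeta>))"
    proof (rule integral_mono')
      show "integrable lborel (\<lambda>\<zeta>. (B * indicator (qbox 2) x) * norm (\<Phi>1 \<zeta>))" using i\<Phi> by simp
      fix \<zeta>
      have "norm (\<kappa> x \<zeta>) \<le> B * indicator (qbox 2) x"
        using \<kappa>b[of x \<zeta>] B by (cases "x \<in> qbox 2"; cases "\<zeta> \<in> qbox \<rho>") auto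
      then show "norm (\<kappa> x \<zeta> * \<Phi>1 \<zeta>) \<le> (B * indicator (qbox 2) x) * norm (\<Phi>1 \<zeta>)"
        unfolding norm_mult by (intro mult_right_mono) auto
      show "0 \<le> (B * indicator (qbox 2) x) * norm (\<Phi>1 \<zeta>)" using B by simp
    qed
    finally show ?thesis by (simp add: mult_ac)
  qed
  define L where "L = (LINT \<zeta>|lborel. norm (\<Phi>1 \<zeta>)) * B"
  have L: "0 \<le> L" using B unfolding L_def by (intro mult_nonneg_nonneg integral_nonneg_AE) auto
  have Ubw: "norm (U x) \<le> (L * (1 + 2\<^sup>2) ^ DIM('a)) * wt x" for x
    using order_trans[OF Ub[of x, folded L_def] mult_left_mono[OF indicator_qbox_le_wt L]]
    by (simp only: mult.assoc)
  have iU: "integrable lborel U" using Ubw by (rule integrable_wt_bound) measurable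
  have icU: "integrable lborel (\<lambda>x. cnj (U x))" using iU by simp
  have i\<kappa>: "integrable lborel (\<lambda>x. \<kappa> x \<zeta>)" for \<zeta>
  proof (rule integrable_wt_bound)
    fix x :: 'a
    have "norm (\<kappa> x \<zeta>) \<le> B * indicator (qbox 2) x"
      using \<kappa>b[of x \<zeta>] B by (cases "x \<in> qbox 2"; cases "\<zeta> \<in> qbox \<rho>") auto
    also have "\<dots> \<le> B * ((1 + 2\<^sup>2) ^ DIM('a) * wt x)"
      using indicator_qbox_le_wt B by (intro mult_left_mono)
    finally show "norm (\<kappa> x \<zeta>) \<le> (B * (1 + 2\<^sup>2) ^ DIM('a)) * wt x" by (simp only: mult.assoc)
  qed measurable
  \<comment> \<open>The three powers of 4 are the cost of \<open>lop\<close> in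
    \<open>ft_decay\<close>, the Leibniz constant \<open>2 ^ (2 * DIM('a))\<close> of the product of
    two slices, and the volume of \<open>qbox 2\<close>.\<close>
  define c1 where "c1 = 4 ^ DIM('a) * (4 ^ DIM('a) * 4 ^ DIM('a)) * B\<^sup>2"
  have c1: "0 \<le> c1" by (simp add: c1_def)
  define N where "N \<zeta> \<zeta>' = (LINT x|lborel. cnj (\<kappa> x \<zeta>') * \<kappa> x \<zeta>)" for \<zeta> \<zeta>'
  have N: "norm (N \<zeta> \<zeta>') \<le> c1 * wt (fst \<zeta>' + snd \<zeta>' - (fst \<zeta> + snd \<zeta>))" for \<zeta> \<zeta>'
  proof -
    define h where "h x = b (x, \<zeta>) * cnj (b (x, \<zeta>'))" for x
    have sl: "ckb (2 * DIM('a)) (\<lambda>x. B * indicator (qbox 2) x) (\<lambda>x. b (x, \<zeta>))" for \<zeta>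
    proof -
      have "ckb (2 * DIM('a)) (\<lambda>x. 1 ^ (2 * DIM('a)) * (B * indicator (qbox 2 \<times> qbox \<rho>) (x, \<zeta>))) (\<lambda>x. b (x, \<zeta>))"
      proof (rule ckb_comp[where A = "\<lambda>x. (x, \<zeta>)" and S = 1, OF _ _ _ b])
        show "\<exists>s w. w \<in> Basis \<and> \<bar>s\<bar> \<le> 1 \<and> (\<forall>x t. (x + t *\<^sub>R v, \<zeta>) = (x, \<zeta>) + (t * s) *\<^sub>R w)"
          if "v \<in> Basis" for v :: 'a
          using that by (intro exI[of _ 1] exI[of _ "(v, 0)"]) (auto simp: Basis_prod_def)
      qed (auto intro!: continuous_intros)
      then show ?thesis
        by (rule ckb_mono) (use B in \<open>auto simp: indicator_def\<close>)
    qed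
    have hb: "ckb (2 * DIM('a)) (\<lambda>x. 2 ^ (2 * DIM('a)) * (B * indicator (qbox 2) x * (B * indicator (qbox 2) x))) h"
      unfolding h_def by (intro ckb_mult ckb_cnj sl)
    have hb': "ckb (2 * DIM('a)) (\<lambda>x. (4 ^ DIM('a) * B\<^sup>2) * indicator (qbox 2) x) h"
      by (rule ckb_mono[OF hb]) (auto simp: indicator_def power_mult power2_eq_square)
    have Nh: "N \<zeta> \<zeta>' = ft h (fst \<zeta>' + snd \<zeta>' - (fst \<zeta> + snd \<zeta>))"
      unfolding N_def ft_def h_def \<kappa>_def
    proof (intro Bochner_Integration.integral_cong refl)
      fix x
      have split: "cnj (b1 * e1) * (b2 * e2) = (cnj e1 * e2) * (b2 * cnj b1)" for b1 b2 e1 e2 :: complex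
        by simp
      have eq: "cnj (phase x \<zeta>') * phase x \<zeta> =
          exp (- \<i> * complex_of_real (x \<bullet> (fst \<zeta>' + snd \<zeta>' - (fst \<zeta> + snd \<zeta>))))"
        unfolding exp_cnj exp_add[symmetric]
        by (simp add: inner_prod_def inner_diff_right inner_add_right inner_commute algebra_simps)
      show "cnj (b (x, \<zeta>') * phase x \<zeta>') * (b (x, \<zeta>) * phase x \<zeta>) =
          exp (- \<i> * complex_of_real (x \<bullet> (fst \<zeta>' + snd \<zeta>' - (fst \<zeta> + snd \<zeta>)))) * (b (x, \<zeta>) * cnj (b (x, \<zeta>')))"
        by (simp only: split eq)
    qed
    have bd: "norm (ft h u) \<le> 4 ^ DIM('a) * (LINT x|lborel. (4 ^ DIM('a) * B\<^sup>2) * indicator (qbox 2) (x::'a)) * wt u" for u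
    proof (rule ft_decay[OF hb'])
      show "(4 ^ DIM('a) * B\<^sup>2) * indicator (qbox 2) z \<le> ((4 ^ DIM('a) * B\<^sup>2) * (1 + 2\<^sup>2) ^ DIM('a)) * wt z" for z :: 'a
        using mult_left_mono[OF indicator_qbox_le_wt[of 2 z], of "4 ^ DIM('a) * B\<^sup>2"] by (simp add: mult.assoc)
    qed measurable
    have meas: "(LINT x|lborel. (4 ^ DIM('a) * B\<^sup>2) * indicator (qbox 2) (x::'a)) = 4 ^ DIM('a) * B\<^sup>2 * 4 ^ DIM('a)"
      by (simp add: measure_def emeasure_qbox)
    show ?thesis unfolding Nh using bd[of "fst \<zeta>' + snd \<zeta>' - (fst \<zeta> + snd \<zeta>)", unfolded meas] by (simp add: c1_def mult_ac)
  qed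
  define J where "J = (LINT x|lborel. cnj (U x) * U x)"
  have J: "J = (LINT \<zeta>|lborel. \<Phi>1 \<zeta> * (LINT \<zeta>'|lborel. cnj (\<Phi>1 \<zeta>') * N \<zeta> \<zeta>'))"
  proof -
    have J1: "J = (LINT \<zeta>|lborel. \<Phi>1 \<zeta> * (LINT x|lborel. \<kappa> x \<zeta> * cnj (U x)))"
      unfolding J_def by (subst (2) U_def) (rule fubini_kernel[OF icU i\<Phi> _ \<kappa>B], measurable)
    have J2: "(LINT x|lborel. \<kappa> x \<zeta> * cnj (U x)) = (LINT \<zeta>'|lborel. cnj (\<Phi>1 \<zeta>') * N \<zeta> \<zeta>')" for \<zeta>
    proof -
      have "cnj (U x) = (LINT \<zeta>'|lborel. cnj (\<kappa> x \<zeta>') * cnj (\<Phi>1 \<zeta>'))" for x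
        unfolding U_def by (subst Bochner_Integration.integral_cnj[symmetric]) simp
      then have "(LINT x|lborel. \<kappa> x \<zeta> * cnj (U x)) =
          (LINT x|lborel. \<kappa> x \<zeta> * (LINT \<zeta>'|lborel. cnj (\<kappa> x \<zeta>') * cnj (\<Phi>1 \<zeta>')))" by simp
      also have "\<dots> = (LINT \<zeta>'|lborel. cnj (\<Phi>1 \<zeta>') * (LINT x|lborel. cnj (\<kappa> x \<zeta>') * \<kappa> x \<zeta>))"
      proof (rule fubini_kernel[OF i\<kappa>, where c = B])
        show "integrable lborel (\<lambda>\<zeta>'. cnj (\<Phi>1 \<zeta>'))" using i\<Phi> by simp
        show "norm (cnj (\<kappa> x y)) \<le> B" for x y using \<kappa>B by simp
      qed measurable
      finally show ?thesis by (simp only: N_def)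
    qed
    show ?thesis unfolding J1 J2 ..
  qed
  define u where "u \<zeta> = ennreal ((norm (\<Phi>1 \<zeta>))\<^sup>2)" for \<zeta>
  define v where "v \<zeta> = (indicator (qbox \<rho>) \<zeta> :: ennreal)" for \<zeta> :: "'a \<times> 'a"
  have [measurable]: "u \<in> borel_measurable borel" "v \<in> borel_measurable borel"
    unfolding u_def v_def by measurable
  define k where "k \<zeta> \<zeta>' = ennreal (wt (fst \<zeta>' + snd \<zeta>' - (fst \<zeta> + snd \<zeta>)))" for \<zeta> \<zeta>' :: "'a \<times> 'a"
  define s where "s \<zeta> = fst \<zeta> + snd \<zeta>" for \<zeta> :: "'a \<times> 'a"
  have [measurable]: "s \<in> borel_measurable borel"
    unfolding s_def by (intro borel_measurable_continuous_onI continuous_intros)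
  have [measurable]: "(\<lambda>(x, y). k x y) \<in> borel_measurable (borel \<Otimes>\<^sub>M borel)"
    unfolding k_def s_def[symmetric] by measurable
  have ksym: "k \<zeta>' \<zeta> = k \<zeta> \<zeta>'" for \<zeta> \<zeta>' by (simp add: k_def wt_minus_commute)
  have "(\<integral>\<^sup>+x. ennreal ((norm (U x))\<^sup>2) \<partial>lborel) = ennreal (LINT x|lborel. (norm (U x))\<^sup>2)"
  proof (intro nn_integral_eq_integral)
    have "integrable lborel (\<lambda>x. norm (U x * U x))"
    proof (rule Bochner_Integration.integrable_bound[OF integrable_mult_right[OF integrable_norm[OF iU], of L]])
      have "norm (U x) \<le> L" for x
        using Ub[of x] L by (cases "x \<in> qbox 2") (auto simp: L_def)
      then show "AE x in lborel. norm (norm (U x * U x)) \<le> norm (L * norm (U x))"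
        using L by (intro AE_I2) (auto simp: norm_mult intro!: mult_right_mono)
    qed measurable
    then show "integrable lborel (\<lambda>x. (norm (U x))\<^sup>2)" by (simp add: norm_mult power2_eq_square)
  qed simp
  also have "(LINT x|lborel. (norm (U x))\<^sup>2) = norm J"
  proof -
    have "complex_of_real (LINT x|lborel. (norm (U x))\<^sup>2) = J"
      unfolding J_def by (subst integral_complex_of_real[symmetric])
        (simp add: complex_norm_square mult.commute del: of_real_power)
    then have "norm (complex_of_real (LINT x|lborel. (norm (U x))\<^sup>2)) = norm J" by simp
    moreover have "0 \<le> (LINT x|lborel. (norm (U x))\<^sup>2)" by (intro integral_nonneg_AE) auto
    ultimately show ?thesis by simp
  qed
  also have "ennreal (norm J) \<le> (\<integral>\<^sup>+\<zeta>. ennreal (norm (\<Phi>1 \<zeta> * (LINT \<zeta>'|lborel. cnj (\<Phi>1 \<zeta>') * N \<zeta> \<zeta>'))) \<partial>lborel)"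
    unfolding J by (rule nn_norm_integral)
  \<comment> \<open>Schur test: the product of the two values of \<open>\<Phi>1\<close> is at most
    the sum of their squares, so in each summand one of the variables occurs only in the kernel and
    in the indicator of the box.\<close>
  also have "\<dots> \<le> (\<integral>\<^sup>+\<zeta>. (\<integral>\<^sup>+\<zeta>'. ennreal c1 * (u \<zeta> * (v \<zeta>' * k \<zeta> \<zeta>') + u \<zeta>' * (v \<zeta> * k \<zeta> \<zeta>')) \<partial>lborel) \<partial>lborel)"
  proof (intro nn_integral_mono)
    fix \<zeta> :: "'a \<times> 'a"
    have "ennreal (norm (\<Phi>1 \<zeta> * (LINT \<zeta>'|lborel. cnj (\<Phi>1 \<zeta>') * N \<zeta> \<zeta>'))) =
       ennreal (norm (LINT \<zeta>'|lborel. \<Phi>1 \<zeta> * (cnj (\<Phi>1 \<zeta>') * N \<zeta> \<zeta>')))"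
      by simp
    also have "\<dots> \<le> (\<integral>\<^sup>+\<zeta>'. ennreal (norm (\<Phi>1 \<zeta> * (cnj (\<Phi>1 \<zeta>') * N \<zeta> \<zeta>'))) \<partial>lborel)"
      by (rule nn_norm_integral)
    also have "\<dots> \<le> (\<integral>\<^sup>+\<zeta>'. ennreal c1 * (u \<zeta> * (v \<zeta>' * k \<zeta> \<zeta>') + u \<zeta>' * (v \<zeta> * k \<zeta> \<zeta>')) \<partial>lborel)"
    proof (intro nn_integral_mono)
      fix \<zeta>' :: "'a \<times> 'a"
      define w where "w = wt (fst \<zeta>' + snd \<zeta>' - (fst \<zeta> + snd \<zeta>))"
      show "ennreal (norm (\<Phi>1 \<zeta> * (cnj (\<Phi>1 \<zeta>') * N \<zeta> \<zeta>'))) \<le> ennreal c1 * (u \<zeta> * (v \<zeta>' * k \<zeta> \<zeta>') + u \<zeta>' * (v \<zeta> * k \<zeta> \<zeta>'))"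
      proof (cases "\<zeta> \<in> qbox \<rho> \<and> \<zeta>' \<in> qbox \<rho>")
        case True
        have w: "0 \<le> w" by (simp add: w_def)
        have ab: "p * q \<le> p\<^sup>2 + q\<^sup>2" if "0 \<le> p" "0 \<le> q" for p q :: real
          using sum_squares_bound[of p q] mult_nonneg_nonneg[OF that] unfolding mult.assoc by linarith
        have "norm (\<Phi>1 \<zeta> * (cnj (\<Phi>1 \<zeta>') * N \<zeta> \<zeta>')) = (norm (\<Phi>1 \<zeta>) * norm (\<Phi>1 \<zeta>')) * norm (N \<zeta> \<zeta>')"
          by (simp add: norm_mult)
        also have "\<dots> \<le> ((norm (\<Phi>1 \<zeta>))\<^sup>2 + (norm (\<Phi>1 \<zeta>'))\<^sup>2) * (c1 * w)"
          unfolding w_def using N c1 by (intro mult_mono ab) auto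
        also have "\<dots> = c1 * ((norm (\<Phi>1 \<zeta>))\<^sup>2 * w + (norm (\<Phi>1 \<zeta>'))\<^sup>2 * w)"
          by (simp add: algebra_simps)
        finally have "ennreal (norm (\<Phi>1 \<zeta> * (cnj (\<Phi>1 \<zeta>') * N \<zeta> \<zeta>'))) \<le>
            ennreal (c1 * ((norm (\<Phi>1 \<zeta>))\<^sup>2 * w + (norm (\<Phi>1 \<zeta>'))\<^sup>2 * w))" by (rule ennreal_leI)
        also have "\<dots> = ennreal c1 * (u \<zeta> * (v \<zeta>' * k \<zeta> \<zeta>') + u \<zeta>' * (v \<zeta> * k \<zeta> \<zeta>'))"
          using True c1 w by (simp add: u_def v_def k_def ennreal_mult ennreal_plus w_def[symmetric])
        finally show ?thesis .
      next
        case False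
        then show ?thesis by (auto simp: \<Phi>1_def)
      qed
    qed
    finally show "ennreal (norm (\<Phi>1 \<zeta> * (LINT \<zeta>'|lborel. cnj (\<Phi>1 \<zeta>') * N \<zeta> \<zeta>'))) \<le>
      (\<integral>\<^sup>+\<zeta>'. ennreal c1 * (u \<zeta> * (v \<zeta>' * k \<zeta> \<zeta>') + u \<zeta>' * (v \<zeta> * k \<zeta> \<zeta>')) \<partial>lborel)" .
  qed
  also have "\<dots> = ennreal c1 * ((\<integral>\<^sup>+\<zeta>. (\<integral>\<^sup>+\<zeta>'. u \<zeta> * (v \<zeta>' * k \<zeta> \<zeta>') \<partial>lborel) \<partial>lborel) +
      (\<integral>\<^sup>+\<zeta>. (\<integral>\<^sup>+\<zeta>'. u \<zeta>' * (v \<zeta> * k \<zeta> \<zeta>') \<partial>lborel) \<partial>lborel))"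
    by (simp add: nn_integral_cmult nn_integral_add)
  also have "(\<integral>\<^sup>+\<zeta>. (\<integral>\<^sup>+\<zeta>'. u \<zeta>' * (v \<zeta> * k \<zeta> \<zeta>') \<partial>lborel) \<partial>lborel) =
      (\<integral>\<^sup>+\<zeta>. (\<integral>\<^sup>+\<zeta>'. u \<zeta> * (v \<zeta>' * k \<zeta> \<zeta>') \<partial>lborel) \<partial>lborel)"
    by (subst lborel_pair.Fubini') (simp_all add: ksym)
  also have "(\<integral>\<^sup>+\<zeta>. (\<integral>\<^sup>+\<zeta>'. u \<zeta> * (v \<zeta>' * k \<zeta> \<zeta>') \<partial>lborel) \<partial>lborel) \<le>
      (\<integral>\<^sup>+\<zeta>. u \<zeta> * ennreal ((2 * \<rho>) ^ DIM('a) * (LINT z|lborel. wt (z::'a))) \<partial>lborel)"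
  proof (intro nn_integral_mono)
    fix \<zeta> :: "'a \<times> 'a"
    have "(\<integral>\<^sup>+\<zeta>'. u \<zeta> * (v \<zeta>' * k \<zeta> \<zeta>') \<partial>lborel) = u \<zeta> * (\<integral>\<^sup>+\<zeta>'. v \<zeta>' * k \<zeta> \<zeta>' \<partial>lborel)"
      by (rule nn_integral_cmult) measurable
    also have "\<dots> \<le> u \<zeta> * ennreal ((2 * \<rho>) ^ DIM('a) * (LINT z|lborel. wt (z::'a)))"
      unfolding v_def k_def by (intro mult_left_mono nn_integral_box_wt \<rho>) simp
    finally show "(\<integral>\<^sup>+\<zeta>'. u \<zeta> * (v \<zeta>' * k \<zeta> \<zeta>') \<partial>lborel) \<le>
        u \<zeta> * ennreal ((2 * \<rho>) ^ DIM('a) * (LINT z|lborel. wt (z::'a)))" .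
  qed
  also have "\<dots> = (\<integral>\<^sup>+\<zeta>. u \<zeta> \<partial>lborel) * ennreal ((2 * \<rho>) ^ DIM('a) * (LINT z|lborel. wt (z::'a)))"
    by (rule nn_integral_multc) measurable
  also have "(\<integral>\<^sup>+\<zeta>. u \<zeta> \<partial>lborel) = (\<integral>\<^sup>+\<zeta>. indicator (qbox \<rho>) \<zeta> * ennreal ((norm (\<Phi> \<zeta>))\<^sup>2) \<partial>lborel)"
    unfolding u_def \<Phi>1_def by (intro nn_integral_cong) (auto simp: indicator_def)
  finally have fin: "(\<integral>\<^sup>+x. ennreal ((norm (U x))\<^sup>2) \<partial>lborel) \<le> ennreal c1 *
     ((\<integral>\<^sup>+\<zeta>. indicator (qbox \<rho>) \<zeta> * ennreal ((norm (\<Phi> \<zeta>))\<^sup>2) \<partial>lborel) * ennreal ((2 * \<rho>) ^ DIM('a) * (LINT z|lborel. wt (z::'a))) +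
      (\<integral>\<^sup>+\<zeta>. indicator (qbox \<rho>) \<zeta> * ennreal ((norm (\<Phi> \<zeta>))\<^sup>2) \<partial>lborel) * ennreal ((2 * \<rho>) ^ DIM('a) * (LINT z|lborel. wt (z::'a))))"
    by (simp add: add_mono mult_left_mono)
  have w0: "0 \<le> (2 * \<rho>) ^ DIM('a) * (LINT z|lborel. wt (z::'a))"
    using \<rho> by (intro mult_nonneg_nonneg integral_nonneg_AE) auto
  have arith: "ennreal c1 * (X * ennreal W + X * ennreal W) = ennreal (2 * c1 * W) * X"
    if "0 \<le> W" for X W
  proof -
    have "ennreal (2 * c1 * W) = 2 * ennreal c1 * ennreal W" using c1 that by (simp add: ennreal_mult)
    then show ?thesis by (simp add: mult_2[symmetric] mult_ac)
  qed
  show ?thesis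
    unfolding U using fin unfolding arith[OF w0] by (simp add: c1_def mult_ac)
qed

text \<open>The operator of \<open>bipsido\<close> as one integral over the pair of frequencies,
  which lets the Fourier calculus on the product space act on it.\<close>

definition bilop :: "('a::euclidean_space \<times> 'a \<times> 'a \<Rightarrow> complex) \<Rightarrow> ('a \<Rightarrow> complex) \<Rightarrow> ('a \<Rightarrow> complex) \<Rightarrow> 'a \<Rightarrow> complex" where
  "bilop b f g x = (LINT \<zeta>|lborel. b (x, \<zeta>) * phase x \<zeta> * (ft f (fst \<zeta>) * ft g (snd \<zeta>)))"

text \<open>Of the 6n derivatives, 4n go into dividing f and g by \<open>pw\<close>, two for each of
  the 2n frequency variables; the remaining 2n are those \<open>phase_L2_bound\<close> spends in x.
  Only local L^2 norms of the transforms of the divided functions remain.\<close>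

lemma local_estimate:
  "\<exists>C>0. \<forall>B \<rho> P Q (b :: 'a::euclidean_space \<times> 'a \<times> 'a \<Rightarrow> complex) f g.
     ckb (6 * DIM('a)) (\<lambda>z. B * indicator (qbox 2 \<times> qbox \<rho>) z) b \<longrightarrow> 0 \<le> B \<longrightarrow> 0 \<le> \<rho> \<longrightarrow>
     integrable lborel f \<longrightarrow> integrable lborel g \<longrightarrow> 0 \<le> P \<longrightarrow> 0 \<le> Q \<longrightarrow>
     (\<integral>\<^sup>+\<xi>. indicator (qbox \<rho>) \<xi> * ennreal ((norm (ft (\<lambda>x. f x / pw x) \<xi>))\<^sup>2) \<partial>lborel) \<le> ennreal P \<longrightarrow>
     (\<integral>\<^sup>+\<eta>. indicator (qbox \<rho>) \<eta> * ennreal ((norm (ft (\<lambda>x. g x / pw x) \<eta>))\<^sup>2) \<partial>lborel) \<le> ennreal Q \<longrightarrow>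
     (\<integral>\<^sup>+x. ennreal ((norm (bilop b f g x))\<^sup>2) \<partial>lborel) \<le> ennreal (C * B\<^sup>2 * \<rho> ^ DIM('a) * (P * Q)) \<and>
     (\<forall>x. (norm (bilop b f g x))\<^sup>2 \<le> C * B\<^sup>2 * \<rho> ^ (2 * DIM('a)) * (P * Q))"
proof -
  define n where "n = DIM('a)"
  define bs :: "('a \<times> 'a) list" where "bs = basis_list @ basis_list"
  have lbs: "length bs = 4 * n" "set bs \<subseteq> Basis"
    by (simp_all add: bs_def length_basis_list basis_list n_def)
  \<comment> \<open>The cost of the \<open>4 * n\<close> conjugated derivatives, each bounded with
    the constant of \<open>ckb_phase_dp\<close> for \<open>K = 6 * n\<close>.\<close>
  define D :: real where "D = (5 * 2 ^ (6 * n)) ^ (4 * n)"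
  define w where "w = (LINT z|lborel. wt (z::'a))"
  have w: "0 \<le> w" unfolding w_def by (intro integral_nonneg_AE) simp
  define C1 where "C1 = 2 * (4 ^ n * (4 ^ n * 4 ^ n)) * D\<^sup>2 * (2 ^ n * w)"
  define C2 where "C2 = D\<^sup>2 * 2 ^ (2 * n)"
  have C12: "0 \<le> C1" "0 \<le> C2" using w by (auto simp: C1_def C2_def)
  show ?thesis
    unfolding bilop_def
  proof (intro exI[of _ "C1 + C2 + 1"] conjI allI impI)
    show "0 < C1 + C2 + 1" using C12 by simp
    fix B \<rho> P Q :: real and b :: "'a \<times> 'a \<times> 'a \<Rightarrow> complex" and f g :: "'a \<Rightarrow> complex"
    assume b: "ckb (6 * DIM('a)) (\<lambda>z. B * indicator (qbox 2 \<times> qbox \<rho>) z) b" and B: "0 \<le> B" and \<rho>: "0 \<le> \<rho>"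
      and f: "integrable lborel f" and g: "integrable lborel g" and PQ0: "0 \<le> P" "0 \<le> Q"
      and P: "(\<integral>\<^sup>+\<xi>. indicator (qbox \<rho>) \<xi> * ennreal ((norm (ft (\<lambda>x. f x / pw x) \<xi>))\<^sup>2) \<partial>lborel) \<le> ennreal P"
      and Q: "(\<integral>\<^sup>+\<eta>. indicator (qbox \<rho>) \<eta> * ennreal ((norm (ft (\<lambda>x. g x / pw x) \<eta>))\<^sup>2) \<partial>lborel) \<le> ennreal Q"
    define F where "F = ft (\<lambda>x. f x / pw x)"
    define G where "G = ft (\<lambda>x. g x / pw x)"
    define \<Phi> where "\<Phi> \<zeta> = F (fst \<zeta>) * G (snd \<zeta>)" for \<zeta>
    define b' where "b' = foldr phase_dp bs b"
    have fm [measurable]: "F \<in> borel_measurable borel" "G \<in> borel_measurable borel"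
      using borel_measurable_integrable[OF integrable_div_pw[OF f]] borel_measurable_integrable[OF integrable_div_pw[OF g]]
      by (auto simp: F_def G_def)
    have \<Phi>m [measurable]: "\<Phi> \<in> borel_measurable borel"
    proof -
      have "(\<lambda>\<zeta>. F (fst \<zeta>) * G (snd \<zeta>)) \<in> borel_measurable (borel \<Otimes>\<^sub>M borel)" by measurable
      then show ?thesis by (simp add: \<Phi>_def[abs_def] borel_prod)
    qed
    have \<Phi>b: "norm (\<Phi> \<zeta>) \<le> (LINT x|lborel. norm (f x / pw x)) * (LINT x|lborel. norm (g x / pw x))" for \<zeta>
      unfolding \<Phi>_def norm_mult F_def G_def using integrable_div_pw[OF f] integrable_div_pw[OF g]
      by (intro mult_mono norm_ft_le integral_nonneg_AE) auto
    have ck': "ckb (2 * n) (\<lambda>z. (D * B) * indicator (qbox 2 \<times> qbox \<rho>) z) b'"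
      using ckb_foldr_phase_dp[of bs "2 * n" B "qbox \<rho>" b "6 * n"] b B lbs
      by (simp add: b'_def D_def n_def del: ckb.simps)
    have DB: "0 \<le> D * B" using B by (simp add: D_def)
    \<comment> \<open>\<open>lop\<close> falls on the symbol times the phase, where it becomes the
      conjugated operator on \<open>b\<close>, and in exchange f and g are divided by
      \<open>pw\<close>.\<close>
    have U: "(LINT \<zeta>|lborel. b (x, \<zeta>) * phase x \<zeta> * (ft f (fst \<zeta>) * ft g (snd \<zeta>))) =
        (LINT \<zeta>|lborel. b' (x, \<zeta>) * phase x \<zeta> * \<Phi> \<zeta>)" for x
    proof -
      define H where "H \<zeta> = b (x, \<zeta>) * phase x \<zeta>" for \<zeta>
      have b4: "ckb (4 * n) (\<lambda>z. B * indicator (qbox 2 \<times> qbox \<rho>) z) b"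
        by (rule ckb_le[OF b]) (simp add: n_def)
      have "ckb (4 * n) (\<lambda>\<zeta>. 1 ^ (4 * n) * (B * indicator (qbox 2 \<times> qbox \<rho>) (x, \<zeta>))) (\<lambda>\<zeta>. b (x, \<zeta>))"
      proof (rule ckb_comp[where A = "\<lambda>\<zeta>. (x, \<zeta>)" and S = 1, OF _ _ _ b4])
        show "\<exists>s w. w \<in> Basis \<and> \<bar>s\<bar> \<le> 1 \<and> (\<forall>\<zeta> t. (x, \<zeta> + t *\<^sub>R v) = (x, \<zeta>) + (t * s) *\<^sub>R w)"
          if "v \<in> Basis" for v :: "'a \<times> 'a"
          using that by (intro exI[of _ 1] exI[of _ "(0, v)"]) (auto simp: Basis_prod_def)
      qed (auto intro!: continuous_intros)
      from ckb_mult[OF this ckb_exp[where y = "(x, x)"]]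
      have "ckb (4 * n) (\<lambda>\<zeta>. 2 ^ (4 * n) * (1 ^ (4 * n) * (B * indicator (qbox 2 \<times> qbox \<rho>) (x, \<zeta>)) * (1 + norm (x, x)) ^ (4 * n))) H"
        unfolding H_def .
      \<comment> \<open>This bound depends on x through the derivatives of the phase. It only
        licenses the transfer of the weight; the quantitative bound is the one for
        \<open>b'\<close>, which is uniform in x.\<close>
      then have "ckb (4 * n) (\<lambda>\<zeta>. (2 ^ (4 * n) * B * (1 + norm (x, x)) ^ (4 * n) * (1 + \<rho>\<^sup>2) ^ DIM('a \<times> 'a)) * wt \<zeta>) H"
      proof (rule ckb_mono)
        fix \<zeta> :: "'a \<times> 'a"
        have "indicator (qbox 2 \<times> qbox \<rho>) (x, \<zeta>) \<le> (1 + \<rho>\<^sup>2) ^ DIM('a \<times> 'a) * wt \<zeta>"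
          using indicator_qbox_le_wt[of \<rho> \<zeta>] by (rule order_trans[rotated]) (auto simp: indicator_def)
        then have "(2 ^ (4 * n) * B * (1 + norm (x, x)) ^ (4 * n)) * indicator (qbox 2 \<times> qbox \<rho>) (x, \<zeta>) \<le>
            (2 ^ (4 * n) * B * (1 + norm (x, x)) ^ (4 * n)) * ((1 + \<rho>\<^sup>2) ^ DIM('a \<times> 'a) * wt \<zeta>)"
          using B by (intro mult_left_mono) auto
        then show "2 ^ (4 * n) * (1 ^ (4 * n) * (B * indicator (qbox 2 \<times> qbox \<rho>) (x, \<zeta>)) * (1 + norm (x, x)) ^ (4 * n)) \<le>
            (2 ^ (4 * n) * B * (1 + norm (x, x)) ^ (4 * n) * (1 + \<rho>\<^sup>2) ^ DIM('a \<times> 'a)) * wt \<zeta>"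
          by (simp add: mult_ac)
      qed
      then have ckH: "ckb (2 * DIM('a \<times> 'a)) (\<lambda>\<zeta>. (2 ^ (4 * n) * B * (1 + norm (x, x)) ^ (4 * n) * (1 + \<rho>\<^sup>2) ^ DIM('a \<times> 'a)) * wt \<zeta>) H"
        by (simp add: n_def del: ckb.simps)
      have "(LINT \<zeta>|lborel. H \<zeta> * (ft f (fst \<zeta>) * ft g (snd \<zeta>))) =
          (LINT \<zeta>|lborel. H \<zeta> * ft (\<lambda>z. f (fst z) * g (snd z)) \<zeta>)"
        by (simp only: ft_tensor[OF f g])
      also have "\<dots> = (LINT \<zeta>|lborel. lop H \<zeta> * ft (\<lambda>z. (f (fst z) * g (snd z)) / pw z) \<zeta>)"
        by (rule ft_weight_transfer[OF ckH integrable_tensor[OF f g]])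
      also have "(\<lambda>z. (f (fst z) * g (snd z)) / pw z) = (\<lambda>z. (f (fst z) / pw (fst z)) * (g (snd z) / pw (snd z)))"
        by (auto simp: fun_eq_iff pw_Pair)
      also have "ft (\<lambda>z. (f (fst z) / pw (fst z)) * (g (snd z) / pw (snd z))) = \<Phi>"
        using ft_tensor[OF integrable_div_pw[OF f] integrable_div_pw[OF g]]
        by (simp add: fun_eq_iff \<Phi>_def F_def G_def)
      also have "lop H = (\<lambda>\<zeta>. b' (x, \<zeta>) * phase x \<zeta>)"
        unfolding lop_def b'_def H_def[abs_def] bs_def[symmetric]
        using b4 lbs B by (intro foldr_dp_phase) (simp_all del: ckb.simps)
      finally show ?thesis by (simp only: H_def)
    qed
    have tens: "(\<integral>\<^sup>+\<zeta>. indicator (qbox \<rho>) \<zeta> * ennreal ((norm (\<Phi> \<zeta>))\<^sup>2) \<partial>lborel) \<le> ennreal (P * Q)"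
    proof -
      have "(\<integral>\<^sup>+\<zeta>. indicator (qbox \<rho>) \<zeta> * ennreal ((norm (\<Phi> \<zeta>))\<^sup>2) \<partial>lborel) =
         (\<integral>\<^sup>+\<zeta>. (indicator (qbox \<rho>) (fst \<zeta>) * ennreal ((norm (F (fst \<zeta>)))\<^sup>2)) *
            (indicator (qbox \<rho>) (snd \<zeta>) * ennreal ((norm (G (snd \<zeta>)))\<^sup>2)) \<partial>lborel)"
      proof (intro nn_integral_cong)
        fix \<zeta> :: "'a \<times> 'a"
        show "indicator (qbox \<rho>) \<zeta> * ennreal ((norm (\<Phi> \<zeta>))\<^sup>2) = (indicator (qbox \<rho>) (fst \<zeta>) * ennreal ((norm (F (fst \<zeta>)))\<^sup>2)) *
            (indicator (qbox \<rho>) (snd \<zeta>) * ennreal ((norm (G (snd \<zeta>)))\<^sup>2))"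
          using mem_qbox_Pair[of "fst \<zeta>" "snd \<zeta>" \<rho>]
          by (auto simp: \<Phi>_def indicator_def norm_mult power_mult_distrib ennreal_mult)
      qed
      also have "\<dots> = (\<integral>\<^sup>+\<xi>. indicator (qbox \<rho>) \<xi> * ennreal ((norm (F \<xi>))\<^sup>2) \<partial>lborel) *
          (\<integral>\<^sup>+\<eta>. indicator (qbox \<rho>) \<eta> * ennreal ((norm (G \<eta>))\<^sup>2) \<partial>lborel)"
        by (rule nn_integral_tensor) measurable
      also have "\<dots> \<le> ennreal P * ennreal Q"
        using P Q unfolding F_def G_def by (intro mult_mono) auto
      finally show ?thesis using PQ0 by (simp add: ennreal_mult)
    qed
    have "(\<integral>\<^sup>+x. ennreal ((norm (LINT \<zeta>|lborel. b' (x, \<zeta>) * phase x \<zeta> * \<Phi> \<zeta>))\<^sup>2) \<partial>lborel) \<le>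
        ennreal (2 * (4 ^ n * (4 ^ n * 4 ^ n)) * (D * B)\<^sup>2 * ((2 * \<rho>) ^ n * w)) *
        (\<integral>\<^sup>+\<zeta>. indicator (qbox \<rho>) \<zeta> * ennreal ((norm (\<Phi> \<zeta>))\<^sup>2) \<partial>lborel)"
      unfolding n_def w_def by (rule phase_L2_bound[OF ck'[unfolded n_def] DB \<rho> \<Phi>m \<Phi>b])
    also have "\<dots> \<le> ennreal (2 * (4 ^ n * (4 ^ n * 4 ^ n)) * (D * B)\<^sup>2 * ((2 * \<rho>) ^ n * w)) * ennreal (P * Q)"
      by (intro mult_left_mono tens) simp
    also have "\<dots> = ennreal (C1 * B\<^sup>2 * \<rho> ^ n * (P * Q))"
      using PQ0 w \<rho> by (subst ennreal_mult[symmetric]) (auto simp: C1_def power_mult_distrib mult_ac)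
    also have "\<dots> \<le> ennreal ((C1 + C2 + 1) * B\<^sup>2 * \<rho> ^ n * (P * Q))"
      using C12 PQ0 \<rho> by (intro ennreal_leI mult_right_mono) auto
    finally show "(\<integral>\<^sup>+x. ennreal ((norm (LINT \<zeta>|lborel. b (x, \<zeta>) * phase x \<zeta> *
        (ft f (fst \<zeta>) * ft g (snd \<zeta>))))\<^sup>2) \<partial>lborel) \<le> ennreal ((C1 + C2 + 1) * B\<^sup>2 * \<rho> ^ DIM('a) * (P * Q))"
      by (simp only: U n_def)
    fix x
    have "ennreal ((norm (LINT \<zeta>|lborel. b' (x, \<zeta>) * phase x \<zeta> * \<Phi> \<zeta>))\<^sup>2) \<le>
        ennreal ((D * B)\<^sup>2 * (2 * \<rho>) ^ (2 * n)) * (\<integral>\<^sup>+\<zeta>. indicator (qbox \<rho>) \<zeta> * ennreal ((norm (\<Phi> \<zeta>))\<^sup>2) \<partial>lborel)"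
      unfolding n_def by (rule phase_sup_bound[OF ckb_bound[OF ck'] DB \<rho> \<Phi>m])
    also have "\<dots> \<le> ennreal ((D * B)\<^sup>2 * (2 * \<rho>) ^ (2 * n)) * ennreal (P * Q)"
      by (intro mult_left_mono tens) simp
    also have "\<dots> = ennreal (C2 * B\<^sup>2 * \<rho> ^ (2 * n) * (P * Q))"
      using PQ0 \<rho> by (subst ennreal_mult[symmetric]) (auto simp: C2_def power_mult_distrib mult_ac)
    also have "\<dots> \<le> ennreal ((C1 + C2 + 1) * B\<^sup>2 * \<rho> ^ (2 * n) * (P * Q))"
      using C12 PQ0 \<rho> by (intro ennreal_leI mult_right_mono) auto
    finally have "(norm (LINT \<zeta>|lborel. b' (x, \<zeta>) * phase x \<zeta> * \<Phi> \<zeta>))\<^sup>2 \<le>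
        (C1 + C2 + 1) * B\<^sup>2 * \<rho> ^ (2 * n) * (P * Q)"
      using C12 PQ0 \<rho> by (subst (asm) ennreal_le_iff) auto
    then show "(norm (LINT \<zeta>|lborel. b (x, \<zeta>) * phase x \<zeta> *
        (ft f (fst \<zeta>) * ft g (snd \<zeta>))))\<^sup>2 \<le> (C1 + C2 + 1) * B\<^sup>2 * \<rho> ^ (2 * DIM('a)) * (P * Q)"
      by (simp only: U n_def)
  qed
qed

subsection \<open>Local norms\<close>

definition lq_le :: "ereal \<Rightarrow> real \<Rightarrow> ('a::euclidean_space \<Rightarrow> complex) \<Rightarrow> bool" where
  "lq_le q N f \<longleftrightarrow> (if q = \<infinity> then AE x in lborel. norm (f x) \<le> N
     else (\<integral>\<^sup>+x. ennreal (norm (f x) powr real_of_ereal q) \<partial>lborel) \<le> ennreal (N powr real_of_ereal q))"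

section \<open>Threshold inequalities and localised masses\<close>

lemma recip_finite: "1 \<le> q \<Longrightarrow> q \<noteq> \<infinity> \<Longrightarrow> recip q = 1 / real_of_ereal q \<and> 1 \<le> real_of_ereal q"
  by (cases q) (auto simp: recip_def)

lemma wt_powr_le: "1 \<le> q \<Longrightarrow> wt x powr q \<le> wt x"
  using powr_mono'[of 1 q "wt x"] wt_le_one[of x] by simp

text \<open>Hoelder's inequality as a pointwise statement: below the threshold \<open>s\<close> the
  square is at most \<open>s^2\<close>, above it the power \<open>q\<close> takes over. After
  integration \<open>s\<close> is chosen to balance the two terms.\<close>

lemma square_le_powr:
  fixes t s q :: real
  assumes "0 \<le> t" "0 < s" "2 \<le> q"
  shows "t\<^sup>2 \<le> s\<^sup>2 + s powr (2 - q) * t powr q"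
proof (cases "t \<le> s")
  case True
  then have "t\<^sup>2 \<le> s\<^sup>2" using assms by (intro power_mono)
  then show ?thesis by (simp add: add_increasing2)
next
  case False
  then have t: "0 < t" using assms by simp
  have "t\<^sup>2 = t powr (2 - q) * t powr q" using t by (simp add: powr_add[symmetric])
  also have "\<dots> \<le> s powr (2 - q) * t powr q"
    using False assms t by (intro mult_right_mono powr_mono2') auto
  finally show ?thesis by (simp add: add_increasing)
qed

text \<open>The counterpart for the output, with the L^r integrand bounded through the square; the
  constant term is integrated only over a cube.\<close>

lemma powr_le_square:
  fixes t s r :: real
  assumes "0 \<le> t" "0 < s" "0 < r" "r \<le> 2"
  shows "t powr r \<le> s powr r + s powr (r - 2) * t\<^sup>2"
proof (cases "t \<le> s")
  case True
  then have "t powr r \<le> s powr r" using assms by (intro powr_mono2) auto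
  then show ?thesis by (simp add: add_increasing2)
next
  case False
  then have t: "0 < t" using assms by simp
  have "t powr r = t powr (r - 2) * t powr 2" using t by (simp only: powr_add[symmetric]) simp
  also have "\<dots> \<le> s powr (r - 2) * t powr 2"
    using False assms t by (intro mult_right_mono powr_mono2') auto
  finally show ?thesis using t by (simp add: add_increasing)
qed

text \<open>The summand \<open>wt y\<close> only serves to make \<open>loc_mass\<close> positive.\<close>

definition loc_mass :: "real \<Rightarrow> real \<Rightarrow> ('a::euclidean_space \<Rightarrow> complex) \<Rightarrow> 'a \<Rightarrow> ennreal" where
  "loc_mass p N f c = (\<integral>\<^sup>+y. ennreal ((norm (f y) / N) powr p + wt y) * ennreal (wt (y - c)) \<partial>lborel)"

text \<open>The normalised power of f has total mass at most 1 and the added weight has mass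
  \<open>w\<close>. A translate of the weight is at most 1, and integrating over all translates
  gives one more factor \<open>w\<close>. The last claim is the form in which f enters a local
  estimate centred at \<open>c\<close>.\<close>

lemma loc_mass:
  fixes f :: "'a::euclidean_space \<Rightarrow> complex"
  assumes [measurable]: "f \<in> borel_measurable borel" and N: "0 < N" and p: "0 < p"
    and f: "(\<integral>\<^sup>+x. ennreal (norm (f x) powr p) \<partial>lborel) \<le> ennreal (N powr p)"
  defines "w \<equiv> (LINT z|lborel. wt (z::'a))"
  shows "loc_mass p N f \<in> borel_measurable borel"
    and "0 < loc_mass p N f c" and "loc_mass p N f c \<le> ennreal (1 + w)"
    and "(\<integral>\<^sup>+c. loc_mass p N f c \<partial>lborel) \<le> ennreal ((1 + w) * w)"
    and "(\<integral>\<^sup>+x. ennreal ((norm (f (c + x)) / N) powr p * wt x) \<partial>lborel) \<le> loc_mass p N f c"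
proof -
  have w: "0 \<le> w" unfolding w_def by (intro integral_nonneg_AE) simp
  have iw: "(\<integral>\<^sup>+x. ennreal (wt (x::'a)) \<partial>lborel) = ennreal w"
    unfolding w_def by (rule nn_integral_eq_integral) (auto simp: integrable_wt)
  have iF: "(\<integral>\<^sup>+x. ennreal ((norm (f x) / N) powr p) \<partial>lborel) \<le> 1"
  proof -
    have "(\<integral>\<^sup>+x. ennreal ((norm (f x) / N) powr p) \<partial>lborel) =
        (\<integral>\<^sup>+x. ennreal (1 / N powr p) * ennreal (norm (f x) powr p) \<partial>lborel)"
      using N by (intro nn_integral_cong) (simp add: powr_divide ennreal_mult[symmetric])
    also have "\<dots> = ennreal (1 / N powr p) * (\<integral>\<^sup>+x. ennreal (norm (f x) powr p) \<partial>lborel)"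
      by (rule nn_integral_cmult) simp
    also have "\<dots> \<le> ennreal (1 / N powr p) * ennreal (N powr p)" by (intro mult_left_mono f) simp
    also have "\<dots> = 1" using N by (simp add: ennreal_mult[symmetric])
    finally show ?thesis .
  qed
  have iS: "(\<integral>\<^sup>+x. ennreal ((norm (f x) / N) powr p + wt x) \<partial>lborel) \<le> ennreal (1 + w)"
  proof -
    have "(\<integral>\<^sup>+x. ennreal ((norm (f x) / N) powr p + wt x) \<partial>lborel) =
        (\<integral>\<^sup>+x. ennreal ((norm (f x) / N) powr p) \<partial>lborel) + ennreal w"
      by (simp add: nn_integral_add iw)
    also have "\<dots> \<le> 1 + ennreal w" by (intro add_mono iF) simp
    finally show ?thesis using w by simp
  qed
  show m: "loc_mass p N f \<in> borel_measurable borel"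
    unfolding loc_mass_def[abs_def] by measurable
  show "0 < loc_mass p N f c"
  proof (rule ccontr)
    assume "\<not> 0 < loc_mass p N f c"
    then have "AE y in lborel. ennreal ((norm (f y) / N) powr p + wt y) * ennreal (wt (y - c)) = 0"
      unfolding loc_mass_def by (simp add: nn_integral_0_iff_AE)
    then have "AE y in (lborel :: 'a measure). False"
    proof eventually_elim
      case (elim y)
      have "0 < (norm (f y) / N) powr p + wt y" by (rule add_nonneg_pos) auto
      then have "0 < ((norm (f y) / N) powr p + wt y) * wt (y - c)" by (intro mult_pos_pos wt_pos)
      moreover have "ennreal (((norm (f y) / N) powr p + wt y) * wt (y - c)) = 0"
        using elim by (subst ennreal_mult) auto
      ultimately show False by (simp only: ennreal_eq_0_iff not_le[symmetric])
    qed
    then have "ae_filter (lborel :: 'a measure) = bot" by (simp only: trivial_limit_def)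
    then show False by (simp add: ae_filter_eq_bot_iff)
  qed
  have "loc_mass p N f c \<le> (\<integral>\<^sup>+y. ennreal ((norm (f y) / N) powr p + wt y) * 1 \<partial>lborel)"
    unfolding loc_mass_def by (intro nn_integral_mono mult_left_mono) (auto simp: wt_le_one)
  then show "loc_mass p N f c \<le> ennreal (1 + w)" using iS by simp
  have "(\<integral>\<^sup>+c. loc_mass p N f c \<partial>lborel) =
      (\<integral>\<^sup>+y. (\<integral>\<^sup>+c. ennreal ((norm (f y) / N) powr p + wt y) * ennreal (wt (y - c)) \<partial>lborel) \<partial>lborel)"
    unfolding loc_mass_def by (rule lborel_pair.Fubini') measurable
  also have "\<dots> = (\<integral>\<^sup>+y. ennreal ((norm (f y) / N) powr p + wt y) * ennreal w \<partial>lborel)"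
    using nn_integral_wt_scale[of 1, where ?'a = 'a] by (simp add: nn_integral_cmult w_def)
  also have "\<dots> = (\<integral>\<^sup>+y. ennreal ((norm (f y) / N) powr p + wt y) \<partial>lborel) * ennreal w"
    by (rule nn_integral_multc) measurable
  also have "\<dots> \<le> ennreal (1 + w) * ennreal w" by (intro mult_right_mono iS) simp
  finally show "(\<integral>\<^sup>+c. loc_mass p N f c \<partial>lborel) \<le> ennreal ((1 + w) * w)"
    using w by (simp add: ennreal_mult)
  have "(\<integral>\<^sup>+x. ennreal ((norm (f (c + x)) / N) powr p * wt x) \<partial>lborel) =
      (\<integral>\<^sup>+x. ennreal ((norm (f (c + x)) / N) powr p * wt ((c + x) - c)) \<partial>lborel)" by simp
  also have "\<dots> = (\<integral>\<^sup>+y. ennreal ((norm (f y) / N) powr p * wt (y - c)) \<partial>lborel)"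
    by (rule nn_integral_lborel_translate) measurable
  also have "\<dots> \<le> loc_mass p N f c"
    unfolding loc_mass_def
  proof (intro nn_integral_mono)
    fix y
    show "ennreal ((norm (f y) / N) powr p * wt (y - c)) \<le> ennreal ((norm (f y) / N) powr p + wt y) * ennreal (wt (y - c))"
      by (subst ennreal_mult[symmetric]) (auto intro!: ennreal_leI mult_right_mono)
  qed
  finally show "(\<integral>\<^sup>+x. ennreal ((norm (f (c + x)) / N) powr p * wt x) \<partial>lborel) \<le> loc_mass p N f c" .
qed

text \<open>For q at most 2 the inequality \<open>local_bessel\<close> is used at q itself, for
  larger q at exponent 2 after a threshold argument; the power of \<open>\<rho>\<close> records both
  cases through \<open>max (recip q) (1/2)\<close>. The function \<open>A\<close> keeps the
  dependence on the centre, because its powers are later integrated over all centres.\<close>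

lemma local_norm:
  "\<exists>C>0. \<exists>W>0. \<forall>q N (f :: 'a::euclidean_space \<Rightarrow> complex). 1 \<le> q \<longrightarrow> 0 < N \<longrightarrow> integrable lborel f \<longrightarrow> lq_le q N f \<longrightarrow>
     (\<exists>A. A \<in> borel_measurable borel \<and> (\<forall>c. 0 < A c) \<and> (q \<noteq> \<infinity> \<longrightarrow> (\<integral>\<^sup>+c. ennreal (A c) \<partial>lborel) \<le> ennreal W) \<and>
       (\<forall>\<rho>>0. \<forall>c. (\<integral>\<^sup>+\<xi>. indicator (qbox \<rho>) \<xi> * ennreal ((norm (ft (\<lambda>x. f (c + x) / pw x) \<xi>))\<^sup>2) \<partial>lborel) \<le>
          ennreal (C * \<rho> powr (real DIM('a) * (2 * max (recip q) (1/2) - 1)) * (N\<^sup>2 * A c powr (2 * recip q)))))"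
proof -
  obtain C where C: "0 < C" and bessel: "\<And>q R A (h :: 'a \<Rightarrow> complex). 1 \<le> q \<Longrightarrow> q \<le> 2 \<Longrightarrow> 0 < R \<Longrightarrow> 0 < A \<Longrightarrow> integrable lborel h \<Longrightarrow>
     (\<integral>\<^sup>+x. ennreal (norm (h x) powr q) \<partial>lborel) \<le> ennreal A \<Longrightarrow>
     (\<integral>\<^sup>+x. indicator (qbox R) x * ennreal ((norm (ft h x))\<^sup>2) \<partial>lborel) \<le>
       ennreal (C * R powr (real DIM('a) * (2 / q - 1)) * A powr (2 / q))"
    using local_bessel[where ?'a = 'a] by blast
  define w where "w = (LINT z|lborel. wt (z::'a))"
  have w: "0 \<le> w" unfolding w_def by (intro integral_nonneg_AE) simp
  have iw: "(\<integral>\<^sup>+x. ennreal (wt (x::'a)) \<partial>lborel) = ennreal w"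
    unfolding w_def by (rule nn_integral_eq_integral) (auto simp: integrable_wt)
  \<comment> \<open>The factor \<open>1 + w\<close> pays for the weight integral that appears when q
    exceeds 2 or is infinite.\<close>
  define C' where "C' = C * (1 + w)"
  have C': "0 < C'" "C \<le> C'" using C w by (auto simp: C'_def)
  define W where "W = (1 + w) * w + 1"
  have W: "0 < W" using w by (simp add: W_def add_nonneg_pos)
  show ?thesis
  proof (rule exI[of _ C'], rule conjI[OF C'(1)], rule exI[of _ W], intro conjI allI impI W)
    fix q :: ereal and N :: real and f :: "'a \<Rightarrow> complex"
    assume q: "1 \<le> q" and N: "0 < N" and f: "integrable lborel f" and fN: "lq_le q N f"
    have fm [measurable]: "f \<in> borel_measurable borel" using f by (auto dest: borel_measurable_integrable)
    have ih: "integrable lborel (\<lambda>x. f (c + x) / pw x)" for c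
      using f by (intro integrable_div_pw) (simp add: lborel_integrable_translate)
    show "\<exists>A. A \<in> borel_measurable borel \<and> (\<forall>c. 0 < A c) \<and> (q \<noteq> \<infinity> \<longrightarrow> (\<integral>\<^sup>+c. ennreal (A c) \<partial>lborel) \<le> ennreal W) \<and>
       (\<forall>\<rho>>0. \<forall>c. (\<integral>\<^sup>+\<xi>. indicator (qbox \<rho>) \<xi> * ennreal ((norm (ft (\<lambda>x. f (c + x) / pw x) \<xi>))\<^sup>2) \<partial>lborel) \<le>
          ennreal (C' * \<rho> powr (real DIM('a) * (2 * max (recip q) (1/2) - 1)) * (N\<^sup>2 * A c powr (2 * recip q))))"
    proof (cases "q = \<infinity>")
      case True
      have "(\<integral>\<^sup>+\<xi>. indicator (qbox \<rho>) \<xi> * ennreal ((norm (ft (\<lambda>x. f (c + x) / pw x) \<xi>))\<^sup>2) \<partial>lborel) \<le> ennreal (C' * N\<^sup>2)"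
        if \<rho>: "0 < \<rho>" for \<rho> c
      proof -
        have "AE x in lborel. norm (f x) \<le> N" using fN True by (simp add: lq_le_def)
        then have "AE x in distr lborel borel ((+) c). norm (f x) \<le> N"
          by (subst lborel_distr_plus)
        then have AE: "AE x in lborel. norm (f (c + x)) \<le> N" by (subst (asm) AE_distr_iff) auto
        have "(\<integral>\<^sup>+x. ennreal (norm (f (c + x) / pw x) powr 2) \<partial>lborel) \<le> (\<integral>\<^sup>+x. ennreal (N\<^sup>2) * ennreal (wt (x::'a)) \<partial>lborel)"
        proof (rule nn_integral_mono_AE)
          show "AE x in lborel. ennreal (norm (f (c + x) / pw x) powr 2) \<le> ennreal (N\<^sup>2) * ennreal (wt x)"
            using AE
          proof eventually_elim
            case (elim x)
            have "norm (f (c + x) / pw x) powr 2 = (norm (f (c + x)))\<^sup>2 * (wt x)\<^sup>2"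
              by (simp add: norm_divide norm_pw power_mult_distrib)
            also have "\<dots> \<le> N\<^sup>2 * wt x"
              using elim wt_mult_self_le[of x] by (intro mult_mono power_mono) (auto simp: power2_eq_square)
            finally have "ennreal (norm (f (c + x) / pw x) powr 2) \<le> ennreal (N\<^sup>2 * wt x)"
              by (rule ennreal_leI)
            then show ?case by (subst ennreal_mult[symmetric]) auto
          qed
        qed
        also have "\<dots> = ennreal (N\<^sup>2 * w)" using w by (simp add: nn_integral_cmult iw ennreal_mult)
        also have "\<dots> \<le> ennreal (N\<^sup>2 * (1 + w))" by (intro ennreal_leI mult_left_mono) auto
        finally have "(\<integral>\<^sup>+x. indicator (qbox \<rho>) x * ennreal ((norm (ft (\<lambda>x. f (c + x) / pw x) x))\<^sup>2) \<partial>lborel) \<le>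
           ennreal (C * \<rho> powr (real DIM('a) * (2 / 2 - 1)) * (N\<^sup>2 * (1 + w)) powr (2 / 2))"
          using N w \<rho> ih by (intro bessel) (auto simp: add_pos_nonneg)
        then show ?thesis using N w \<rho> by (simp add: C'_def mult_ac)
      qed
      \<comment> \<open>For infinite q the exponent \<open>2 * recip q\<close> is 0, so a constant
        mass serves as witness and no bound on its integral is asked for.\<close>
      then show ?thesis
        using True by (intro exI[of _ "\<lambda>c. 1"]) (auto simp: recip_def)
    next
      case False
      define p where "p = real_of_ereal q"
      have p: "1 \<le> p" "recip q = 1 / p" using recip_finite[OF q False] by (auto simp: p_def)
      have fp: "(\<integral>\<^sup>+x. ennreal (norm (f x) powr p) \<partial>lborel) \<le> ennreal (N powr p)"
        using fN False by (simp add: lq_le_def p_def)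
      have p0: "0 < p" using p by simp
      note lm = loc_mass[OF fm N p0 fp, folded w_def]
      define A where "A c = enn2real (loc_mass p N f c)" for c
      have fin: "loc_mass p N f c < top" for c
        using lm(3)[of c] ennreal_less_top by (rule le_less_trans)
      have eA: "ennreal (A c) = loc_mass p N f c" for c
        using fin unfolding A_def by (rule ennreal_enn2real)
      have A0: "0 < A c" for c
        using lm(2) fin by (simp add: A_def enn2real_positive_iff)
      have Am [measurable]: "A \<in> borel_measurable borel"
        unfolding A_def[abs_def] using lm(1) by measurable
      have iA: "(\<integral>\<^sup>+c. ennreal (A c) \<partial>lborel) \<le> ennreal W"
        unfolding eA W_def by (rule order_trans[OF lm(4)]) (simp add: ennreal_leI)
      have Fb: "(\<integral>\<^sup>+x. ennreal ((norm (f (c + x)) / N) powr p * wt x) \<partial>lborel) \<le> ennreal (A c)" for c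
        unfolding eA by (rule lm(5))
      have main: "(\<integral>\<^sup>+\<xi>. indicator (qbox \<rho>) \<xi> * ennreal ((norm (ft (\<lambda>x. f (c + x) / pw x) \<xi>))\<^sup>2) \<partial>lborel) \<le>
          ennreal (C' * \<rho> powr (real DIM('a) * (2 * max (1 / p) (1/2) - 1)) * (N\<^sup>2 * A c powr (2 * (1 / p))))"
        if \<rho>: "0 < \<rho>" for \<rho> c
      proof (cases "p \<le> 2")
        case True
        have "(\<integral>\<^sup>+x. ennreal (norm (f (c + x) / pw x) powr p) \<partial>lborel) \<le>
            (\<integral>\<^sup>+x. ennreal (N powr p) * ennreal ((norm (f (c + x)) / N) powr p * wt x) \<partial>lborel)"
        proof (intro nn_integral_mono)
          fix x
          have "norm (f (c + x) / pw x) powr p = norm (f (c + x)) powr p * wt x powr p"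
            by (simp add: norm_divide norm_pw powr_mult)
          also have "\<dots> \<le> norm (f (c + x)) powr p * wt x"
            using p by (intro mult_left_mono wt_powr_le) auto
          also have "\<dots> = N powr p * ((norm (f (c + x)) / N) powr p * wt x)"
            using N by (simp add: powr_divide)
          finally show "ennreal (norm (f (c + x) / pw x) powr p) \<le> ennreal (N powr p) * ennreal ((norm (f (c + x)) / N) powr p * wt x)"
            by (simp add: ennreal_mult[symmetric] ennreal_leI)
        qed
        also have "\<dots> = ennreal (N powr p) * (\<integral>\<^sup>+x. ennreal ((norm (f (c + x)) / N) powr p * wt x) \<partial>lborel)"
          by (rule nn_integral_cmult) measurable
        also have "\<dots> \<le> ennreal (N powr p) * ennreal (A c)" by (intro mult_left_mono Fb) simp
        also have "\<dots> = ennreal (N powr p * A c)" using A0[of c] by (simp add: ennreal_mult)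
        finally have "(\<integral>\<^sup>+x. indicator (qbox \<rho>) x * ennreal ((norm (ft (\<lambda>x. f (c + x) / pw x) x))\<^sup>2) \<partial>lborel) \<le>
           ennreal (C * \<rho> powr (real DIM('a) * (2 / p - 1)) * (N powr p * A c) powr (2 / p))"
          using N A0[of c] \<rho> ih p True by (intro bessel) auto
        also have "(N powr p * A c) powr (2 / p) = N\<^sup>2 * A c powr (2 * (1 / p))"
          using N A0[of c] p by (simp add: powr_mult powr_powr)
        also have "2 / p - 1 = 2 * max (1 / p) (1/2) - 1" using True p by (simp add: max_def field_simps)
        also have "ennreal (C * \<rho> powr (real DIM('a) * (2 * max (1 / p) (1/2) - 1)) * (N\<^sup>2 * A c powr (2 * (1 / p)))) \<le>
            ennreal (C' * \<rho> powr (real DIM('a) * (2 * max (1 / p) (1/2) - 1)) * (N\<^sup>2 * A c powr (2 * (1 / p))))"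
          using C' by (intro ennreal_leI mult_right_mono) auto
        finally show ?thesis .
      next
        case False
        \<comment> \<open>The threshold is the local L^p size of the normalised f. With
          \<open>s powr p = A c\<close> both terms of \<open>square_le_powr\<close> become multiples
          of \<open>s^2\<close>.\<close>
        define s where "s = A c powr (1 / p)"
        have s: "0 < s" "s powr p = A c" "s\<^sup>2 = A c powr (2 * (1 / p))"
          using A0[of c] p by (auto simp: s_def powr_powr powr_power)
        have sA: "s powr (2 - p) * A c = s\<^sup>2"
          using s(1) by (simp add: s(2)[symmetric] powr_add[symmetric])
        have "(\<integral>\<^sup>+x. ennreal (norm (f (c + x) / pw x) powr 2) \<partial>lborel) \<le>
            (\<integral>\<^sup>+x. ennreal (N\<^sup>2 * s\<^sup>2) * ennreal (wt x) + ennreal (N\<^sup>2 * s powr (2 - p)) * ennreal ((norm (f (c + x)) / N) powr p * wt x) \<partial>lborel)"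
        proof (intro nn_integral_mono)
          fix x
          define F where "F = norm (f (c + x)) / N"
          have F: "0 \<le> F" using N by (simp add: F_def)
          have "norm (f (c + x) / pw x) powr 2 = N\<^sup>2 * (F\<^sup>2 * (wt x)\<^sup>2)"
            using N by (simp add: norm_divide norm_pw power_mult_distrib F_def power_divide)
          also have "\<dots> \<le> N\<^sup>2 * ((s\<^sup>2 + s powr (2 - p) * F powr p) * wt x)"
            using F s(1) False wt_mult_self_le[of x]
            by (intro mult_left_mono mult_mono square_le_powr) (auto simp: power2_eq_square)
          also have "\<dots> = N\<^sup>2 * s\<^sup>2 * wt x + N\<^sup>2 * s powr (2 - p) * (F powr p * wt x)"
            by (simp add: algebra_simps)
          finally show "ennreal (norm (f (c + x) / pw x) powr 2) \<le>
              ennreal (N\<^sup>2 * s\<^sup>2) * ennreal (wt x) + ennreal (N\<^sup>2 * s powr (2 - p)) * ennreal ((norm (f (c + x)) / N) powr p * wt x)"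
            unfolding F_def[symmetric]
            by (simp add: ennreal_plus[symmetric] ennreal_mult[symmetric] ennreal_leI del: ennreal_plus)
        qed
        also have "\<dots> = ennreal (N\<^sup>2 * s\<^sup>2) * ennreal w + ennreal (N\<^sup>2 * s powr (2 - p)) * (\<integral>\<^sup>+x. ennreal ((norm (f (c + x)) / N) powr p * wt x) \<partial>lborel)"
          by (simp add: nn_integral_add nn_integral_cmult iw del: ennreal_mult')
        also have "\<dots> \<le> ennreal (N\<^sup>2 * s\<^sup>2) * ennreal w + ennreal (N\<^sup>2 * s powr (2 - p)) * ennreal (A c)"
          by (intro add_left_mono mult_left_mono Fb) simp
        also have "\<dots> = ennreal (N\<^sup>2 * s\<^sup>2 * w + N\<^sup>2 * (s powr (2 - p) * A c))"
          using A0[of c] w by (simp add: ennreal_mult[symmetric] ennreal_plus[symmetric] mult.assoc del: ennreal_plus)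
        also have "N\<^sup>2 * s\<^sup>2 * w + N\<^sup>2 * (s powr (2 - p) * A c) = N\<^sup>2 * s\<^sup>2 * (1 + w)"
          unfolding sA by (simp add: algebra_simps)
        finally have "(\<integral>\<^sup>+x. indicator (qbox \<rho>) x * ennreal ((norm (ft (\<lambda>x. f (c + x) / pw x) x))\<^sup>2) \<partial>lborel) \<le>
           ennreal (C * \<rho> powr (real DIM('a) * (2 / 2 - 1)) * (N\<^sup>2 * s\<^sup>2 * (1 + w)) powr (2 / 2))"
          using N s(1) w \<rho> ih by (intro bessel) (auto intro!: mult_pos_pos simp: add_pos_nonneg)
        moreover have "2 * max (1 / p) (1/2) - 1 = 0" using False by (simp add: max_def field_simps)
        ultimately show ?thesis
          using N s(1) w \<rho> unfolding s(3)[symmetric] by (simp add: C'_def mult_ac)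
      qed
      show ?thesis
        using Am A0 iA main unfolding p(2) by (intro exI[of _ A]) blast
    qed
  qed
qed

subsection \<open>The single-scale estimate\<close>

lemma ft_translate:
  fixes f :: "'a::euclidean_space \<Rightarrow> complex"
  assumes [measurable]: "f \<in> borel_measurable borel"
  shows "ft f \<xi> = exp (- \<i> * complex_of_real (c \<bullet> \<xi>)) * ft (\<lambda>y. f (c + y)) \<xi>"
proof -
  have "ft f \<xi> = (LINT y|lborel. exp (- \<i> * complex_of_real ((c + y) \<bullet> \<xi>)) * f (c + y))"
    unfolding ft_def by (rule lborel_integral_translate[symmetric]) measurable
  also have "\<dots> = (LINT y|lborel. exp (- \<i> * complex_of_real (c \<bullet> \<xi>)) * (exp (- \<i> * complex_of_real (y \<bullet> \<xi>)) * f (c + y)))"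
    by (intro Bochner_Integration.integral_cong refl)
       (simp add: inner_add_left algebra_simps exp_diff exp_minus divide_inverse)
  finally show ?thesis by (simp add: ft_def)
qed

text \<open>Translating f and g modulates their transforms by exponentials that cancel the change of
  phase, so only the symbol is shifted. The cutoff \<open>\<psi>\<close> depends on x alone and
  passes into the symbol.\<close>

lemma bilop_translate:
  fixes f g :: "'a::euclidean_space \<Rightarrow> complex"
  assumes [measurable]: "f \<in> borel_measurable borel" "g \<in> borel_measurable borel"
  shows "\<psi> x * bilop b f g (c + x) = bilop (\<lambda>z. \<psi> (fst z) * b (c + fst z, snd z)) (\<lambda>y. f (c + y)) (\<lambda>y. g (c + y)) x"
proof -
  have "bilop b f g (c + x) = (LINT \<zeta>|lborel. b (c + x, \<zeta>) * phase x \<zeta> *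
      (ft (\<lambda>y. f (c + y)) (fst \<zeta>) * ft (\<lambda>y. g (c + y)) (snd \<zeta>)))"
    unfolding bilop_def
  proof (intro Bochner_Integration.integral_cong refl)
    fix \<zeta> :: "'a \<times> 'a"
    have "exp (\<i> * complex_of_real (\<zeta> \<bullet> (c + x, c + x))) * (exp (- \<i> * complex_of_real (c \<bullet> fst \<zeta>)) * exp (- \<i> * complex_of_real (c \<bullet> snd \<zeta>))) =
        phase x \<zeta>"
      unfolding exp_add[symmetric]
      by (simp add: inner_prod_def inner_add_right inner_commute algebra_simps)
    note e = this
    have s: "b1 * E1 * ((e1 * F1) * (e2 * G1)) = b1 * (E1 * (e1 * e2)) * (F1 * G1)" for b1 E1 e1 F1 e2 G1 :: complex
      by simp
    show "b (c + x, \<zeta>) * exp (\<i> * complex_of_real (\<zeta> \<bullet> (c + x, c + x))) * (ft f (fst \<zeta>) * ft g (snd \<zeta>)) =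
        b (c + x, \<zeta>) * phase x \<zeta> * (ft (\<lambda>y. f (c + y)) (fst \<zeta>) * ft (\<lambda>y. g (c + y)) (snd \<zeta>))"
      unfolding ft_translate[OF assms(1), of "fst \<zeta>" c] ft_translate[OF assms(2), of "snd \<zeta>" c] s e ..
  qed
  then show ?thesis by (simp add: bilop_def mult.assoc)
qed

lemma bilop_measurable:
  assumes [measurable]: "b \<in> borel_measurable borel" "f \<in> borel_measurable borel" "g \<in> borel_measurable borel"
  shows "bilop b f g \<in> borel_measurable borel"
  unfolding bilop_def[abs_def]
proof (rule lborel.borel_measurable_lebesgue_integral)
  have [measurable]: "(\<lambda>\<zeta>. ft f (fst \<zeta>) * ft g (snd \<zeta>)) \<in> borel_measurable borel"
  proof -
    have "(\<lambda>\<zeta>. ft f (fst \<zeta>) * ft g (snd \<zeta>)) \<in> borel_measurable (borel \<Otimes>\<^sub>M borel)" by measurable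
    then show ?thesis by (simp add: borel_prod)
  qed
  show "(\<lambda>(x, \<zeta>). b (x, \<zeta>) * phase x \<zeta> * (ft f (fst \<zeta>) * ft g (snd \<zeta>)))
      \<in> borel_measurable (borel \<Otimes>\<^sub>M lborel)"
    by measurable
qed

text \<open>For r at most 2 the L^2 bound suffices on a set of finite measure, with threshold
  \<open>s\<close>; for larger r the surplus power r - 2 is taken from the supremum bound, which is
  worse by the factor \<open>\<rho> powr (n/2)\<close>. In the constant, \<open>2 ^ DIM('a)\<close>
  is the volume of the cube.\<close>

lemma local_power_bound:
  fixes U :: "'a::euclidean_space \<Rightarrow> complex"
  assumes [measurable]: "U \<in> borel_measurable borel" and s: "0 < s" and \<rho>: "1 \<le> \<rho>" and r: "0 < r"
    and L2: "(\<integral>\<^sup>+x. ennreal ((norm (U x))\<^sup>2) \<partial>lborel) \<le> ennreal (s\<^sup>2)"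
    and sup: "\<And>x. (norm (U x))\<^sup>2 \<le> s\<^sup>2 * \<rho> ^ DIM('a)"
  shows "(\<integral>\<^sup>+x. indicator (qbox 1) x * ennreal (norm (U x) powr r) \<partial>lborel) \<le>
    ennreal ((2 ^ DIM('a) + 1) * (s * \<rho> powr (real DIM('a) * max 0 (1/2 - 1/r))) powr r)"
proof (cases "r \<le> 2")
  case True
  have "(\<integral>\<^sup>+x. indicator (qbox 1) x * ennreal (norm (U x) powr r) \<partial>lborel) \<le>
      (\<integral>\<^sup>+x. ennreal (s powr r) * indicator (qbox 1) x + ennreal (s powr (r - 2)) * ennreal ((norm (U x))\<^sup>2) \<partial>lborel)"
  proof (intro nn_integral_mono)
    fix x
    show "indicator (qbox 1) x * ennreal (norm (U x) powr r) \<le>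
        ennreal (s powr r) * indicator (qbox 1) x + ennreal (s powr (r - 2)) * ennreal ((norm (U x))\<^sup>2)"
      using powr_le_square[of "norm (U x)" s r] s r True
      by (cases "x \<in> qbox 1") (simp_all add: ennreal_mult[symmetric] ennreal_plus[symmetric] ennreal_leI del: ennreal_plus)
  qed
  also have "\<dots> = ennreal (s powr r) * emeasure lborel (qbox 1 :: 'a set) + ennreal (s powr (r - 2)) * (\<integral>\<^sup>+x. ennreal ((norm (U x))\<^sup>2) \<partial>lborel)"
    by (simp add: nn_integral_add nn_integral_cmult)
  also have "\<dots> \<le> ennreal (s powr r) * ennreal (2 ^ DIM('a)) + ennreal (s powr (r - 2)) * ennreal (s\<^sup>2)"
    by (intro add_mono mult_left_mono L2) (auto simp: emeasure_qbox)
  also have "\<dots> = ennreal (s powr r * 2 ^ DIM('a) + s powr (r - 2) * s\<^sup>2)"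
    by (simp add: ennreal_mult[symmetric] ennreal_plus[symmetric] del: ennreal_plus)
  also have "s powr (r - 2) * s\<^sup>2 = s powr r"
    using s powr_add[of s "r - 2" 2] by simp
  also have "s powr r * 2 ^ DIM('a) + s powr r = (2 ^ DIM('a) + 1) * s powr r"
    by (simp add: algebra_simps)
  also have "max 0 (1/2 - 1/r) = 0" if "r \<le> 2" using that r by (simp add: max_def field_simps)
  then have "s powr r = (s * \<rho> powr (real DIM('a) * max 0 (1/2 - 1/r))) powr r" using True \<rho> by simp
  finally show ?thesis .
next
  case False
  define S where "S = s * \<rho> powr (real DIM('a) / 2)"
  have S: "0 < S" using s \<rho> by (simp add: S_def)
  have US: "norm (U x) \<le> S" for x
  proof (rule power2_le_imp_le)
    have "S\<^sup>2 = s\<^sup>2 * \<rho> ^ DIM('a)"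
      using \<rho> by (simp add: S_def power_mult_distrib powr_power powr_realpow)
    then show "(norm (U x))\<^sup>2 \<le> S\<^sup>2" using sup by simp
  qed (use S in simp)
  have "(\<integral>\<^sup>+x. indicator (qbox 1) x * ennreal (norm (U x) powr r) \<partial>lborel) \<le>
      (\<integral>\<^sup>+x. ennreal (S powr (r - 2)) * ennreal ((norm (U x))\<^sup>2) \<partial>lborel)"
  proof (intro nn_integral_mono)
    fix x
    have "norm (U x) powr r \<le> S powr (r - 2) * (norm (U x))\<^sup>2"
    proof (cases "U x = 0")
      case nz: False
      have "norm (U x) powr r = norm (U x) powr (r - 2) * norm (U x) powr 2"
        by (simp only: powr_add[symmetric]) simp
      also have "\<dots> \<le> S powr (r - 2) * norm (U x) powr 2"
        using False US by (intro mult_right_mono powr_mono2) auto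
      finally show ?thesis using nz by simp
    qed (use r in simp)
    then show "indicator (qbox 1) x * ennreal (norm (U x) powr r) \<le> ennreal (S powr (r - 2)) * ennreal ((norm (U x))\<^sup>2)"
      by (cases "x \<in> qbox 1") (simp_all add: ennreal_mult[symmetric] ennreal_leI)
  qed
  also have "\<dots> = ennreal (S powr (r - 2)) * (\<integral>\<^sup>+x. ennreal ((norm (U x))\<^sup>2) \<partial>lborel)"
    by (rule nn_integral_cmult) measurable
  also have "\<dots> \<le> ennreal (S powr (r - 2)) * ennreal (s\<^sup>2)"
    by (intro mult_left_mono L2) simp
  also have "\<dots> = ennreal (S powr (r - 2) * s\<^sup>2)" by (simp add: ennreal_mult)
  also have "S powr (r - 2) * s\<^sup>2 = (s * \<rho> powr (real DIM('a) * max 0 (1/2 - 1/r))) powr r"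
  proof -
    have m: "max 0 (1/2 - 1/r) = 1/2 - 1/r" using False by (simp add: max_def field_simps)
    have e: "real DIM('a) * (1/2 - 1/r) * r = real DIM('a) / 2 * (r - 2)"
      using r by (simp add: field_simps)
    have "s powr (r - 2) * s\<^sup>2 = s powr r" using s powr_add[of s "r - 2" 2] by simp
    moreover have "S powr (r - 2) = s powr (r - 2) * \<rho> powr (real DIM('a) / 2 * (r - 2))"
      using s \<rho> by (simp only: S_def powr_mult powr_powr)
    moreover have "(s * \<rho> powr (real DIM('a) * (1/2 - 1/r))) powr r = s powr r * \<rho> powr (real DIM('a) * (1/2 - 1/r) * r)"
      using s \<rho> by (simp only: powr_mult powr_powr)
    ultimately show ?thesis unfolding m e by (simp add: mult_ac)
  qed
  also have "ennreal ((s * \<rho> powr (real DIM('a) * max 0 (1/2 - 1/r))) powr r) \<le>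
     ennreal ((2 ^ DIM('a) + 1) * (s * \<rho> powr (real DIM('a) * max 0 (1/2 - 1/r))) powr r)"
    by (intro ennreal_leI) (simp add: algebra_simps)
  finally show ?thesis .
qed

text \<open>The exponent of R in units of the dimension: each input contributes
  \<open>max (recip q) (1/2) - 1/2\<close>, the L^2 estimate 1/2, and the passage to r > 2 the last
  term.\<close>

definition scale_exp :: "ereal \<Rightarrow> ereal \<Rightarrow> real \<Rightarrow> real" where
  "scale_exp q1 q2 r = max (recip q1) (1/2) + max (recip q2) (1/2) - 1/2 + max 0 (1/2 - 1/r)"

text \<open>With u, v the reciprocals: if both are at most 1/2, the exponent equals the maximum of
  1/2 and 1 - 1/r. If only u exceeds 1/2, it equals u. If both exceed 1/2, it is u + v - 1/2, and
  this is where the extra summand is used: the larger of u and v is at least (u + v)/2.\<close>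

lemma scale_exp_le:
  assumes "1 \<le> q1" "1 \<le> q2" "0 < r" "1 / r = recip q1 + recip q2"
  shows "scale_exp q1 q2 r \<le> max (max (1/2) (recip q1)) (max (recip q2) (1 - 1/r)) + 1/2 * max (1/r - 1) 0"
    and "0 \<le> recip q1" "0 \<le> recip q2"
proof -
  have 0: "0 \<le> recip q" if "1 \<le> q" for q
    using recip_finite[OF that] by (cases "q = \<infinity>") (auto simp: recip_def)
  show "0 \<le> recip q1" "0 \<le> recip q2" using 0 assms by auto
  then show "scale_exp q1 q2 r \<le> max (max (1/2) (recip q1)) (max (recip q2) (1 - 1/r)) + 1/2 * max (1/r - 1) 0"
    unfolding scale_exp_def assms(4) by (auto simp: max_def)
qed

text \<open>The r-th power is averaged over all unit cubes. The local bound on the cube at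
  \<open>c\<close> contains a product of powers of the two local masses, and Young's inequality
  makes it summable over \<open>c\<close>, also when r < 1.\<close>

lemma single_scale:
  assumes q: "1 \<le> q1" "1 \<le> q2" and r: "0 < r" "1 / r = recip q1 + recip q2"
  shows "\<exists>C>0. \<forall>B R N1 N2 (b :: 'a::euclidean_space \<times> 'a \<times> 'a \<Rightarrow> complex) f g.
     ckb (6 * DIM('a)) (\<lambda>z. B * indicator (UNIV \<times> qbox (2 * R)) z) b \<longrightarrow> 0 < B \<longrightarrow> 1 \<le> R \<longrightarrow> 0 < N1 \<longrightarrow> 0 < N2 \<longrightarrow>
     integrable lborel f \<longrightarrow> integrable lborel g \<longrightarrow> lq_le q1 N1 f \<longrightarrow> lq_le q2 N2 g \<longrightarrow>
     (\<integral>\<^sup>+x. ennreal (norm (bilop b f g x) powr r) \<partial>lborel) \<le>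
       ennreal (C * (B * R powr (real DIM('a) * scale_exp q1 q2 r) * N1 * N2) powr r)"
proof -
  define n where "n = DIM('a)"
  define u v where "u = recip q1" and "v = recip q2"
  note uv0 = scale_exp_le(2,3)[OF q r, folded u_def v_def]
  \<comment> \<open>The exponents of the two local masses add up to 1: here the relation between r,
    q1 and q2 enters the integration over the cubes.\<close>
  have ruv: "u * r + v * r = 1" using r by (simp add: u_def v_def field_simps)
  obtain \<phi> :: "'a \<Rightarrow> real" and C0 where \<phi>: "0 \<le> C0"
      "ckb (6 * n) (\<lambda>z. C0 * indicator (qbox 2) z) (\<lambda>z. complex_of_real (\<phi> z))"
      "\<And>z. z \<in> qbox 1 \<Longrightarrow> \<phi> z = 1"
    using box_cutoff[of "6 * n"] by blast
  obtain C1 where C1: "0 < C1" and loc: "\<And>B \<rho> P Q (b :: 'a \<times> 'a \<times> 'a \<Rightarrow> complex) f g.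
     ckb (6 * DIM('a)) (\<lambda>z. B * indicator (qbox 2 \<times> qbox \<rho>) z) b \<Longrightarrow> 0 \<le> B \<Longrightarrow> 0 \<le> \<rho> \<Longrightarrow>
     integrable lborel f \<Longrightarrow> integrable lborel g \<Longrightarrow> 0 \<le> P \<Longrightarrow> 0 \<le> Q \<Longrightarrow>
     (\<integral>\<^sup>+\<xi>. indicator (qbox \<rho>) \<xi> * ennreal ((norm (ft (\<lambda>x. f x / pw x) \<xi>))\<^sup>2) \<partial>lborel) \<le> ennreal P \<Longrightarrow>
     (\<integral>\<^sup>+\<eta>. indicator (qbox \<rho>) \<eta> * ennreal ((norm (ft (\<lambda>x. g x / pw x) \<eta>))\<^sup>2) \<partial>lborel) \<le> ennreal Q \<Longrightarrow>
     (\<integral>\<^sup>+x. ennreal ((norm (bilop b f g x))\<^sup>2) \<partial>lborel) \<le> ennreal (C1 * B\<^sup>2 * \<rho> ^ DIM('a) * (P * Q)) \<and>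
     (\<forall>x. (norm (bilop b f g x))\<^sup>2 \<le> C1 * B\<^sup>2 * \<rho> ^ (2 * DIM('a)) * (P * Q))"
    using local_estimate[where ?'a = 'a]
  proof (elim exE conjE, goal_cases)
    case (1 C)
    show ?case by (rule 1(1)[OF 1(2)]) (rule 1(3)[rule_format]; assumption)
  qed
  obtain C2 W where C2: "0 < C2" and W: "0 < W" and ln: "\<And>q N (f :: 'a \<Rightarrow> complex). 1 \<le> q \<Longrightarrow> 0 < N \<Longrightarrow> integrable lborel f \<Longrightarrow> lq_le q N f \<Longrightarrow>
     (\<exists>A. A \<in> borel_measurable borel \<and> (\<forall>c. 0 < A c) \<and> (q \<noteq> \<infinity> \<longrightarrow> (\<integral>\<^sup>+c. ennreal (A c) \<partial>lborel) \<le> ennreal W) \<and>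
       (\<forall>\<rho>>0. \<forall>c. (\<integral>\<^sup>+\<xi>. indicator (qbox \<rho>) \<xi> * ennreal ((norm (ft (\<lambda>x. f (c + x) / pw x) \<xi>))\<^sup>2) \<partial>lborel) \<le>
          ennreal (C2 * \<rho> powr (real DIM('a) * (2 * max (recip q) (1/2) - 1)) * (N\<^sup>2 * A c powr (2 * recip q)))))"
    using local_norm[where ?'a = 'a]
  proof (elim exE conjE, goal_cases)
    case (1 C W)
    show ?case by (rule 1(1)[OF 1(2,3)]) (rule 1(4)[rule_format]; assumption)
  qed
  \<comment> \<open>The Leibniz constant for cutting the symbol in space; the summand 1 only gives
    positivity.\<close>
  define D where "D = 2 ^ (6 * n) * (C0 + 1)"
  have D: "0 < D" using \<phi>(1) by (simp add: D_def)
  define K where "K = sqrt C1 * C2 * D"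
  have K: "0 < K" "K\<^sup>2 = C1 * (C2 * C2) * D\<^sup>2" using C1 C2 D by (auto simp: K_def power_mult_distrib power2_eq_square)
  define e where "e = scale_exp q1 q2 r"
  \<comment> \<open>\<open>2 ^ n + 1\<close> is the constant of \<open>local_power_bound\<close>,
    \<open>2 powr (n * e)\<close> comes from the frequency box having radius \<open>2 * R\<close>,
    and \<open>2 * W\<close> from the integrals of the two masses.\<close>
  define C where "C = (2 ^ n + 1) * (K * 2 powr (n * e)) powr r * (2 * W)"
  have C: "0 < C" using K W by (simp add: C_def add_pos_pos)
  show ?thesis
  proof (intro exI[of _ C] conjI allI impI C)
    fix B R N1 N2 :: real and b :: "'a \<times> 'a \<times> 'a \<Rightarrow> complex" and f g :: "'a \<Rightarrow> complex"
    assume b: "ckb (6 * DIM('a)) (\<lambda>z. B * indicator (UNIV \<times> qbox (2 * R)) z) b"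
      and B: "0 < B" and R: "1 \<le> R" and N: "0 < N1" "0 < N2" and fg: "integrable lborel f" "integrable lborel g"
      and lq: "lq_le q1 N1 f" "lq_le q2 N2 g"
    have [measurable]: "b \<in> borel_measurable borel" by (rule ckb_measurable[OF b])
    have fgm [measurable]: "f \<in> borel_measurable borel" "g \<in> borel_measurable borel"
      using fg by (auto dest: borel_measurable_integrable)
    have Tm [measurable]: "bilop b f g \<in> borel_measurable borel" by (rule bilop_measurable) measurable
    define \<rho> where "\<rho> = 2 * R"
    have \<rho>: "1 \<le> \<rho>" "0 < \<rho>" using R by (auto simp: \<rho>_def)
    obtain A1 where A1 [measurable]: "A1 \<in> borel_measurable borel" and A1': "\<And>c. 0 < A1 c"
        "q1 \<noteq> \<infinity> \<Longrightarrow> (\<integral>\<^sup>+c. ennreal (A1 c) \<partial>lborel) \<le> ennreal W"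
        "\<And>c. (\<integral>\<^sup>+\<xi>. indicator (qbox \<rho>) \<xi> * ennreal ((norm (ft (\<lambda>x. f (c + x) / pw x) \<xi>))\<^sup>2) \<partial>lborel) \<le>
          ennreal (C2 * \<rho> powr (n * (2 * max u (1/2) - 1)) * (N1\<^sup>2 * A1 c powr (2 * u)))"
      using ln[OF q(1) N(1) fg(1) lq(1)] unfolding n_def[symmetric] u_def[symmetric]
    proof (elim exE conjE, goal_cases)
      case (1 A)
      show ?case
        by (rule 1(1)[OF 1(2) 1(3)[rule_format] 1(4)[rule_format] 1(5)[rule_format, OF \<rho>(2)]])
    qed
    obtain A2 where A2 [measurable]: "A2 \<in> borel_measurable borel" and A2': "\<And>c. 0 < A2 c"
        "q2 \<noteq> \<infinity> \<Longrightarrow> (\<integral>\<^sup>+c. ennreal (A2 c) \<partial>lborel) \<le> ennreal W"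
        "\<And>c. (\<integral>\<^sup>+\<xi>. indicator (qbox \<rho>) \<xi> * ennreal ((norm (ft (\<lambda>x. g (c + x) / pw x) \<xi>))\<^sup>2) \<partial>lborel) \<le>
          ennreal (C2 * \<rho> powr (n * (2 * max v (1/2) - 1)) * (N2\<^sup>2 * A2 c powr (2 * v)))"
      using ln[OF q(2) N(2) fg(2) lq(2)] unfolding n_def[symmetric] v_def[symmetric]
    proof (elim exE conjE, goal_cases)
      case (1 A)
      show ?case
        by (rule 1(1)[OF 1(2) 1(3)[rule_format] 1(4)[rule_format] 1(5)[rule_format, OF \<rho>(2)]])
    qed
    \<comment> \<open>The product of the two local norms carries the power
      \<open>2 * \<gamma> - n\<close> of \<open>\<rho>\<close>; with the factor
      \<open>\<rho> ^ n\<close> of the L^2 estimate it becomes a perfect square.\<close>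
    define \<gamma> where "\<gamma> = n * (max u (1/2) + max v (1/2) - 1/2)"
    define V where "V c = B * N1 * N2 * (A1 c powr u * A2 c powr v)" for c
    have V: "0 < V c" for c using B N A1'(1)[of c] A2'(1)[of c] by (simp add: V_def)
    define H where "H = K * \<rho> powr (n * e)"
    have H: "0 < H" using K \<rho> by (simp add: H_def)
    have local: "(\<integral>\<^sup>+x. indicator (qbox 1) x * ennreal (norm (bilop b f g (c + x)) powr r) \<partial>lborel) \<le>
        ennreal ((2 ^ n + 1) * (H * V c) powr r)" for c
    proof -
      define bc where "bc z = complex_of_real (\<phi> (fst z)) * b (c + fst z, snd z)" for z
      define U where "U = bilop bc (\<lambda>y. f (c + y)) (\<lambda>y. g (c + y))"
      define s where "s = K * \<rho> powr \<gamma> * V c"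
      have s: "0 < s" using K \<rho> V by (simp add: s_def)
      define P where "P = C2 * \<rho> powr (n * (2 * max u (1/2) - 1)) * (N1\<^sup>2 * A1 c powr (2 * u))"
      define Q where "Q = C2 * \<rho> powr (n * (2 * max v (1/2) - 1)) * (N2\<^sup>2 * A2 c powr (2 * v))"
      have PQ: "0 \<le> P" "0 \<le> Q" using C2 by (auto simp: P_def Q_def)
      have ck\<phi>: "ckb (6 * n) (\<lambda>z :: 'a \<times> 'a \<times> 'a. 1 ^ (6 * n) * (C0 * indicator (qbox 2) (fst z))) (\<lambda>z. complex_of_real (\<phi> (fst z)))"
      proof (rule ckb_comp[where A = fst and S = 1, OF _ _ _ \<phi>(2)])
        show "\<exists>s w. w \<in> Basis \<and> \<bar>s\<bar> \<le> 1 \<and> (\<forall>x t. fst (x + t *\<^sub>R v) = fst x + (t * s) *\<^sub>R w)"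
          if v: "v \<in> Basis" for v :: "'a \<times> 'a \<times> 'a"
        proof (cases "fst v = 0")
          case True
          then show ?thesis
            using nonempty_Basis by (intro exI[of _ 0] exI[of _ "SOME b. b \<in> Basis"]) (auto simp: some_in_eq)
        next
          case False
          then show ?thesis
            using v by (intro exI[of _ 1] exI[of _ "fst v"]) (auto simp: Basis_prod_def)
        qed
      qed (auto intro!: continuous_intros)
      have ckb': "ckb (6 * n) (\<lambda>z. 1 ^ (6 * n) * (B * indicator (UNIV \<times> qbox \<rho>) (c + fst z, snd z))) (\<lambda>z. b (c + fst z, snd z))"
      proof (rule ckb_comp[where A = "\<lambda>z. (c + fst z, snd z)" and S = 1, OF _ _ _ b[folded n_def \<rho>_def]])
        show "\<exists>s w. w \<in> Basis \<and> \<bar>s\<bar> \<le> 1 \<and> (\<forall>x t. (c + fst (x + t *\<^sub>R v), snd (x + t *\<^sub>R v)) =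
            (c + fst x, snd x) + (t * s) *\<^sub>R w)"
          if v: "v \<in> Basis" for v :: "'a \<times> 'a \<times> 'a"
          using v by (intro exI[of _ 1] exI[of _ v]) (auto simp: prod_eq_iff)
      qed (auto intro!: continuous_intros)
      have "ckb (6 * DIM('a)) (\<lambda>z. (D * B) * indicator (qbox 2 \<times> qbox \<rho>) z) bc"
        unfolding bc_def[abs_def] n_def[symmetric]
      proof (rule ckb_mono[OF ckb_mult[OF ck\<phi> ckb']])
        fix z :: "'a \<times> 'a \<times> 'a"
        have "2 ^ (6 * n) * (C0 * B) \<le> D * B" using B by (simp add: D_def algebra_simps)
        then show "2 ^ (6 * n) * (1 ^ (6 * n) * (C0 * indicator (qbox 2) (fst z)) *
            (1 ^ (6 * n) * (B * indicator (UNIV \<times> qbox \<rho>) (c + fst z, snd z)))) \<le> D * B * indicator (qbox 2 \<times> qbox \<rho>) z"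
          by (cases z) (auto simp: indicator_def)
      qed
      from loc[OF this, of "\<lambda>y. f (c + y)" "\<lambda>y. g (c + y)" P Q]
      have est: "(\<integral>\<^sup>+x. ennreal ((norm (U x))\<^sup>2) \<partial>lborel) \<le> ennreal (C1 * (D * B)\<^sup>2 * \<rho> ^ n * (P * Q))"
          "\<And>x. (norm (U x))\<^sup>2 \<le> C1 * (D * B)\<^sup>2 * \<rho> ^ (2 * n) * (P * Q)"
        using B D \<rho> PQ fg fgm A1'(3)[of c] A2'(3)[of c]
        by (auto simp: lborel_integrable_translate U_def P_def Q_def n_def)
      have PQe: "P * Q = (C2 * C2) * \<rho> powr (2 * \<gamma> - n) * (N1 * N2 * (A1 c powr u * A2 c powr v))\<^sup>2"
      proof -
        have rr: "\<rho> powr (n * (2 * max u (1/2) - 1)) * \<rho> powr (n * (2 * max v (1/2) - 1)) = \<rho> powr (2 * \<gamma> - n)"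
          unfolding powr_add[symmetric] \<gamma>_def by (simp add: algebra_simps)
        have sq: "A1 c powr (2 * u) = (A1 c powr u)\<^sup>2" "A2 c powr (2 * v) = (A2 c powr v)\<^sup>2"
          by (simp_all add: power2_eq_square powr_add[symmetric])
        have eq: "(C2 * R1 * (M1 * a1)) * (C2 * R2 * (M2 * a2)) = (C2 * C2) * (R1 * R2) * (M1 * M2 * (a1 * a2))"
          for R1 R2 M1 M2 a1 a2 :: real by (simp only: mult_ac)
        show ?thesis
          unfolding P_def Q_def eq rr sq power_mult_distrib ..
      qed
      have \<rho>e: "\<rho> powr (2 * \<gamma> - n) * \<rho> ^ n = (\<rho> powr \<gamma>)\<^sup>2"
        using \<rho> by (simp add: powr_realpow[symmetric] powr_add[symmetric] power2_eq_square)
      have e1: "C1 * (D * B)\<^sup>2 * \<rho> ^ n * (P * Q) = s\<^sup>2"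
      proof -
        have "C1 * (D * B)\<^sup>2 * \<rho> ^ n * (P * Q) = (C1 * (C2 * C2) * D\<^sup>2) * (\<rho> powr (2 * \<gamma> - n) * \<rho> ^ n) * (V c)\<^sup>2"
          unfolding PQe V_def power_mult_distrib by (simp only: mult_ac)
        then show ?thesis unfolding \<rho>e K(2)[symmetric] by (simp add: s_def power_mult_distrib)
      qed
      have "C1 * (D * B)\<^sup>2 * \<rho> ^ (2 * n) * (P * Q) = (C1 * (D * B)\<^sup>2 * \<rho> ^ n * (P * Q)) * \<rho> ^ n"
        unfolding mult_2[of n] power_add by (simp only: mult_ac)
      then have e2: "C1 * (D * B)\<^sup>2 * \<rho> ^ (2 * n) * (P * Q) = s\<^sup>2 * \<rho> ^ n" by (simp only: e1)
      have Um [measurable]: "U \<in> borel_measurable borel"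
      proof -
        have [measurable]: "bc \<in> borel_measurable borel"
          unfolding bc_def[abs_def] by (rule ckb_measurable[OF ckb_mult[OF ck\<phi> ckb']])
        show ?thesis unfolding U_def by (rule bilop_measurable; measurable)
      qed
      have "(\<integral>\<^sup>+x. indicator (qbox 1) x * ennreal (norm (bilop b f g (c + x)) powr r) \<partial>lborel) =
          (\<integral>\<^sup>+x. indicator (qbox 1) x * ennreal (norm (U x) powr r) \<partial>lborel)"
      proof (intro nn_integral_cong)
        fix x
        have "complex_of_real (\<phi> x) * bilop b f g (c + x) = U x"
          unfolding U_def bc_def[abs_def] by (rule bilop_translate[where \<psi> = "\<lambda>x. complex_of_real (\<phi> x)", OF fgm])
        then show "indicator (qbox 1) x * ennreal (norm (bilop b f g (c + x)) powr r) =
            indicator (qbox 1) x * ennreal (norm (U x) powr r)"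
          using \<phi>(3)[of x] by (cases "x \<in> qbox 1") auto
      qed
      also have "\<dots> \<le> ennreal ((2 ^ n + 1) * (s * \<rho> powr (real n * max 0 (1/2 - 1/r))) powr r)"
        unfolding n_def
        by (rule local_power_bound[OF Um s \<rho>(1) r(1)]) (use est[unfolded e1 e2] in \<open>auto simp: n_def\<close>)
      also have "s * \<rho> powr (real n * max 0 (1/2 - 1/r)) = H * V c"
        using \<rho> by (simp add: s_def H_def e_def scale_exp_def \<gamma>_def u_def[symmetric] v_def[symmetric]
            powr_add[symmetric] algebra_simps)
      finally show ?thesis .
    qed
    have iV: "(\<integral>\<^sup>+c. ennreal (V c powr r) \<partial>lborel) \<le> ennreal ((B * N1 * N2) powr r * (2 * W))"
    proof -
      \<comment> \<open>For infinite q the coefficient \<open>recip q * r\<close> is 0, which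
        removes the one mass whose integral is not controlled.\<close>
      have iA: "(\<integral>\<^sup>+c. ennreal (recip q * r) * ennreal (A c) \<partial>lborel) \<le> ennreal W"
        if "q \<noteq> \<infinity> \<Longrightarrow> (\<integral>\<^sup>+c. ennreal (A c) \<partial>lborel) \<le> ennreal W" "recip q * r \<le> 1"
          and [measurable]: "A \<in> borel_measurable borel" for q and A :: "'a \<Rightarrow> real"
      proof (cases "q = \<infinity>")
        case False
        have "(\<integral>\<^sup>+c. ennreal (recip q * r) * ennreal (A c) \<partial>lborel) = ennreal (recip q * r) * (\<integral>\<^sup>+c. ennreal (A c) \<partial>lborel)"
          by (rule nn_integral_cmult) measurable
        also have "\<dots> \<le> ennreal 1 * ennreal W" using that(1)[OF False] that(2) by (intro mult_mono ennreal_leI) auto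
        finally show ?thesis by simp
      qed (simp add: recip_def)
      have "(\<integral>\<^sup>+c. ennreal (V c powr r) \<partial>lborel) \<le>
          (\<integral>\<^sup>+c. ennreal ((B * N1 * N2) powr r) * (ennreal (recip q1 * r) * ennreal (A1 c) + ennreal (recip q2 * r) * ennreal (A2 c)) \<partial>lborel)"
      proof (intro nn_integral_mono)
        fix c
        have "V c powr r = (B * N1 * N2) powr r * (A1 c powr (u * r) * A2 c powr (v * r))"
          by (simp add: V_def powr_mult powr_powr)
        also have "\<dots> \<le> (B * N1 * N2) powr r * (u * r * A1 c + v * r * A2 c)"
          using uv0 r(1) ruv A1'(1) A2'(1) by (intro mult_left_mono Youngs_inequality_0) auto
        finally show "ennreal (V c powr r) \<le>
            ennreal ((B * N1 * N2) powr r) * (ennreal (recip q1 * r) * ennreal (A1 c) + ennreal (recip q2 * r) * ennreal (A2 c))"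
          using uv0 r(1) A1'(1)[of c] A2'(1)[of c]
          by (simp add: u_def[symmetric] v_def[symmetric] ennreal_mult[symmetric] ennreal_plus[symmetric] ennreal_leI less_imp_le del: ennreal_plus)
      qed
      also have "\<dots> = ennreal ((B * N1 * N2) powr r) * ((\<integral>\<^sup>+c. ennreal (recip q1 * r) * ennreal (A1 c) \<partial>lborel) +
          (\<integral>\<^sup>+c. ennreal (recip q2 * r) * ennreal (A2 c) \<partial>lborel))"
        by (subst nn_integral_cmult) (simp_all add: nn_integral_add)
      also have "\<dots> \<le> ennreal ((B * N1 * N2) powr r) * (ennreal W + ennreal W)"
      proof (intro mult_left_mono add_mono iA)
        have "0 \<le> u * r" "0 \<le> v * r" using uv0 r(1) by auto
        then show "recip q1 * r \<le> 1" "recip q2 * r \<le> 1"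
          using ruv unfolding u_def[symmetric] v_def[symmetric] by linarith+
      qed (use A1'(2) A2'(2) in auto)
      also have "\<dots> = ennreal ((B * N1 * N2) powr r * (2 * W))"
        using W by (simp add: ennreal_mult[symmetric] ennreal_plus[symmetric] del: ennreal_plus)
      finally show ?thesis .
    qed
    \<comment> \<open>Integrating the integral over the cube at \<open>c\<close> over all
      \<open>c\<close> counts every point with the volume \<open>2 ^ n\<close> of the cube.\<close>
    have "ennreal (2 ^ n) * (\<integral>\<^sup>+x. ennreal (norm (bilop b f g x) powr r) \<partial>lborel) =
        (\<integral>\<^sup>+x. indicator (qbox 1) (x::'a) * (\<integral>\<^sup>+c. ennreal (norm (bilop b f g c) powr r) \<partial>lborel) \<partial>lborel)"
      by (subst nn_integral_multc) (simp_all add: emeasure_qbox n_def)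
    also have "\<dots> = (\<integral>\<^sup>+x. indicator (qbox 1) x * (\<integral>\<^sup>+c. ennreal (norm (bilop b f g (x + c)) powr r) \<partial>lborel) \<partial>lborel)"
      by (subst nn_integral_lborel_translate) simp_all
    also have "\<dots> = (\<integral>\<^sup>+x. (\<integral>\<^sup>+c. indicator (qbox 1) x * ennreal (norm (bilop b f g (x + c)) powr r) \<partial>lborel) \<partial>lborel)"
      by (subst nn_integral_cmult) simp_all
    also have "\<dots> = (\<integral>\<^sup>+c. (\<integral>\<^sup>+x. indicator (qbox 1) x * ennreal (norm (bilop b f g (x + c)) powr r) \<partial>lborel) \<partial>lborel)"
      by (rule lborel_pair.Fubini') measurable
    also have "\<dots> \<le> (\<integral>\<^sup>+c. ennreal ((2 ^ n + 1) * H powr r) * ennreal (V c powr r) \<partial>lborel)"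
    proof (intro nn_integral_mono)
      fix c
      have e: "(2 ^ n + 1) * (H * V c) powr r = (2 ^ n + 1) * H powr r * V c powr r" by (simp add: powr_mult)
      have "ennreal ((2 ^ n + 1) * H powr r) * ennreal (V c powr r) = ennreal ((2 ^ n + 1) * (H * V c) powr r)"
        unfolding e by (rule ennreal_mult[symmetric]) auto
      then show "(\<integral>\<^sup>+x. indicator (qbox 1) x * ennreal (norm (bilop b f g (x + c)) powr r) \<partial>lborel) \<le>
          ennreal ((2 ^ n + 1) * H powr r) * ennreal (V c powr r)"
        using local[of c] by (simp only: add.commute[of _ c])
    qed
    also have "\<dots> = ennreal ((2 ^ n + 1) * H powr r) * (\<integral>\<^sup>+c. ennreal (V c powr r) \<partial>lborel)"
      by (rule nn_integral_cmult) (simp add: V_def[abs_def])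
    also have "\<dots> \<le> ennreal ((2 ^ n + 1) * H powr r) * ennreal ((B * N1 * N2) powr r * (2 * W))"
      by (intro mult_left_mono iV) simp
    also have "\<dots> = ennreal (C * (B * R powr (n * e) * N1 * N2) powr r)"
    proof -
      have "H = (K * 2 powr (n * e)) * R powr (n * e)"
        using R by (simp add: H_def \<rho>_def powr_mult)
      then have "(2 ^ n + 1) * H powr r * ((B * N1 * N2) powr r * (2 * W)) = C * (B * R powr (n * e) * N1 * N2) powr r"
        by (simp add: C_def powr_mult mult_ac)
      then show ?thesis using W by (subst ennreal_mult[symmetric]) auto
    qed
    finally have "ennreal (2 ^ n) * (\<integral>\<^sup>+x. ennreal (norm (bilop b f g x) powr r) \<partial>lborel) \<le> ennreal (C * (B * R powr (n * e) * N1 * N2) powr r)" .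
    moreover have "1 * (\<integral>\<^sup>+x. ennreal (norm (bilop b f g x) powr r) \<partial>lborel) \<le> ennreal (2 ^ n) * (\<integral>\<^sup>+x. ennreal (norm (bilop b f g x) powr r) \<partial>lborel)"
      by (intro mult_right_mono) auto
    ultimately show "(\<integral>\<^sup>+x. ennreal (norm (bilop b f g x) powr r) \<partial>lborel) \<le>
       ennreal (C * (B * R powr (real DIM('a) * scale_exp q1 q2 r) * N1 * N2) powr r)"
      by (simp add: n_def e_def)
  qed
qed

subsection \<open>Schwartz functions and rescaling\<close>

lemma smooth_has_dd:
  assumes "smooth F" "vs \<in> lists Basis" "v \<in> Basis"
  shows "has_dd v (iderv vs F) (iderv (v # vs) F)"
proof -
  have "(\<lambda>t::real. iderv vs F (z + t *\<^sub>R v)) differentiable (at 0)" for z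
    using assms by (auto simp: smooth_def)
  then show ?thesis
    unfolding has_dd_def by (simp add: dirderiv_def vector_derivative_works)
qed

text \<open>The map \<open>A\<close> is diagonal up to translation, with its own speed
  \<open>s v\<close> in each basis direction, so a derivative along the list \<open>vs\<close> picks
  up the product of the speeds. Space and frequency can thus be scaled in opposite directions at
  once.\<close>

lemma ckb_smooth_scaled:
  fixes F :: "'b::euclidean_space \<Rightarrow> complex" and A :: "'b \<Rightarrow> 'b"
  assumes F: "smooth F" and A: "\<And>v x t. v \<in> Basis \<Longrightarrow> A (x + t *\<^sub>R v) = A x + (t * s v) *\<^sub>R v"
    and cA: "continuous_on UNIV A"
    and M: "\<And>vs z. vs \<in> lists Basis \<Longrightarrow> length vs \<le> K \<Longrightarrow> \<bar>prod_list (map s vs)\<bar> * norm (iderv vs F (A z)) \<le> M z"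
  shows "ckb K M (\<lambda>z. F (A z))"
proof -
  \<comment> \<open>Induction on the number \<open>k\<close> of derivatives still to come, for an
    arbitrary list \<open>us\<close> of derivatives already taken.\<close>
  have "ckb k M (\<lambda>z. of_real (prod_list (map s us)) * iderv us F (A z))"
    if "us \<in> lists Basis" "length us + k \<le> K" for k us
    using that
  proof (induction k arbitrary: us)
    case 0
    have "continuous_on UNIV (\<lambda>z. iderv us F (A z))"
      using F 0 by (intro continuous_on_compose2[OF _ cA]) (auto simp: smooth_def)
    then show ?case using M[of us] 0 by (auto intro!: continuous_intros simp: norm_mult)
  next
    case (Suc k)
    show ?case
    proof (rule ckb_SucI[where h' = "\<lambda>v z. of_real (prod_list (map s (v # us))) * iderv (v # us) F (A z)"])
      have "continuous_on UNIV (\<lambda>z. iderv us F (A z))"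
        using F Suc.prems by (intro continuous_on_compose2[OF _ cA]) (auto simp: smooth_def)
      then show "continuous_on UNIV (\<lambda>z. of_real (prod_list (map s us)) * iderv us F (A z))"
        by (intro continuous_intros)
      show "norm (of_real (prod_list (map s us)) * iderv us F (A z)) \<le> M z" for z
        using M[of us] Suc.prems by (simp add: norm_mult)
      fix v :: 'b assume v: "v \<in> Basis"
      have "has_dd v (\<lambda>z. iderv us F (A z)) (\<lambda>z. of_real (s v) * iderv (v # us) F (A z))"
        by (rule has_dd_comp[OF smooth_has_dd[OF F Suc.prems(1) v] A[OF v]])
      from has_dd_cmult[OF this, of "of_real (prod_list (map s us))"]
      show "has_dd v (\<lambda>z. of_real (prod_list (map s us)) * iderv us F (A z))
          (\<lambda>z. of_real (prod_list (map s (v # us))) * iderv (v # us) F (A z))"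
        by (simp add: mult_ac del: iderv.simps)
      show "ckb k M (\<lambda>z. of_real (prod_list (map s (v # us))) * iderv (v # us) F (A z))"
        using Suc.prems v by (intro Suc.IH) auto
    qed
  qed
  from this[of "[]" K] show ?thesis by simp
qed

lemma finite_lists_Basis: "finite {vs \<in> lists (Basis :: 'b::euclidean_space set). length vs \<le> K}"
  by (rule finite_subset[OF _ finite_lists_length_le[OF finite_Basis, of K]]) auto

lemma wt_lower: "1 / (1 + norm x) ^ (2 * DIM('a)) \<le> wt (x :: 'a::euclidean_space)"
proof -
  have "(\<Prod>b\<in>(Basis :: 'a set). 1 / (1 + norm x)\<^sup>2) \<le> wt x"
    unfolding wt_def
  proof (intro prod_mono conjI)
    fix b :: 'a assume b: "b \<in> Basis"
    have "(x \<bullet> b)\<^sup>2 \<le> (norm x)\<^sup>2"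
      using Basis_le_norm[OF b, of x] by (metis abs_ge_zero power2_abs power_mono)
    moreover have "(1 + norm x)\<^sup>2 = 1 + 2 * norm x + (norm x)\<^sup>2"
      by (simp add: power2_eq_square algebra_simps)
    ultimately have "1 + (x \<bullet> b)\<^sup>2 \<le> (1 + norm x)\<^sup>2" using norm_ge_zero[of x] by linarith
    then show "1 / (1 + norm x)\<^sup>2 \<le> 1 / (1 + (x \<bullet> b)\<^sup>2)"
      by (intro divide_left_mono mult_pos_pos zero_less_power one_plus_square_pos add_pos_nonneg) auto
  qed simp
  then show ?thesis by (simp add: power_mult power_divide)
qed

text \<open>Decay of order \<open>2 * DIM\<close> is what \<open>wt_lower\<close> converts into the
  product weight. One constant serves all derivatives because there are only finitely many lists of
  length at most \<open>k\<close>.\<close>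

lemma schwartz_ckb:
  fixes f :: "real^'n \<Rightarrow> complex"
  assumes "schwartz f"
  shows "\<exists>C. ckb k (\<lambda>z. C * wt z) f"
proof -
  have f: "smooth f" using assms by (simp add: schwartz_def)
  have "\<forall>vs\<in>lists Basis. \<exists>C. \<forall>x. (1 + norm x) ^ (2 * DIM(real^'n)) * norm (iderv vs f x) \<le> C"
    using assms unfolding schwartz_def by blast
  from bchoice[OF this] obtain C where H: "\<forall>vs\<in>lists Basis. \<forall>x. (1 + norm x) ^ (2 * DIM(real^'n)) * norm (iderv vs f x) \<le> C vs" ..
  have C: "(1 + norm x) ^ (2 * DIM(real^'n)) * norm (iderv vs f x) \<le> C vs" if "vs \<in> lists Basis" for vs x
    by (rule spec[OF bspec[OF H that]])
  define L where "L = {vs \<in> lists (Basis :: (real^'n) set). length vs \<le> k}"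
  define D where "D = (\<Sum>vs\<in>L. \<bar>C vs\<bar>)"
  have "ckb k (\<lambda>z. D * wt z) (\<lambda>z. f (id z))"
  proof (rule ckb_smooth_scaled[where s = "\<lambda>_. 1" and A = id, OF f])
    fix vs :: "(real^'n) list" and z :: "real^'n"
    assume vs: "vs \<in> lists Basis" "length vs \<le> k"
    have "\<bar>C vs\<bar> \<le> (\<Sum>vs\<in>L. \<bar>C vs\<bar>)"
      using vs finite_lists_Basis[of k] unfolding L_def by (intro member_le_sum) auto
    then have CD: "C vs \<le> D" unfolding D_def by linarith
    have p: "0 < (1 + norm z) ^ (2 * DIM(real^'n))" by (intro zero_less_power) (simp add: add_pos_nonneg)
    have "norm (iderv vs f z) \<le> C vs / (1 + norm z) ^ (2 * DIM(real^'n))"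
      using C[OF vs(1), of z] p by (simp only: pos_le_divide_eq mult.commute)
    also have "\<dots> \<le> D * (1 / (1 + norm z) ^ (2 * DIM(real^'n)))"
      using CD p by (simp add: divide_right_mono del: DIM_cart)
    also have "\<dots> \<le> D * wt z"
      by (intro mult_left_mono wt_lower) (simp add: D_def sum_nonneg)
    finally show "\<bar>prod_list (map (\<lambda>_. 1::real) vs)\<bar> * norm (iderv vs f (id z)) \<le> D * wt z"
      by (simp add: map_replicate_const)
  qed (auto intro!: continuous_intros)
  then show ?thesis by (auto simp del: ckb.simps)
qed

lemma schwartz_facts:
  fixes f :: "real^'n \<Rightarrow> complex"
  assumes "schwartz f"
  shows "integrable lborel f" "integrable lborel (ft f)"
proof -
  obtain C where C: "ckb (2 * DIM(real^'n)) (\<lambda>z. C * wt z) f" using schwartz_ckb[OF assms] by blast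
  then show i: "integrable lborel f" by (rule ckb_integrable)
  have m: "f \<in> borel_measurable borel" by (rule ckb_measurable[OF C])
  show "integrable lborel (ft f)"
  proof (rule integrable_wt_bound)
    show "norm (ft f y) \<le> 4 ^ DIM(real^'n) * (LINT x|lborel. C * wt (x :: real^'n)) * wt y" for y
      by (rule ft_decay[OF C order_refl]) measurable
    show "ft f \<in> borel_measurable borel" using m by measurable
  qed
qed

section \<open>Passage from the iterated integral to the frequency pair, and rescaling\<close>

lemma fourier_ft: "fourier f = ft f"
  by (simp add: fun_eq_iff fourier_def ft_def)

lemma bilop_integrable:
  fixes A :: "'a::euclidean_space \<times> 'a \<times> 'a \<Rightarrow> complex"
  assumes [measurable]: "A \<in> borel_measurable borel" and A: "\<And>z. norm (A z) \<le> C"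
    and f: "integrable lborel (ft f)" and g: "integrable lborel (ft g)"
  shows "integrable lborel (\<lambda>\<zeta>. A (x, \<zeta>) * phase x \<zeta> * (ft f (fst \<zeta>) * ft g (snd \<zeta>)))"
proof -
  have i: "integrable lborel (\<lambda>\<zeta>. ft f (fst \<zeta>) * ft g (snd \<zeta>))" by (rule integrable_tensor[OF f g])
  have C: "0 \<le> C" using A[of undefined] norm_ge_zero order_trans by blast
  show ?thesis
  proof (rule Bochner_Integration.integrable_bound[OF integrable_mult_right[OF i, of "of_real C"]])
    have [measurable]: "(\<lambda>\<zeta>. ft f (fst \<zeta>) * ft g (snd \<zeta>)) \<in> borel_measurable borel"
      using borel_measurable_integrable[OF i] by simp
    show "(\<lambda>\<zeta>. A (x, \<zeta>) * phase x \<zeta> * (ft f (fst \<zeta>) * ft g (snd \<zeta>))) \<in> borel_measurable lborel"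
      by measurable
    show "AE \<zeta> in lborel. norm (A (x, \<zeta>) * phase x \<zeta> * (ft f (fst \<zeta>) * ft g (snd \<zeta>)))
        \<le> norm (of_real C * (ft f (fst \<zeta>) * ft g (snd \<zeta>)))"
      using A C by (intro AE_I2) (auto simp: norm_mult intro!: mult_right_mono)
  qed
qed

lemma bipsido_bilop:
  fixes a :: "real^'n \<Rightarrow> real^'n \<Rightarrow> real^'n \<Rightarrow> complex"
  defines "A \<equiv> (\<lambda>(x, \<xi>, \<eta>). a x \<xi> \<eta>)"
  assumes Am: "A \<in> borel_measurable borel" and A: "\<And>z. norm (A z) \<le> C"
    and f: "integrable lborel (ft f)" and g: "integrable lborel (ft g)"
  shows "bipsido a f g x = bilop A f g x"
proof -
  have "integrable (lborel \<Otimes>\<^sub>M lborel) (\<lambda>(\<xi>, \<eta>). A (x, \<xi>, \<eta>) * exp (\<i> * complex_of_real ((\<xi>, \<eta>) \<bullet> (x, x))) * (ft f \<xi> * ft g \<eta>))"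
    using bilop_integrable[OF Am A f g, of x] by (simp add: lborel_prod case_prod_beta' del: inner_Pair)
  from lborel_pair.integral_fst[OF this]
  have "(LINT \<xi>|lborel. LINT \<eta>|lborel. A (x, \<xi>, \<eta>) * exp (\<i> * complex_of_real ((\<xi>, \<eta>) \<bullet> (x, x))) * (ft f \<xi> * ft g \<eta>)) =
      bilop A f g x"
    by (simp add: bilop_def lborel_prod case_prod_beta' del: inner_Pair)
  then show ?thesis
    by (simp add: bipsido_def A_def fourier_ft inner_add_right inner_commute mult.assoc)
qed

text \<open>The Jacobian over the frequency pair is the product of the factors
  \<open>l ^ DIM('a)\<close> that the transforms of the two dilated functions acquire.\<close>

lemma bilop_scale:
  fixes f g :: "'a::euclidean_space \<Rightarrow> complex"
  assumes [measurable]: "c \<in> borel_measurable borel" "f \<in> borel_measurable borel" "g \<in> borel_measurable borel" and l: "0 < l"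
  shows "bilop c f g ((1 / l) *\<^sub>R x) =
    bilop (\<lambda>z. c ((1 / l) *\<^sub>R fst z, l *\<^sub>R snd z)) (\<lambda>y. f ((1 / l) *\<^sub>R y)) (\<lambda>y. g ((1 / l) *\<^sub>R y)) x"
proof -
  define \<Phi> where "\<Phi> \<zeta> = ft f (fst \<zeta>) * ft g (snd \<zeta>)" for \<zeta>
  have [measurable]: "\<Phi> \<in> borel_measurable borel"
  proof -
    have "(\<lambda>\<zeta>. ft f (fst \<zeta>) * ft g (snd \<zeta>)) \<in> borel_measurable (borel \<Otimes>\<^sub>M borel)" by measurable
    then show ?thesis by (simp add: borel_prod \<Phi>_def[abs_def])
  qed
  define y where "y = (1 / l) *\<^sub>R x"
  have xy: "x = l *\<^sub>R y" using l by (simp add: y_def)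
  have "bilop c f g y = (l ^ DIM('a \<times> 'a)) *\<^sub>R (LINT \<zeta>|lborel. c (y, l *\<^sub>R \<zeta>) * exp (\<i> * complex_of_real ((l *\<^sub>R \<zeta>) \<bullet> (y, y))) * \<Phi> (l *\<^sub>R \<zeta>))"
    unfolding bilop_def \<Phi>_def[symmetric] by (rule lborel_integral_scale[OF _ l]) measurable
  also have "\<dots> = (LINT \<zeta>|lborel. c (y, l *\<^sub>R \<zeta>) * phase x \<zeta> *
      (ft (\<lambda>y. f ((1 / l) *\<^sub>R y)) (fst \<zeta>) * ft (\<lambda>y. g ((1 / l) *\<^sub>R y)) (snd \<zeta>)))"
    unfolding integral_scaleR_right[symmetric]
  proof (intro Bochner_Integration.integral_cong refl)
    fix \<zeta> :: "'a \<times> 'a"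
    have e: "(l *\<^sub>R \<zeta>) \<bullet> (y, y) = \<zeta> \<bullet> (x, x)"
      by (simp add: xy inner_prod_def algebra_simps)
    show "l ^ DIM('a \<times> 'a) *\<^sub>R (c (y, l *\<^sub>R \<zeta>) * exp (\<i> * complex_of_real ((l *\<^sub>R \<zeta>) \<bullet> (y, y))) * \<Phi> (l *\<^sub>R \<zeta>)) =
      c (y, l *\<^sub>R \<zeta>) * phase x \<zeta> *
      (ft (\<lambda>y. f ((1 / l) *\<^sub>R y)) (fst \<zeta>) * ft (\<lambda>y. g ((1 / l) *\<^sub>R y)) (snd \<zeta>))"
      unfolding e ft_scale[OF assms(2) l] ft_scale[OF assms(3) l]
      by (simp add: \<Phi>_def scaleR_conv_of_real power_add)
  qed
  finally show ?thesis by (simp add: y_def bilop_def)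
qed

lemma lq_le_scale:
  fixes f :: "'a::euclidean_space \<Rightarrow> complex"
  assumes [measurable]: "f \<in> borel_measurable borel" and l: "0 < l" and q: "1 \<le> q" and N: "0 < N" and f: "lq_le q N f"
  shows "lq_le q (l powr (real DIM('a) * recip q) * N) (\<lambda>x. f ((1 / l) *\<^sub>R x))"
proof (cases "q = \<infinity>")
  case True
  have "AE x in lborel. norm (f x) \<le> N" using f True by (simp add: lq_le_def)
  \<comment> \<open>The exceptional null set is carried through the dilation by the integral of its
    indicator.\<close>
  then have "(\<integral>\<^sup>+x. indicator {x. \<not> norm (f x) \<le> N} x \<partial>lborel) = 0"
    by (subst nn_integral_0_iff_AE) (auto simp: indicator_def)
  then have *: "ennreal ((1 / l) ^ DIM('a)) * (\<integral>\<^sup>+x. indicator {x. \<not> norm (f x) \<le> N} ((1 / l) *\<^sub>R x) \<partial>lborel) = 0"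
    using l by (subst nn_integral_lborel_scale[symmetric]) auto
  have "(\<integral>\<^sup>+x. indicator {x. \<not> norm (f x) \<le> N} ((1 / l) *\<^sub>R x) \<partial>lborel) = (0::ennreal)"
  proof -
    have "0 < (1 / l) ^ DIM('a)" using l by simp
    then show ?thesis using * by (simp only: mult_eq_0_iff ennreal_eq_0_iff not_le[symmetric] simp_thms)
  qed
  then have "AE x in lborel. norm (f ((1 / l) *\<^sub>R x)) \<le> N"
    by (subst (asm) nn_integral_0_iff_AE) (auto simp: indicator_def)
  then show ?thesis using True l by (simp add: lq_le_def recip_def)
next
  case False
  define p where "p = real_of_ereal q"
  have p: "recip q = 1 / p" "1 \<le> p" using recip_finite[OF q False] by (auto simp: p_def)
  have fp: "(\<integral>\<^sup>+x. ennreal (norm (f x) powr p) \<partial>lborel) \<le> ennreal (N powr p)"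
    using f False by (simp add: lq_le_def p_def)
  have "(\<integral>\<^sup>+x. ennreal (norm (f ((1 / l) *\<^sub>R x)) powr p) \<partial>lborel) =
      ennreal (l ^ DIM('a)) * (\<integral>\<^sup>+x. ennreal (norm (f ((1 / l) *\<^sub>R (l *\<^sub>R x))) powr p) \<partial>lborel)"
    by (rule nn_integral_lborel_scale[OF _ l]) measurable
  also have "\<dots> \<le> ennreal (l ^ DIM('a)) * ennreal (N powr p)" using l fp by (intro mult_left_mono) auto
  also have "\<dots> = ennreal ((l powr (real DIM('a) * (1 / p)) * N) powr p)"
  proof -
    have "(l powr (real DIM('a) * (1 / p)) * N) powr p = l powr (real DIM('a) * (1 / p) * p) * N powr p"
      using l N by (simp only: powr_mult powr_powr)
    also have "l powr (real DIM('a) * (1 / p) * p) = l ^ DIM('a)"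
      using l p(2) powr_realpow[OF l, of "DIM('a)"] by simp
    finally show ?thesis using l by (simp add: ennreal_mult)
  qed
  finally show ?thesis using False by (simp add: lq_le_def p_def[symmetric] p(1))
qed

text \<open>Treats r < 1 and r >= 1 together: the sum is at most a geometric series times the
  largest weighted term, and the r-th power of that term is one summand on the right.\<close>

lemma sum_powr_le:
  fixes t :: "nat \<Rightarrow> real"
  assumes t: "\<And>j. 0 \<le> t j" and r: "0 < r" and \<sigma>: "0 < \<sigma>"
  shows "(\<Sum>j\<le>J. t j) powr r \<le> (1 / (1 - 2 powr (- \<sigma>))) powr r * (\<Sum>j\<le>J. (2 powr (real j * \<sigma>) * t j) powr r)"
proof -
  define z where "z = 2 powr (- \<sigma>)"
  have z: "0 < z" "z < 1" using \<sigma> by (use powr_less_mono[of "- \<sigma>" 0 2] \<sigma> in \<open>auto simp: z_def\<close>)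
  define m where "m = Max ((\<lambda>j. 2 powr (real j * \<sigma>) * t j) ` {..J})"
  have "m \<in> (\<lambda>j. 2 powr (real j * \<sigma>) * t j) ` {..J}" unfolding m_def by (intro Max_in) auto
  then obtain k where k: "k \<le> J" "m = 2 powr (real k * \<sigma>) * t k" by auto
  have m0: "0 \<le> m" using t k(2) by simp
  have tm: "t j \<le> z ^ j * m" if "j \<le> J" for j
  proof -
    have "2 powr (real j * \<sigma>) * t j \<le> m" unfolding m_def using that by (intro Max_ge) auto
    then have "z ^ j * (2 powr (real j * \<sigma>) * t j) \<le> z ^ j * m" using z by (intro mult_left_mono) auto
    moreover have "z ^ j * 2 powr (real j * \<sigma>) = 1"
      by (simp add: z_def powr_realpow[symmetric] powr_powr powr_add[symmetric] mult.commute)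
    ultimately show ?thesis by (simp add: mult.assoc[symmetric])
  qed
  have "(\<Sum>j\<le>J. t j) \<le> (\<Sum>j\<le>J. z ^ j) * m"
    unfolding sum_distrib_right using tm by (intro sum_mono) auto
  also have "(\<Sum>j\<le>J. z ^ j) \<le> 1 / (1 - z)"
  proof -
    have "(\<Sum>j\<le>J. z ^ j) \<le> (\<Sum>j. z ^ j)"
      using z by (intro sum_le_suminf summable_geometric) auto
    then show ?thesis using z by (simp add: suminf_geometric)
  qed
  finally have "(\<Sum>j\<le>J. t j) \<le> 1 / (1 - z) * m" using m0 by (simp add: mult_right_mono)
  then have "(\<Sum>j\<le>J. t j) powr r \<le> (1 / (1 - z) * m) powr r"
    using r t by (intro powr_mono2) (auto intro!: sum_nonneg)
  also have "\<dots> = (1 / (1 - z)) powr r * m powr r" by (simp only: powr_mult)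
  also have "m powr r \<le> (\<Sum>j\<le>J. (2 powr (real j * \<sigma>) * t j) powr r)"
    unfolding k(2) using k(1) by (intro member_le_sum[of k "{..J}" "\<lambda>j. (2 powr (real j * \<sigma>) * t j) powr r"]) auto
  finally show ?thesis by (simp add: z_def mult_left_mono)
qed

subsection \<open>Dyadic pieces of the symbol\<close>

text \<open>The hole is an open box, so the set is closed, as \<open>ckb_supp\<close> requires; the
  first piece has no hole.\<close>

definition annulus :: "bool \<Rightarrow> real \<Rightarrow> 'a::euclidean_space set" where
  "annulus first R = qbox (2 * R) - (if first then {} else box (- (R / 2) *\<^sub>R One) ((R / 2) *\<^sub>R One))"

definition dyadic_cut :: "('a::euclidean_space \<Rightarrow> real) \<Rightarrow> bool \<Rightarrow> real \<Rightarrow> 'a \<Rightarrow> real" where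
  "dyadic_cut \<phi> first R \<zeta> = \<phi> ((1 / R) *\<^sub>R \<zeta>) - (if first then 0 else \<phi> ((2 / R) *\<^sub>R \<zeta>))"

lemma ckb_dilate:
  assumes f: "ckb k M f" and "0 \<le> c" "c \<le> S" "1 \<le> S"
  shows "ckb k (\<lambda>x. S ^ k * M (c *\<^sub>R x)) (\<lambda>x. f (c *\<^sub>R x))"
proof (rule ckb_comp[where A = "\<lambda>x. c *\<^sub>R x", OF _ _ _ f])
  show "\<exists>s w. w \<in> Basis \<and> \<bar>s\<bar> \<le> S \<and> (\<forall>x t. c *\<^sub>R (x + t *\<^sub>R v) = c *\<^sub>R x + (t * s) *\<^sub>R w)"
    if "v \<in> Basis" for v :: 'a
    using assms that by (intro exI[of _ c] exI[of _ v]) (auto simp: algebra_simps)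
qed (use assms in \<open>auto intro!: continuous_intros\<close>)

text \<open>The outer cutoff is dilated by 1/R, at most 1, and keeps its bounds; the inner one by
  2/R, at most 2, and costs \<open>2 ^ k\<close>.\<close>

lemma cut_ckb:
  fixes \<phi> :: "'a::euclidean_space \<Rightarrow> real"
  assumes \<phi>: "ckb k (\<lambda>z. C * indicator (qbox 2) z) (\<lambda>z. complex_of_real (\<phi> z))" and C: "0 \<le> C"
    and one: "\<And>z. z \<in> qbox 1 \<Longrightarrow> \<phi> z = 1" and R: "1 \<le> R"
  shows "ckb k (\<lambda>z. C * (1 + 2 ^ k) * indicator (annulus first R) z) (\<lambda>z. complex_of_real (dyadic_cut \<phi> first R z))"
proof -
  have out: "\<phi> z = 0" if "z \<notin> qbox 2" for z
    using ckb_bound[OF \<phi>, of z] that by simp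
  have 1: "ckb k (\<lambda>z. C) (\<lambda>z. complex_of_real (\<phi> ((1 / R) *\<^sub>R z)))"
    by (rule ckb_mono[OF ckb_dilate[OF \<phi>, of "1 / R" 1]]) (use R C in \<open>auto simp: indicator_def\<close>)
  have "ckb k (\<lambda>z. 2 ^ k * (C * indicator (qbox 2) ((2 / R) *\<^sub>R z))) (\<lambda>z. complex_of_real (\<phi> ((2 / R) *\<^sub>R z)))"
    using R by (intro ckb_dilate[OF \<phi>]) (auto simp: divide_le_eq)
  then have 2: "ckb k (\<lambda>z. 2 ^ k * C) (\<lambda>z. complex_of_real (\<phi> ((2 / R) *\<^sub>R z)))"
    by (rule ckb_mono) (use C in \<open>auto simp: indicator_def\<close>)
  have ck: "ckb k (\<lambda>z. C * (1 + 2 ^ k)) (\<lambda>z. complex_of_real (dyadic_cut \<phi> first R z))"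
  proof (cases first)
    case True
    then show ?thesis
      unfolding dyadic_cut_def using C by (auto intro!: ckb_mono[OF 1] mult_left_le[where a = C, THEN order_trans[rotated]] simp: algebra_simps)
  next
    case False
    have "ckb k (\<lambda>z. C + norm (-1 :: complex) * (2 ^ k * C)) (\<lambda>z. complex_of_real (\<phi> ((1 / R) *\<^sub>R z)) + (-1) * complex_of_real (\<phi> ((2 / R) *\<^sub>R z)))"
      by (intro ckb_add ckb_cmult 1 2)
    then show ?thesis
      using False by (simp add: dyadic_cut_def[abs_def] algebra_simps del: ckb.simps)
  qed
  have cl: "closed (annulus first R :: 'a set)"
    unfolding annulus_def by (auto intro!: closed_Diff closed_qbox open_box)
  have van: "complex_of_real (dyadic_cut \<phi> first R z) = 0" if z: "z \<notin> annulus first R" for z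
  proof (cases "z \<in> qbox (2 * R)")
    case False
    have "(1 / R) *\<^sub>R z \<notin> qbox 2" "(2 / R) *\<^sub>R z \<notin> qbox 2"
    proof -
      show "(1 / R) *\<^sub>R z \<notin> qbox 2" using False R by (simp add: mem_qbox_scale)
      have "z \<notin> qbox R" using False R qbox_mono[of R "2 * R"] by auto
      then show "(2 / R) *\<^sub>R z \<notin> qbox 2" using R by (simp add: mem_qbox_scale)
    qed
    then show ?thesis by (simp add: dyadic_cut_def out)
  next
    case True
    then have "\<not> first" "z \<in> box (- (R / 2) *\<^sub>R One) ((R / 2) *\<^sub>R One)"
      using z by (auto simp: annulus_def split: if_splits)
    moreover from this have "z \<in> qbox (R / 2)" "z \<in> qbox R"
      using R by (auto simp: mem_box qbox_def abs_le_iff minus_le_iff intro!: less_imp_le)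
    ultimately show ?thesis using R by (simp add: dyadic_cut_def one mem_qbox_scale)
  qed
  show ?thesis by (rule ckb_supp[OF cl ck van])
qed

text \<open>In the original variables the piece lives where 1 + |\<xi>| + |\<eta>| is comparable to
  \<open>l * R\<close>. The upper bound needs 4n + 1 and the lower bound 2; \<open>c\<close> covers
  both. The first piece has no hole, but there \<open>l * R\<close> is 1 and the lower bound is
  trivial.\<close>

lemma annulus_size:
  fixes \<xi> \<eta> :: "'a::euclidean_space"
  assumes z: "(\<xi>, \<eta>) \<in> annulus first R" and R: "1 \<le> R" and l: "1 \<le> l" and f: "first \<Longrightarrow> l * R = 1"
  defines "T \<equiv> 1 + norm (l *\<^sub>R \<xi>) + norm (l *\<^sub>R \<eta>)" and "c \<equiv> 4 * real DIM('a) + 2"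
  shows "T \<le> c * (l * R)" "l * R \<le> c * T"
proof -
  have q: "(\<xi>, \<eta>) \<in> qbox (2 * R)" using z by (auto simp: annulus_def)
  have nb: "norm x \<le> real DIM('a) * (2 * R)" if "x \<in> qbox (2 * R)" for x :: 'a
  proof -
    have "norm x \<le> (\<Sum>b\<in>Basis. \<bar>x \<bullet> b\<bar>)" by (rule norm_le_l1)
    also have "\<dots> \<le> (\<Sum>b\<in>(Basis :: 'a set). 2 * R)" using that by (intro sum_mono) (auto simp: qbox_def)
    finally show ?thesis by simp
  qed
  have n: "norm \<xi> \<le> real DIM('a) * (2 * R)" "norm \<eta> \<le> real DIM('a) * (2 * R)"
    using q by (auto simp: mem_qbox_Pair intro: nb)
  have lR: "1 \<le> l * R" using l R mult_mono[of 1 l 1 R] by simp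
  have "l * norm \<xi> \<le> l * (real DIM('a) * (2 * R))" "l * norm \<eta> \<le> l * (real DIM('a) * (2 * R))"
    using l by (auto intro!: mult_left_mono n)
  moreover have "l * (real DIM('a) * (2 * R)) = 2 * (real DIM('a) * (l * R))" by simp
  moreover have "T = 1 + l * norm \<xi> + l * norm \<eta>" using l by (simp add: T_def)
  ultimately have "T \<le> 1 + 4 * (real DIM('a) * (l * R))" by linarith
  also have "\<dots> \<le> c * (l * R)" using lR by (simp add: c_def algebra_simps)
  finally show "T \<le> c * (l * R)" .
  have T1: "1 \<le> T" by (simp add: T_def)
  have c2: "2 \<le> c" by (simp add: c_def)
  show "l * R \<le> c * T"
  proof (cases first)
    case True
    then show ?thesis using f T1 c2 mult_mono[of 1 c 1 T] by simp
  next
    case False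
    have "(\<xi>, \<eta>) \<notin> box (- (R / 2) *\<^sub>R One) ((R / 2) *\<^sub>R One)" using z False by (auto simp: annulus_def)
    then have "\<exists>b\<in>Basis. \<not> (- (R / 2) < (\<xi>, \<eta>) \<bullet> b \<and> (\<xi>, \<eta>) \<bullet> b < R / 2)"
      unfolding mem_box by simp
    then obtain b :: "'a \<times> 'a" where b: "b \<in> Basis" "\<not> (- (R / 2) < (\<xi>, \<eta>) \<bullet> b \<and> (\<xi>, \<eta>) \<bullet> b < R / 2)"
      by blast
    from b(2) have b2: "R / 2 \<le> \<bar>(\<xi>, \<eta>) \<bullet> b\<bar>" by linarith
    have "\<bar>\<xi> \<bullet> u\<bar> \<le> norm \<xi>" "\<bar>\<eta> \<bullet> u\<bar> \<le> norm \<eta>" if "u \<in> Basis" for u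
      using that by (auto intro: Basis_le_norm)
    then have "R / 2 \<le> norm \<xi> + norm \<eta>"
      using b(1) b2 by (fastforce simp: Basis_prod_def intro: order_trans add_increasing add_increasing2)
    then have "l * (R / 2) \<le> l * (norm \<xi> + norm \<eta>)" using l by (intro mult_left_mono) auto
    also have "\<dots> \<le> T" using l by (simp add: T_def algebra_simps)
    finally have "l * R \<le> 2 * T" by simp
    also have "\<dots> \<le> c * T" using c2 T1 by (intro mult_right_mono) auto
    finally show ?thesis .
  qed
qed

lemma powr_comparable:
  fixes T J c e :: real
  assumes "0 < T" "0 < J" "1 \<le> c" "T \<le> c * J" "J \<le> c * T"
  shows "T powr e \<le> c powr \<bar>e\<bar> * J powr e"
proof (cases "0 \<le> e")
  case True
  have "T powr e \<le> (c * J) powr e" using assms True by (intro powr_mono2) auto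
  then show ?thesis using True by (simp add: powr_mult)
next
  case False
  have "(c * T) powr e \<le> J powr e" using assms False by (intro powr_mono2') auto
  then have "c powr (- e) * (c powr e * T powr e) \<le> c powr (- e) * J powr e"
    by (intro mult_left_mono) (auto simp: powr_mult)
  then show ?thesis
    using False assms by (simp add: mult.assoc[symmetric] powr_add[symmetric])
qed

section \<open>Orders of differentiation in space and in frequency\<close>

definition n_x :: "('a::real_vector \<times> 'a \<times> 'a) list \<Rightarrow> nat" where
  "n_x vs = length (filter (\<lambda>v. fst v \<noteq> 0) vs)"

definition n_freq :: "('a::real_vector \<times> 'a \<times> 'a) list \<Rightarrow> nat" where
  "n_freq vs = length (filter (\<lambda>v. fst (snd v) \<noteq> 0) vs) + length (filter (\<lambda>v. snd (snd v) \<noteq> 0) vs)"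

text \<open>A basis vector of the triple product is nonzero in exactly one component, so each entry
  of the list is counted once and contributes either \<open>l\<close> or
  \<open>1 / l\<close>.\<close>

lemma count_lists:
  fixes vs :: "('a::euclidean_space \<times> 'a \<times> 'a) list"
  assumes "vs \<in> lists Basis" and l: "0 < l"
  shows "prod_list (map (\<lambda>v. if fst v \<noteq> 0 then 1 / l else l) vs) = l powr (real (n_freq vs) - real (n_x vs))"
    and "n_freq vs + n_x vs = length vs"
proof -
  have "prod_list (map (\<lambda>v. if fst v \<noteq> 0 then 1 / l else l) vs) = l powr (real (n_freq vs) - real (n_x vs)) \<and>
      n_freq vs + n_x vs = length vs"
    using assms(1)
  proof (induction vs)
    case Nil
    then show ?case using l by (simp add: n_freq_def n_x_def)
  next
    case (Cons v vs)
    have "v \<in> Basis" using Cons.hyps by auto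
    then consider "fst v \<noteq> 0" "fst (snd v) = 0" "snd (snd v) = 0"
      | "fst v = 0" "fst (snd v) \<noteq> 0" "snd (snd v) = 0"
      | "fst v = 0" "fst (snd v) = 0" "snd (snd v) \<noteq> 0"
      by (auto simp: Basis_prod_def dest: nonzero_Basis)
    then show ?case
    proof cases
      case 1
      have "l powr (real (n_freq vs) - real (n_x vs) - 1) = 1 / l * l powr (real (n_freq vs) - real (n_x vs))"
        using l by (simp add: powr_diff)
      then show ?thesis using Cons.IH 1 by (simp add: n_freq_def n_x_def algebra_simps)
    next
      case 2
      have "l powr (1 + (real (n_freq vs) - real (n_x vs))) = l * l powr (real (n_freq vs) - real (n_x vs))"
        using l by (simp add: powr_add)
      then show ?thesis using Cons.IH 2 by (simp add: n_freq_def n_x_def algebra_simps)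
    next
      case 3
      have "l powr (1 + (real (n_freq vs) - real (n_x vs))) = l * l powr (real (n_freq vs) - real (n_x vs))"
        using l by (simp add: powr_add)
      then show ?thesis using Cons.IH 3 by (simp add: n_freq_def n_x_def algebra_simps)
    qed
  qed
  then show "prod_list (map (\<lambda>v. if fst v \<noteq> 0 then 1 / l else l) vs) = l powr (real (n_freq vs) - real (n_x vs))"
    "n_freq vs + n_x vs = length vs" by auto
qed

lemma bisymbolD:
  fixes a :: "real^'n \<Rightarrow> real^'n \<Rightarrow> real^'n \<Rightarrow> complex"
  assumes "bisymbol m \<rho> \<delta> a"
  defines "A \<equiv> (\<lambda>(x, \<xi>, \<eta>). a x \<xi> \<eta>)"
  shows "smooth A"
    and "\<exists>C. \<forall>vs\<in>lists Basis. 0 \<le> C vs \<and> (\<forall>x \<xi> \<eta>. norm (iderv vs A (x, \<xi>, \<eta>)) \<le>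
       C vs * (1 + norm \<xi> + norm \<eta>) powr (m - \<rho> * real (n_freq vs) + \<delta> * real (n_x vs)))"
proof -
  show "smooth A" using assms by (simp add: bisymbol_def Let_def)
  have "\<forall>vs\<in>lists Basis. \<exists>C. \<forall>x \<xi> \<eta>. norm (iderv vs A (x, \<xi>, \<eta>)) \<le>
       C * (1 + norm \<xi> + norm \<eta>) powr (m - \<rho> * real (n_freq vs) + \<delta> * real (n_x vs))"
    using assms(1) unfolding bisymbol_def Let_def A_def[symmetric] n_freq_def n_x_def by blast
  from bchoice[OF this] obtain C where C: "\<forall>vs\<in>lists Basis. \<forall>x \<xi> \<eta>. norm (iderv vs A (x, \<xi>, \<eta>)) \<le>
       C vs * (1 + norm \<xi> + norm \<eta>) powr (m - \<rho> * real (n_freq vs) + \<delta> * real (n_x vs))" ..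
  show "\<exists>C. \<forall>vs\<in>lists Basis. 0 \<le> C vs \<and> (\<forall>x \<xi> \<eta>. norm (iderv vs A (x, \<xi>, \<eta>)) \<le>
       C vs * (1 + norm \<xi> + norm \<eta>) powr (m - \<rho> * real (n_freq vs) + \<delta> * real (n_x vs)))"
  proof (intro exI[of _ "\<lambda>vs. \<bar>C vs\<bar>"] ballI conjI allI)
    fix vs :: "((real^'n) \<times> (real^'n) \<times> (real^'n)) list" and x \<xi> \<eta> :: "real^'n"
    assume "vs \<in> lists Basis"
    then have "norm (iderv vs A (x, \<xi>, \<eta>)) \<le>
       C vs * (1 + norm \<xi> + norm \<eta>) powr (m - \<rho> * real (n_freq vs) + \<delta> * real (n_x vs))"
      using C by blast
    also have "\<dots> \<le> \<bar>C vs\<bar> * (1 + norm \<xi> + norm \<eta>) powr (m - \<rho> * real (n_freq vs) + \<delta> * real (n_x vs))"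
      by (intro mult_right_mono) auto
    finally show "norm (iderv vs A (x, \<xi>, \<eta>)) \<le>
       \<bar>C vs\<bar> * (1 + norm \<xi> + norm \<eta>) powr (m - \<rho> * real (n_freq vs) + \<delta> * real (n_x vs))" .
  qed simp
qed

text \<open>After rescaling by \<open>l = J powr \<rho>\<close> an \<open>x\<close>-derivative costs \<open>J powr (\<delta> - \<rho>) \<le> 1\<close> and a frequency
  derivative costs nothing.\<close>

lemma piece_ckb:
  fixes a :: "real^'n \<Rightarrow> real^'n \<Rightarrow> real^'n \<Rightarrow> complex" and \<phi> :: "(real^'n) \<times> (real^'n) \<Rightarrow> real"
  assumes a: "bisymbol m \<rho> \<delta> a" and \<rho>: "0 < \<rho>" "\<rho> \<le> 1" and \<delta>: "0 \<le> \<delta>" "\<delta> \<le> \<rho>"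
    and \<phi>: "ckb K (\<lambda>z. C\<phi> * indicator (qbox 2) z) (\<lambda>z. complex_of_real (\<phi> z))" "0 \<le> C\<phi>" "\<And>z. z \<in> qbox 1 \<Longrightarrow> \<phi> z = 1"
  defines "A \<equiv> (\<lambda>(x, \<xi>, \<eta>). a x \<xi> \<eta>)"
  shows "\<exists>C>0. \<forall>J first. 1 \<le> J \<longrightarrow> (first \<longrightarrow> J = 1) \<longrightarrow>
    ckb K (\<lambda>z. C * J powr m * indicator (UNIV \<times> qbox (2 * J powr (1 - \<rho>))) z)
      (\<lambda>z. A ((1 / J powr \<rho>) *\<^sub>R fst z, J powr \<rho> *\<^sub>R snd z) * complex_of_real (dyadic_cut \<phi> first (J powr (1 - \<rho>)) (snd z)))"
proof -
  have A: "smooth A" using bisymbolD(1)[OF a] by (simp add: A_def)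
  obtain C where "\<forall>vs\<in>lists Basis. 0 \<le> C vs \<and> (\<forall>x \<xi> \<eta>. norm (iderv vs A (x, \<xi>, \<eta>)) \<le>
       C vs * (1 + norm \<xi> + norm \<eta>) powr (m - \<rho> * real (n_freq vs) + \<delta> * real (n_x vs)))"
    using bisymbolD(2)[OF a] unfolding A_def ..
  then have C0: "\<And>vs. vs \<in> lists Basis \<Longrightarrow> 0 \<le> C vs"
    and CA: "\<And>vs x \<xi> \<eta>. vs \<in> lists Basis \<Longrightarrow> norm (iderv vs A (x, \<xi>, \<eta>)) \<le>
       C vs * (1 + norm \<xi> + norm \<eta>) powr (m - \<rho> * real (n_freq vs) + \<delta> * real (n_x vs))"
    by blast+
  define c where "c = 4 * real DIM(real^'n) + 2"
  have c: "1 \<le> c" by (simp add: c_def)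
  define L where "L = {vs \<in> lists (Basis :: ((real^'n) \<times> (real^'n) \<times> (real^'n)) set). length vs \<le> K}"
  have finL: "finite L" unfolding L_def by (rule finite_lists_Basis)
  \<comment> \<open>The symbol bound is a power of 1 + |\<xi>| + |\<eta>| with varying exponent;
    replacing the base by \<open>J\<close> costs a power of \<open>c\<close>, and
    \<open>\<bar>m\<bar> + 2 * real K\<close> is a crude bound for all exponents that occur.\<close>
  define E where "E = (\<Sum>vs\<in>L. C vs) * c powr (\<bar>m\<bar> + 2 * real K)"
  have E0: "0 \<le> E" unfolding E_def using C0 by (intro mult_nonneg_nonneg sum_nonneg) (auto simp: L_def)
  define D where "D = 2 ^ K * (E * (C\<phi> * (1 + 2 ^ K))) + 1"
  have D0: "0 < D" unfolding D_def using E0 \<phi>(2) by (intro add_nonneg_pos mult_nonneg_nonneg) auto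
  show ?thesis
  proof (intro exI[of _ D] conjI allI impI D0)
    fix J :: real and first :: bool
    assume J: "1 \<le> J" and f: "first \<longrightarrow> J = 1"
    define l where "l = J powr \<rho>"
    define R where "R = J powr (1 - \<rho>)"
    have l: "1 \<le> l" and R: "1 \<le> R" using J \<rho> by (auto simp: l_def R_def ge_one_powr_ge_zero)
    have lR: "l * R = J" using J by (simp add: l_def R_def powr_add[symmetric])
    define dil where "dil z = ((1 / l) *\<^sub>R fst z, l *\<^sub>R snd z)" for z :: "(real^'n) \<times> (real^'n) \<times> (real^'n)"
    define s where "s v = (if fst v \<noteq> 0 then 1 / l else l)" for v :: "(real^'n) \<times> (real^'n) \<times> (real^'n)"
    \<comment> \<open>A pointwise majorant of all rescaled derivatives. It is compared with
      \<open>J powr m\<close> only on the annulus; elsewhere the cutoff factor vanishes.\<close>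
    define MA where "MA z = (\<Sum>vs\<in>L. \<bar>prod_list (map s vs)\<bar> * norm (iderv vs A (dil z)))" for z
    have ckA: "ckb K MA (\<lambda>z. A (dil z))"
    proof (rule ckb_smooth_scaled[where s = s, OF A])
      show "dil (x + t *\<^sub>R v) = dil x + (t * s v) *\<^sub>R v" if "v \<in> Basis" for v x t
        using that by (auto simp: dil_def s_def Basis_prod_def algebra_simps)
      show "continuous_on UNIV dil" unfolding dil_def[abs_def] by (intro continuous_intros)
      show "\<bar>prod_list (map s vs)\<bar> * norm (iderv vs A (dil z)) \<le> MA z" if "vs \<in> lists Basis" "length vs \<le> K" for vs z
        unfolding MA_def using that finL by (intro member_le_sum) (auto simp: L_def)
    qed
    have MAb: "MA z \<le> E * J powr m" if z: "snd z \<in> annulus first R" for z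
    proof -
      obtain x \<xi> \<eta> where zz: "z = (x, \<xi>, \<eta>)" by (cases z)
      define T where "T = 1 + norm (l *\<^sub>R \<xi>) + norm (l *\<^sub>R \<eta>)"
      have T: "0 < T" by (simp add: T_def add_pos_nonneg)
      have Tb: "T \<le> c * J" "J \<le> c * T"
        using annulus_size[of \<xi> \<eta> first R l] z R l f unfolding zz T_def c_def lR by auto
      have "\<bar>prod_list (map s vs)\<bar> * norm (iderv vs A (dil z)) \<le> C vs * (c powr (\<bar>m\<bar> + 2 * real K) * J powr m)"
        if vs: "vs \<in> L" for vs
      proof -
        have vB: "vs \<in> lists Basis" "length vs \<le> K" using vs by (auto simp: L_def)
        define \<alpha> p where "\<alpha> = real (n_freq vs)" and "p = real (n_x vs)"
        have ap: "0 \<le> \<alpha>" "0 \<le> p" "\<alpha> + p \<le> K"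
          using count_lists(2)[OF vB(1), of 1] vB(2) by (auto simp: \<alpha>_def p_def)
        define e where "e = m - \<rho> * \<alpha> + \<delta> * p"
        have "\<rho> * \<alpha> \<le> 1 * \<alpha>" "\<delta> * p \<le> 1 * p" using ap \<rho> \<delta> by (intro mult_right_mono; simp)+
        moreover have "0 \<le> \<rho> * \<alpha>" "0 \<le> \<delta> * p" using ap \<rho> \<delta> by auto
        ultimately have e: "\<bar>e\<bar> \<le> \<bar>m\<bar> + 2 * real K" unfolding e_def using ap by linarith
        have "prod_list (map s vs) = l powr (\<alpha> - p)"
          using count_lists(1)[OF vB(1), of l] l by (simp add: s_def[abs_def] \<alpha>_def p_def)
        then have pl: "\<bar>prod_list (map s vs)\<bar> = J powr (\<rho> * (\<alpha> - p))" by (simp add: l_def powr_powr)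
        have "norm (iderv vs A (dil z)) \<le> C vs * T powr e"
          using CA[OF vB(1), of "(1 / l) *\<^sub>R x" "l *\<^sub>R \<xi>" "l *\<^sub>R \<eta>"] by (simp add: zz dil_def T_def e_def \<alpha>_def p_def)
        also have "\<dots> \<le> C vs * (c powr \<bar>e\<bar> * J powr e)"
          using J T Tb c C0[OF vB(1)] by (intro mult_left_mono powr_comparable) auto
        also have "\<dots> \<le> C vs * (c powr (\<bar>m\<bar> + 2 * real K) * J powr e)"
          using e c C0[OF vB(1)] by (intro mult_left_mono mult_right_mono powr_mono) auto
        finally have "\<bar>prod_list (map s vs)\<bar> * norm (iderv vs A (dil z)) \<le>
            J powr (\<rho> * (\<alpha> - p)) * (C vs * (c powr (\<bar>m\<bar> + 2 * real K) * J powr e))"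
          unfolding pl by (intro mult_left_mono) auto
        also have "\<dots> = C vs * (c powr (\<bar>m\<bar> + 2 * real K) * (J powr (\<rho> * (\<alpha> - p)) * J powr e))" by (simp only: mult_ac)
        \<comment> \<open>The contributions of the frequency derivatives cancel, and each space
          derivative leaves \<open>\<delta> - \<rho>\<close>.\<close>
        also have "J powr (\<rho> * (\<alpha> - p)) * J powr e = J powr (m - (\<rho> - \<delta>) * p)"
          unfolding powr_add[symmetric] e_def by (simp add: algebra_simps)
        also have "C vs * (c powr (\<bar>m\<bar> + 2 * real K) * J powr (m - (\<rho> - \<delta>) * p)) \<le>
            C vs * (c powr (\<bar>m\<bar> + 2 * real K) * J powr m)"
          using J \<delta> ap C0[OF vB(1)] by (intro mult_left_mono powr_mono) auto
        finally show ?thesis .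
      qed
      then have "MA z \<le> (\<Sum>vs\<in>L. C vs * (c powr (\<bar>m\<bar> + 2 * real K) * J powr m))"
        unfolding MA_def by (intro sum_mono)
      then show ?thesis by (simp add: E_def sum_distrib_right mult.assoc)
    qed
    define F where "F = C\<phi> * (1 + 2 ^ K)"
    have F: "0 \<le> F" using \<phi>(2) by (simp add: F_def)
    have "ckb K (\<lambda>z. 1 ^ K * (F * indicator (annulus first R) (snd z)))
        (\<lambda>z :: (real^'n) \<times> (real^'n) \<times> (real^'n). complex_of_real (dyadic_cut \<phi> first R (snd z)))"
    proof (rule ckb_comp[where A = snd and S = 1, OF _ _ _ cut_ckb[OF \<phi>(1,2) \<phi>(3) R, folded F_def]])
      show "\<exists>s w. w \<in> Basis \<and> \<bar>s\<bar> \<le> 1 \<and> (\<forall>x t. snd (x + t *\<^sub>R v) = snd x + (t * s) *\<^sub>R w)"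
        if v: "v \<in> Basis" for v :: "(real^'n) \<times> (real^'n) \<times> (real^'n)"
      proof (cases "snd v = 0")
        case True
        then show ?thesis
          using nonempty_Basis by (intro exI[of _ 0] exI[of _ "SOME b. b \<in> Basis"]) (auto simp: some_in_eq)
      next
        case False
        then show ?thesis
          using v by (intro exI[of _ 1] exI[of _ "snd v"]) (auto simp: Basis_prod_def)
      qed
    qed (auto intro!: continuous_intros)
    from ckb_mult[OF ckA this]
    have "ckb K (\<lambda>z. D * J powr m * indicator (UNIV \<times> qbox (2 * R)) z) (\<lambda>z. A (dil z) * complex_of_real (dyadic_cut \<phi> first R (snd z)))"
    proof (rule ckb_mono)
      fix z :: "(real^'n) \<times> (real^'n) \<times> (real^'n)"
      show "2 ^ K * (MA z * (1 ^ K * (F * indicator (annulus first R) (snd z)))) \<le> D * J powr m * indicator (UNIV \<times> qbox (2 * R)) z"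
      proof (cases "snd z \<in> annulus first R")
        case True
        then have i: "z \<in> UNIV \<times> qbox (2 * R)" by (cases z) (auto simp: annulus_def)
        have "2 ^ K * (MA z * F) \<le> 2 ^ K * ((E * J powr m) * F)"
          using MAb[OF True] F by (intro mult_left_mono mult_right_mono) auto
        also have "\<dots> = (2 ^ K * (E * F)) * J powr m" by (simp only: mult_ac)
        also have "\<dots> \<le> D * J powr m" by (intro mult_right_mono) (auto simp: D_def F_def)
        finally show ?thesis using True i by simp
      qed (use D0 in \<open>simp add: indicator_def\<close>)
    qed
    then show "ckb K (\<lambda>z. D * J powr m * indicator (UNIV \<times> qbox (2 * J powr (1 - \<rho>))) z)
      (\<lambda>z. A ((1 / J powr \<rho>) *\<^sub>R fst z, J powr \<rho> *\<^sub>R snd z) * complex_of_real (dyadic_cut \<phi> first (J powr (1 - \<rho>)) (snd z)))"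
      by (simp only: dil_def l_def R_def)
  qed
qed

subsection \<open>Summing the pieces\<close>

text \<open>At a fixed frequency the cutoff is 1 as soon as \<open>2 ^ J\<close> exceeds its norm;
  the integrand without cutoff is the majorant.\<close>

lemma bilop_limit:
  fixes A :: "'a::euclidean_space \<times> 'a \<times> 'a \<Rightarrow> complex"
  assumes Am: "A \<in> borel_measurable borel" and A: "\<And>z. norm (A z) \<le> C"
    and f: "integrable lborel (ft f)" and g: "integrable lborel (ft g)"
    and \<phi>m: "\<phi> \<in> borel_measurable borel" and \<phi>: "\<And>z. 0 \<le> \<phi> z" "\<And>z. \<phi> z \<le> 1" "\<And>z. z \<in> qbox 1 \<Longrightarrow> \<phi> z = (1::real)"
  shows "(\<lambda>J. bilop (\<lambda>z. A z * complex_of_real (\<phi> ((1 / 2 ^ J) *\<^sub>R snd z))) f g x) \<longlonglongrightarrow> bilop A f g x"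
  unfolding bilop_def
proof (rule integral_dominated_convergence)
  note i = bilop_integrable[OF Am A f g, of x]
  note [measurable] = Am \<phi>m
  have [measurable]: "(\<lambda>\<zeta>. ft f (fst \<zeta>) * ft g (snd \<zeta>)) \<in> borel_measurable borel"
    using borel_measurable_integrable[OF integrable_tensor[OF f g]] by simp
  show "(\<lambda>\<zeta>. A (x, \<zeta>) * phase x \<zeta> * (ft f (fst \<zeta>) * ft g (snd \<zeta>))) \<in> borel_measurable lborel"
    by measurable
  show "(\<lambda>\<zeta>. A (x, \<zeta>) * complex_of_real (\<phi> ((1 / 2 ^ J) *\<^sub>R snd (x, \<zeta>))) * phase x \<zeta> *
      (ft f (fst \<zeta>) * ft g (snd \<zeta>))) \<in> borel_measurable lborel" for J :: nat
    unfolding snd_conv by measurable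
  show "integrable lborel (\<lambda>\<zeta>. norm (A (x, \<zeta>) * phase x \<zeta> * (ft f (fst \<zeta>) * ft g (snd \<zeta>))))"
    using i by (rule integrable_norm)
  show "AE \<zeta> in lborel. norm (A (x, \<zeta>) * complex_of_real (\<phi> ((1 / 2 ^ J) *\<^sub>R snd (x, \<zeta>))) * phase x \<zeta> *
      (ft f (fst \<zeta>) * ft g (snd \<zeta>))) \<le> norm (A (x, \<zeta>) * phase x \<zeta> * (ft f (fst \<zeta>) * ft g (snd \<zeta>)))" for J
    using \<phi>(1,2) by (intro AE_I2) (auto simp: norm_mult intro!: mult_right_mono mult_left_le)
  show "AE \<zeta> in lborel. (\<lambda>J. A (x, \<zeta>) * complex_of_real (\<phi> ((1 / 2 ^ J) *\<^sub>R snd (x, \<zeta>))) * phase x \<zeta> *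
      (ft f (fst \<zeta>) * ft g (snd \<zeta>))) \<longlonglongrightarrow> A (x, \<zeta>) * phase x \<zeta> * (ft f (fst \<zeta>) * ft g (snd \<zeta>))"
  proof (rule AE_I2)
    fix \<zeta> :: "'a \<times> 'a"
    obtain J0 where J0: "norm \<zeta> < 2 ^ J0" using real_arch_pow[of 2 "norm \<zeta>"] by auto
    have "\<phi> ((1 / 2 ^ J) *\<^sub>R \<zeta>) = 1" if "J0 \<le> J" for J
    proof (rule \<phi>(3))
      have "(2::real) ^ J0 \<le> 2 ^ J" using that by (intro power_increasing) auto
      then have "\<bar>\<zeta> \<bullet> b\<bar> \<le> 2 ^ J" if "b \<in> Basis" for b
        using J0 Basis_le_norm[OF that, of \<zeta>] by linarith
      then show "(1 / 2 ^ J) *\<^sub>R \<zeta> \<in> qbox 1" by (subst mem_qbox_scale) (auto simp: qbox_def)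
    qed
    then have "\<forall>\<^sub>F J in sequentially. A (x, \<zeta>) * phase x \<zeta> * (ft f (fst \<zeta>) * ft g (snd \<zeta>)) =
        A (x, \<zeta>) * complex_of_real (\<phi> ((1 / 2 ^ J) *\<^sub>R snd (x, \<zeta>))) * phase x \<zeta> *
        (ft f (fst \<zeta>) * ft g (snd \<zeta>))"
      by (auto simp: eventually_sequentially)
    then show "(\<lambda>J. A (x, \<zeta>) * complex_of_real (\<phi> ((1 / 2 ^ J) *\<^sub>R snd (x, \<zeta>))) * phase x \<zeta> *
      (ft f (fst \<zeta>) * ft g (snd \<zeta>))) \<longlonglongrightarrow> A (x, \<zeta>) * phase x \<zeta> * (ft f (fst \<zeta>) * ft g (snd \<zeta>))"
      by (rule Lim_transform_eventually[OF tendsto_const])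
  qed
qed

text \<open>The sum telescopes: the inner cutoff of a piece is the outer cutoff of the piece before
  it, because 2 / 2^(j+1) = 1 / 2^j.\<close>

lemma dyadic_sum:
  fixes \<zeta> :: "'a::euclidean_space"
  shows "(\<Sum>j\<le>J. dyadic_cut \<phi> (j = 0) (2 ^ j) \<zeta>) = \<phi> ((1 / 2 ^ J) *\<^sub>R \<zeta>)"
  by (induction J) (auto simp: dyadic_cut_def)

lemma bilop_dyadic_sum:
  fixes A :: "'a::euclidean_space \<times> 'a \<times> 'a \<Rightarrow> complex"
  assumes Am: "A \<in> borel_measurable borel" and A: "\<And>z. norm (A z) \<le> C"
    and f: "integrable lborel (ft f)" and g: "integrable lborel (ft g)"
    and \<phi>m: "\<phi> \<in> borel_measurable borel" and \<phi>: "\<And>z. 0 \<le> \<phi> z" "\<And>z. \<phi> z \<le> (1::real)"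
  shows "(\<Sum>j\<le>J. bilop (\<lambda>z. A z * complex_of_real (dyadic_cut \<phi> (j = 0) (2 ^ j) (snd z))) f g x) =
    bilop (\<lambda>z. A z * complex_of_real (\<phi> ((1 / 2 ^ J) *\<^sub>R snd z))) f g x"
proof -
  note [measurable] = Am \<phi>m
  have C: "0 \<le> C" using A[of undefined] norm_ge_zero order_trans by blast
  have "integrable lborel (\<lambda>\<zeta>. A (x, \<zeta>) * complex_of_real (dyadic_cut \<phi> (j = 0) (2 ^ j) (snd (x, \<zeta>))) *
     phase x \<zeta> * (ft f (fst \<zeta>) * ft g (snd \<zeta>)))" for j :: nat
  proof (rule bilop_integrable[where A = "\<lambda>z. A z * complex_of_real (dyadic_cut \<phi> (j = 0) (2 ^ j) (snd z))", OF _ _ f g])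
    have 1: "(\<lambda>z. \<phi> ((1 / 2 ^ j) *\<^sub>R z)) \<in> borel_measurable borel" "(\<lambda>z. \<phi> ((2 / 2 ^ j) *\<^sub>R z)) \<in> borel_measurable borel"
      by measurable
    have [measurable]: "dyadic_cut \<phi> (j = 0) (2 ^ j) \<in> borel_measurable borel"
      using 1 by (cases j) (auto simp: dyadic_cut_def[abs_def] intro!: borel_measurable_diff)
    have [measurable]: "(\<lambda>z::'a \<times> 'a \<times> 'a. snd z) \<in> borel_measurable borel"
      by (intro borel_measurable_continuous_onI continuous_intros)
    show "(\<lambda>z. A z * complex_of_real (dyadic_cut \<phi> (j = 0) (2 ^ j) (snd z))) \<in> borel_measurable borel" by measurable
    fix z :: "'a \<times> 'a \<times> 'a"
    have "\<bar>dyadic_cut \<phi> (j = 0) (2 ^ j) (snd z)\<bar> \<le> 1"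
      using \<phi>(1)[of "(1 / 2 ^ j) *\<^sub>R snd z"] \<phi>(2)[of "(1 / 2 ^ j) *\<^sub>R snd z"]
        \<phi>(1)[of "(2 / 2 ^ j) *\<^sub>R snd z"] \<phi>(2)[of "(2 / 2 ^ j) *\<^sub>R snd z"]
      by (auto simp: dyadic_cut_def abs_le_iff)
    then show "norm (A z * complex_of_real (dyadic_cut \<phi> (j = 0) (2 ^ j) (snd z))) \<le> C * 1"
      unfolding norm_mult norm_of_real using A C by (intro mult_mono) auto
  qed
  then have "(\<Sum>j\<le>J. bilop (\<lambda>z. A z * complex_of_real (dyadic_cut \<phi> (j = 0) (2 ^ j) (snd z))) f g x) =
     (LINT \<zeta>|lborel. (\<Sum>j\<le>J. A (x, \<zeta>) * complex_of_real (dyadic_cut \<phi> (j = 0) (2 ^ j) (snd (x, \<zeta>))) *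
     phase x \<zeta> * (ft f (fst \<zeta>) * ft g (snd \<zeta>))))"
    unfolding bilop_def by (subst Bochner_Integration.integral_sum) auto
  also have "\<dots> = bilop (\<lambda>z. A z * complex_of_real (\<phi> ((1 / 2 ^ J) *\<^sub>R snd z))) f g x"
    unfolding bilop_def
    by (simp only: sum_distrib_left[symmetric] sum_distrib_right[symmetric] of_real_sum[symmetric] dyadic_sum)
  finally show ?thesis .
qed

section \<open>From extended norms to real bounds, and the summation\<close>

lemma Lnorm_lq_le:
  fixes f :: "real^'n \<Rightarrow> complex"
  assumes q: "1 \<le> q" and [measurable]: "f \<in> borel_measurable borel"
  shows "Lnorm q f = 0 \<Longrightarrow> AE x in lborel. f x = 0"
    and "Lnorm q f = ennreal N \<Longrightarrow> 0 < N \<Longrightarrow> lq_le q N f"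
proof -
  show "AE x in lborel. f x = 0" if 0: "Lnorm q f = 0"
  proof (cases "q = \<infinity>")
    case True
    have "AE x in lborel. ennreal (norm (f x)) \<le> esssup lborel (\<lambda>x. ennreal (norm (f x)))" by (rule esssup_AE)
    then show ?thesis using 0 True by (auto simp: Lnorm_def ennreal_eq_0_iff elim!: eventually_mono)
  next
    case False
    define p where "p = real_of_ereal q"
    have p: "1 \<le> p" using recip_finite[OF q False] by (simp add: p_def)
    define I where "I = (\<integral>\<^sup>+ x. ennreal (norm (f x) powr p) \<partial>lborel)"
    have "Lnorm q f = (if I = \<infinity> then \<infinity> else ennreal (enn2real I powr (1 / p)))"
      by (simp only: Lnorm_def p_def I_def Let_def False if_False)
    then have "I \<noteq> \<infinity>" "enn2real I powr (1 / p) = 0" using 0 by (auto split: if_splits simp: ennreal_eq_0_iff)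
    then have "I = 0" by (auto simp: enn2real_eq_0_iff)
    then show ?thesis unfolding I_def by (subst (asm) nn_integral_0_iff_AE) (auto simp: ennreal_eq_0_iff)
  qed
  show "lq_le q N f" if N: "Lnorm q f = ennreal N" "0 < N"
  proof (cases "q = \<infinity>")
    case True
    have "AE x in lborel. ennreal (norm (f x)) \<le> esssup lborel (\<lambda>x. ennreal (norm (f x)))" by (rule esssup_AE)
    then show ?thesis using N True by (auto simp: Lnorm_def lq_le_def ennreal_le_iff elim!: eventually_mono)
  next
    case False
    define p where "p = real_of_ereal q"
    have p: "1 \<le> p" using recip_finite[OF q False] by (simp add: p_def)
    define I where "I = (\<integral>\<^sup>+ x. ennreal (norm (f x) powr p) \<partial>lborel)"
    have "Lnorm q f = (if I = \<infinity> then \<infinity> else ennreal (enn2real I powr (1 / p)))"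
      by (simp only: Lnorm_def p_def I_def Let_def False if_False)
    then have L: "(if I = \<infinity> then \<infinity> else ennreal (enn2real I powr (1 / p))) = ennreal N"
      using N by simp
    then have fin: "I \<noteq> \<infinity>" by (auto split: if_splits)
    then have "enn2real I powr (1 / p) = N" using L N by (simp add: ennreal_inj)
    then have "N powr p = enn2real I" using p by (auto simp: powr_powr)
    then have "ennreal (N powr p) = I" using fin by (simp add: ennreal_enn2real less_top)
    then show ?thesis using False by (simp add: lq_le_def p_def[symmetric] I_def)
  qed
qed

lemma ft_AE_zero: "AE x in lborel. f x = 0 \<Longrightarrow> ft f \<xi> = 0"
  unfolding ft_def by (rule integral_eq_zero_AE) auto

theorem theorem5p19:
  fixes a :: "real^'n \<Rightarrow> real^'n \<Rightarrow> real^'n \<Rightarrow> complex"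
    and q1 q2 :: ereal and r m \<rho> \<delta> :: real
  assumes "1 \<le> q1" and "1 \<le> q2"
    and "0 < r" and "1 / r = recip q1 + recip q2"
    and "0 < \<rho>" and "\<rho> \<le> 1" and "0 \<le> \<delta>" and "\<delta> \<le> \<rho>" and "\<delta> < 1"
    and "bisymbol m \<rho> \<delta> a"
    and "m < real CARD('n) * (\<rho> - 1) *
           (max (max (1/2) (recip q1)) (max (recip q2) (1 - 1/r)) + 1/2 * max (1/r - 1) 0)"
  shows "\<exists>C::real. \<forall>f g. schwartz f \<longrightarrow> schwartz g \<longrightarrow>
           Lnorm (ereal r) (bipsido a f g) \<le> ennreal C * Lnorm q1 f * Lnorm q2 g"
proof -
  note q = assms(1,2) and r = assms(3,4) and \<rho> = assms(5,6) and \<delta> = assms(7,8)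
  define n where "n = real CARD('n)"
  define e where "e = scale_exp q1 q2 r"
  define A where "A = (\<lambda>(x, \<xi>, \<eta>). a x \<xi> \<eta>)"
  define M where "M = max (max (1/2) (recip q1)) (max (recip q2) (1 - 1/r)) + 1/2 * max (1/r - 1) 0"
  have eM: "e \<le> M" unfolding e_def M_def by (rule scale_exp_le(1)[OF q r])
  have M0: "0 \<le> M" unfolding M_def by (simp add: add_nonneg_nonneg le_max_iff_disj)
  have mM: "m < n * (\<rho> - 1) * M" using assms(11) by (simp add: n_def M_def)
  have n1: "0 \<le> n * (1 - \<rho>)" using \<rho> by (simp add: n_def)
  \<comment> \<open>The order is nonpositive, so the symbol is bounded; Fubini and the limit of the
    truncations rely on this.\<close>
  have m0: "m \<le> 0"
  proof -
    have "0 \<le> n * (1 - \<rho>) * M" using n1 M0 by simp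
    then show ?thesis using mM by (simp add: algebra_simps)
  qed
  \<comment> \<open>The decay rate of the pieces: with \<open>J = 2 ^ j\<close> and
    \<open>R = J powr (1 - \<rho>)\<close>, the single-scale bound is
    \<open>J powr m * R powr (n * e)\<close>, that is \<open>J powr (- \<kappa>)\<close>.\<close>
  define \<kappa> where "\<kappa> = - (m + (1 - \<rho>) * (n * e))"
  have \<kappa>: "0 < \<kappa>"
  proof -
    have "n * (1 - \<rho>) * e \<le> n * (1 - \<rho>) * M" using n1 eM by (intro mult_left_mono)
    then show ?thesis using mM by (simp add: \<kappa>_def algebra_simps)
  qed
  \<comment> \<open>Half of the decay is spent as the weight in \<open>sum_powr_le\<close>, the
    other half makes the series of integrals converge.\<close>
  define \<sigma> where "\<sigma> = \<kappa> / 2"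
  have \<sigma>: "0 < \<sigma>" "\<sigma> - \<kappa> = - \<sigma>" using \<kappa> by (auto simp: \<sigma>_def)
  have A: "smooth A" using bisymbolD(1)[OF assms(10)] by (simp add: A_def)
  have Am [measurable]: "A \<in> borel_measurable borel"
  proof -
    have "\<forall>vs\<in>lists Basis. continuous_on UNIV (iderv vs A)" using A by (simp add: smooth_def)
    from bspec[OF this, of "[]"] have "continuous_on UNIV A" by simp
    then show ?thesis by (rule borel_measurable_continuous_onI)
  qed
  obtain CA where CA: "\<And>z. norm (A z) \<le> CA"
  proof -
    obtain C where C: "\<forall>vs\<in>lists Basis. 0 \<le> C vs \<and> (\<forall>x \<xi> \<eta>. norm (iderv vs A (x, \<xi>, \<eta>)) \<le>
       C vs * (1 + norm \<xi> + norm \<eta>) powr (m - \<rho> * real (n_freq vs) + \<delta> * real (n_x vs)))"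
      using bisymbolD(2)[OF assms(10)] unfolding A_def ..
    have C0: "0 \<le> C []" and Cb: "norm (A (x, \<xi>, \<eta>)) \<le> C [] * (1 + norm \<xi> + norm \<eta>) powr m" for x \<xi> \<eta>
      using bspec[OF C, of "[]"] by (auto simp: n_freq_def n_x_def)
    have "norm (A (x, \<xi>, \<eta>)) \<le> C []" for x \<xi> \<eta>
    proof -
      have "(1 + norm \<xi> + norm \<eta>) powr m \<le> (1 + norm \<xi> + norm \<eta>) powr 0"
        using m0 by (intro powr_mono) auto
      then have "(1 + norm \<xi> + norm \<eta>) powr m \<le> 1" by (auto split: if_splits)
      then show ?thesis using order_trans[OF Cb mult_left_le[OF _ C0]] by blast
    qed
    then show ?thesis using that[of "C []"] by (metis prod_cases3)
  qed
  obtain \<phi> :: "(real^'n) \<times> (real^'n) \<Rightarrow> real" and C\<phi> where \<phi>: "0 \<le> C\<phi>"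
      "ckb (6 * DIM(real^'n)) (\<lambda>z. C\<phi> * indicator (qbox 2) z) (\<lambda>z. complex_of_real (\<phi> z))"
      "\<And>z. z \<in> qbox 1 \<Longrightarrow> \<phi> z = 1" "\<And>z. 0 \<le> \<phi> z" "\<And>z. \<phi> z \<le> 1"
    using box_cutoff[of "6 * DIM(real^'n)"] by blast
  have \<phi>m [measurable]: "\<phi> \<in> borel_measurable borel"
  proof -
    have "(\<lambda>z. Re (complex_of_real (\<phi> z))) \<in> borel_measurable borel"
      using ckb_measurable[OF \<phi>(2)] by measurable
    then show ?thesis by simp
  qed
  obtain C1 where C1: "0 < C1" and single: "\<And>B R N1 N2 (b :: (real^'n) \<times> (real^'n) \<times> (real^'n) \<Rightarrow> complex) f g.
     ckb (6 * DIM(real^'n)) (\<lambda>z. B * indicator (UNIV \<times> qbox (2 * R)) z) b \<Longrightarrow> 0 < B \<Longrightarrow> 1 \<le> R \<Longrightarrow> 0 < N1 \<Longrightarrow> 0 < N2 \<Longrightarrow>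
     integrable lborel f \<Longrightarrow> integrable lborel g \<Longrightarrow> lq_le q1 N1 f \<Longrightarrow> lq_le q2 N2 g \<Longrightarrow>
     (\<integral>\<^sup>+x. ennreal (norm (bilop b f g x) powr r) \<partial>lborel) \<le>
       ennreal (C1 * (B * R powr (real DIM(real^'n) * scale_exp q1 q2 r) * N1 * N2) powr r)"
    using single_scale[OF q r, where ?'a = "real^'n"]
  proof (elim exE conjE, goal_cases)
    case (1 C)
    show ?case by (rule 1(1)[OF 1(2)]) (rule 1(3)[rule_format]; assumption)
  qed
  obtain C2 where C2: "0 < C2" and piece: "\<And>J first. 1 \<le> J \<Longrightarrow> (first \<Longrightarrow> J = 1) \<Longrightarrow>
    ckb (6 * DIM(real^'n)) (\<lambda>z. C2 * J powr m * indicator (UNIV \<times> qbox (2 * J powr (1 - \<rho>))) z)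
      (\<lambda>z. A ((1 / J powr \<rho>) *\<^sub>R fst z, J powr \<rho> *\<^sub>R snd z) * complex_of_real (dyadic_cut \<phi> first (J powr (1 - \<rho>)) (snd z)))"
    using piece_ckb[OF assms(10) \<rho> \<delta> \<phi>(2,1,3), folded A_def] by blast
  define T where "T j = bilop (\<lambda>z. A z * complex_of_real (dyadic_cut \<phi> (j = 0) (2 ^ j) (snd z)))" for j :: nat
  have cut_m [measurable]: "(\<lambda>z. A z * complex_of_real (dyadic_cut \<phi> (j = 0) (2 ^ j) (snd z))) \<in> borel_measurable borel" for j :: nat
  proof -
    have 1: "(\<lambda>z. \<phi> ((1 / 2 ^ j) *\<^sub>R z)) \<in> borel_measurable borel" "(\<lambda>z. \<phi> ((2 / 2 ^ j) *\<^sub>R z)) \<in> borel_measurable borel"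
      by measurable
    have [measurable]: "dyadic_cut \<phi> (j = 0) (2 ^ j) \<in> borel_measurable borel"
      using 1 by (cases j) (auto simp: dyadic_cut_def[abs_def] intro!: borel_measurable_diff)
    have [measurable]: "(\<lambda>z::(real^'n) \<times> (real^'n) \<times> (real^'n). snd z) \<in> borel_measurable borel"
      by (intro borel_measurable_continuous_onI continuous_intros)
    show ?thesis by measurable
  qed
  have Tj: "(\<integral>\<^sup>+x. ennreal (norm (T j f g x) powr r) \<partial>lborel) \<le> ennreal (C1 * (C2 * N1 * N2) powr r * 2 powr (- (real j * \<kappa> * r)))"
    if f: "integrable lborel f" and g: "integrable lborel g" and N: "0 < N1" "0 < N2" and lq: "lq_le q1 N1 f" "lq_le q2 N2 g" for j f g N1 N2
  proof -
    have fm [measurable]: "f \<in> borel_measurable borel" "g \<in> borel_measurable borel"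
      using f g by (auto dest: borel_measurable_integrable)
    define J where "J = (2::real) ^ j"
    define l where "l = J powr \<rho>"
    define R where "R = J powr (1 - \<rho>)"
    have J: "1 \<le> J" by (simp add: J_def)
    have l: "0 < l" and R: "1 \<le> R" "0 < R" using J \<rho> by (auto simp: l_def R_def ge_one_powr_ge_zero)
    have lR: "l * R = J" using J by (simp add: l_def R_def powr_add[symmetric])
    define f' where "f' y = f ((1 / l) *\<^sub>R y)" for y
    define g' where "g' y = g ((1 / l) *\<^sub>R y)" for y
    have i: "integrable lborel (\<lambda>y. h ((1 / l) *\<^sub>R y))" if h: "integrable lborel h" for h :: "real^'n \<Rightarrow> complex"
    proof (rule integrableI_bounded)
      have [measurable]: "h \<in> borel_measurable borel" using h by (auto dest: borel_measurable_integrable)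
      show "(\<lambda>y. h ((1 / l) *\<^sub>R y)) \<in> borel_measurable lborel" by measurable
      have "(\<integral>\<^sup>+x. ennreal (norm (h ((1 / l) *\<^sub>R x))) \<partial>lborel) = ennreal (l ^ DIM(real^'n)) * (\<integral>\<^sup>+x. ennreal (norm (h ((1 / l) *\<^sub>R (l *\<^sub>R x)))) \<partial>lborel)"
        by (rule nn_integral_lborel_scale[OF _ l]) measurable
      also have "\<dots> < \<infinity>" using h l by (simp add: integrable_iff_bounded ennreal_mult_less_top)
      finally show "(\<integral>\<^sup>+x. ennreal (norm (h ((1 / l) *\<^sub>R x))) \<partial>lborel) < \<infinity>" .
    qed
    define b where "b z = A ((1 / l) *\<^sub>R fst z, l *\<^sub>R snd z) * complex_of_real (dyadic_cut \<phi> (j = 0) R (snd z))" for z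
    have ckb: "ckb (6 * DIM(real^'n)) (\<lambda>z. C2 * J powr m * indicator (UNIV \<times> qbox (2 * R)) z) b"
      unfolding b_def[abs_def] l_def R_def by (rule piece[OF J]) (simp add: J_def)
    \<comment> \<open>A cutoff at radius J in the original frequencies is one at radius R after
      dilation by \<open>l\<close>, since \<open>l * R = J\<close>.\<close>
    have sc: "dyadic_cut \<phi> (j = 0) (2 ^ j) (l *\<^sub>R \<zeta>) = dyadic_cut \<phi> (j = 0) R \<zeta>" for \<zeta>
    proof -
      have "1 / 2 ^ j * l = 1 / R" "2 / 2 ^ j * l = 2 / R"
        using l R unfolding J_def[symmetric] lR[symmetric] by auto
      then show ?thesis by (simp only: dyadic_cut_def scaleR_scaleR)
    qed
    have Tb: "T j f g ((1 / l) *\<^sub>R x) = bilop b f' g' x" for x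
      unfolding T_def bilop_scale[OF cut_m fm l] b_def[abs_def] f'_def[abs_def] g'_def[abs_def] by (simp add: sc)
    have Tm [measurable]: "T j f g \<in> borel_measurable borel"
      unfolding T_def by (rule bilop_measurable[OF cut_m fm])
    define d where "d = real DIM(real^'n)"
    have "(\<integral>\<^sup>+x. ennreal (norm (T j f g x) powr r) \<partial>lborel) =
        ennreal ((1 / l) ^ DIM(real^'n)) * (\<integral>\<^sup>+x. ennreal (norm (T j f g ((1 / l) *\<^sub>R x)) powr r) \<partial>lborel)"
      using l by (intro nn_integral_lborel_scale) auto
    also have "\<dots> \<le> ennreal ((1 / l) ^ DIM(real^'n)) * ennreal (C1 * ((C2 * J powr m) * R powr (d * e) * (l powr (d * recip q1) * N1) * (l powr (d * recip q2) * N2)) powr r)"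
      unfolding Tb d_def e_def
    proof (intro mult_left_mono single)
      show "lq_le q1 (l powr (real DIM(real^'n) * recip q1) * N1) f'" "lq_le q2 (l powr (real DIM(real^'n) * recip q2) * N2) g'"
        unfolding f'_def[abs_def] g'_def[abs_def]
        by (rule lq_le_scale[OF fm(1) l q(1) N(1) lq(1)], rule lq_le_scale[OF fm(2) l q(2) N(2) lq(2)])
      show "integrable lborel f'" "integrable lborel g'" unfolding f'_def[abs_def] g'_def[abs_def] by (intro i f g)+
    qed (use ckb R C2 J N l in auto)
    also have "\<dots> = ennreal (C1 * (C2 * N1 * N2) powr r * 2 powr (- (real j * \<kappa> * r)))"
    proof -
      have "(C2 * J powr m) * R powr (d * e) * (l powr (d * recip q1) * N1) * (l powr (d * recip q2) * N2) =
          (C2 * N1 * N2) * (J powr m * R powr (d * e)) * (l powr (d * recip q1) * l powr (d * recip q2))" by (simp only: mult_ac)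
      \<comment> \<open>Scaling balance: the dilated inputs gain \<open>l powr (d / r)\<close>
        together, whose r-th power cancels the Jacobian of the output.\<close>
      also have "l powr (d * recip q1) * l powr (d * recip q2) = l powr (d * (1 / r))"
        unfolding powr_add[symmetric] r(2) by (simp add: algebra_simps)
      also have "J powr m * R powr (d * e) = J powr (- \<kappa>)"
        by (simp add: R_def powr_powr powr_add[symmetric] \<kappa>_def n_def d_def algebra_simps)
      finally have "((C2 * J powr m) * R powr (d * e) * (l powr (d * recip q1) * N1) * (l powr (d * recip q2) * N2)) powr r =
          (C2 * N1 * N2) powr r * J powr (- \<kappa> * r) * l powr (d * (1 / r) * r)"
        by (simp only: powr_mult powr_powr)
      moreover have "l powr (d * (1 / r) * r) = l ^ DIM(real^'n)"
        using r(1) l powr_realpow[OF l, of "DIM(real^'n)"] by (simp add: d_def)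
      moreover have "J powr (- \<kappa> * r) = 2 powr (- (real j * \<kappa> * r))"
        by (simp add: J_def powr_realpow[symmetric] powr_powr mult.assoc)
      ultimately show ?thesis using C1 l by (simp add: ennreal_mult[symmetric] power_divide)
    qed
    finally show ?thesis .
  qed
  define cs where "cs = (1 / (1 - 2 powr (- \<sigma>))) powr r"
  define z where "z = 2 powr (- (\<sigma> * r))"
  have z: "0 < z" "z < 1" using \<sigma>(1) r(1) powr_less_mono[of "- (\<sigma> * r)" 0 2] by (auto simp: z_def)
  have cs0: "0 \<le> cs" by (simp add: cs_def)
  \<comment> \<open>The summand 1 keeps \<open>D\<close> positive, which the case of an infinite
    norm uses.\<close>
  define D where "D = (cs * C1 * C2 powr r * (1 / (1 - z)) + 1) powr (1 / r)"
  have D0: "0 < cs * C1 * C2 powr r * (1 / (1 - z)) + 1" using cs0 C1 z by (intro add_nonneg_pos) auto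
  then have D: "0 < D" by (simp add: D_def)
  show ?thesis
  proof (intro exI[of _ D] allI impI)
    fix f g :: "real^'n \<Rightarrow> complex"
    assume S: "schwartz f" "schwartz g"
    note if' = schwartz_facts[OF S(1)] and ig = schwartz_facts[OF S(2)]
    have fm [measurable]: "f \<in> borel_measurable borel" "g \<in> borel_measurable borel"
      using if' ig by (auto dest: borel_measurable_integrable)
    have bil: "bipsido a f g = bilop A f g"
      using bipsido_bilop[of a, folded A_def, OF Am CA if'(2) ig(2)] by (simp add: fun_eq_iff)
    define I where "I = (\<integral>\<^sup>+x. ennreal (norm (bipsido a f g x) powr r) \<partial>lborel)"
    have Lr: "Lnorm (ereal r) (bipsido a f g) = (if I = \<infinity> then \<infinity> else ennreal (enn2real I powr (1 / r)))"
      by (simp add: Lnorm_def I_def)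
    \<comment> \<open>Zero norms are separated first because 0 times infinity is 0 in
      \<open>ennreal\<close>: there the operator itself vanishes, since the transform of an almost
      everywhere zero function is 0.\<close>
    consider (z1) "Lnorm q1 f = 0" | (z2) "Lnorm q2 g = 0"
      | (inf) "Lnorm q1 f \<noteq> 0" "Lnorm q2 g \<noteq> 0" "Lnorm q1 f = \<infinity> \<or> Lnorm q2 g = \<infinity>"
      | (fin) N1 N2 where "Lnorm q1 f = ennreal N1" "Lnorm q2 g = ennreal N2" "0 < N1" "0 < N2"
    proof -
      have "\<exists>N>0. L = ennreal N" if "L \<noteq> 0" "L \<noteq> \<infinity>" for L
        using that by (intro exI[of _ "enn2real L"]) (auto simp: enn2real_positive_iff less_top zero_less_iff_neq_zero)
      then show ?thesis using that by metis
    qed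
    then show "Lnorm (ereal r) (bipsido a f g) \<le> ennreal D * Lnorm q1 f * Lnorm q2 g"
    proof cases
      case z1
      have "ft f = (\<lambda>_. 0)" using ft_AE_zero[OF Lnorm_lq_le(1)[OF q(1) fm(1) z1]] by (simp add: fun_eq_iff)
      then have "I = 0" using r(1) by (simp add: I_def bil bilop_def)
      then show ?thesis by (simp add: Lr)
    next
      case z2
      have "ft g = (\<lambda>_. 0)" using ft_AE_zero[OF Lnorm_lq_le(1)[OF q(2) fm(2) z2]] by (simp add: fun_eq_iff)
      then have "I = 0" using r(1) by (simp add: I_def bil bilop_def)
      then show ?thesis by (simp add: Lr)
    next
      case inf
      then have "ennreal D * Lnorm q1 f * Lnorm q2 g = \<infinity>"
        using D by (auto simp: ennreal_mult_eq_top_iff ennreal_eq_0_iff)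
      then show ?thesis by simp
    next
      case (fin N1 N2)
      have lq: "lq_le q1 N1 f" "lq_le q2 N2 g"
        using Lnorm_lq_le(2)[OF q(1) fm(1) fin(1,3)] Lnorm_lq_le(2)[OF q(2) fm(2) fin(2,4)] by auto
      have Tm [measurable]: "T j f g \<in> borel_measurable borel" for j
        unfolding T_def by (rule bilop_measurable[OF cut_m fm])
      \<comment> \<open>The weighted r-th powers dominate every partial sum of the pieces, uniformly
        in the number of terms, so they also dominate the limit.\<close>
      define u where "u j x = ennreal (cs * (2 powr (real j * \<sigma>) * norm (T j f g x)) powr r)" for j x
      have pw: "ennreal (norm (bipsido a f g x) powr r) \<le> (\<Sum>j. u j x)" for x
      proof -
        have lim: "(\<lambda>J. \<Sum>j\<le>J. T j f g x) \<longlonglongrightarrow> bilop A f g x"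
          unfolding T_def bilop_dyadic_sum[OF Am CA if'(2) ig(2) \<phi>m \<phi>(4,5)]
          by (rule bilop_limit[OF Am CA if'(2) ig(2) \<phi>m \<phi>(4,5) \<phi>(3)])
        have le: "ennreal (norm (\<Sum>j\<le>J. T j f g x) powr r) \<le> (\<Sum>j. u j x)" for J
        proof -
          have "norm (\<Sum>j\<le>J. T j f g x) powr r \<le> (\<Sum>j\<le>J. norm (T j f g x)) powr r"
            using r(1) by (intro powr_mono2 norm_sum) auto
          also have "\<dots> \<le> cs * (\<Sum>j\<le>J. (2 powr (real j * \<sigma>) * norm (T j f g x)) powr r)"
            unfolding cs_def by (rule sum_powr_le[OF _ r(1) \<sigma>(1)]) simp
          also have "\<dots> = (\<Sum>j\<le>J. cs * (2 powr (real j * \<sigma>) * norm (T j f g x)) powr r)"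
            by (rule sum_distrib_left)
          finally have "ennreal (norm (\<Sum>j\<le>J. T j f g x) powr r) \<le> (\<Sum>j\<le>J. u j x)"
            using cs0 unfolding u_def by (subst sum_ennreal) (auto intro: ennreal_leI)
          also have "\<dots> \<le> (\<Sum>j. u j x)" by (rule sum_le_suminf) auto
          finally show ?thesis .
        qed
        have "(\<lambda>J. ennreal (norm (\<Sum>j\<le>J. T j f g x) powr r)) \<longlonglongrightarrow> ennreal (norm (bilop A f g x) powr r)"
          using r(1) by (intro tendsto_ennrealI tendsto_powr2 tendsto_norm lim tendsto_const) auto
        then show ?thesis unfolding bil by (rule LIMSEQ_le_const2) (use le in blast)
      qed
      define W where "W = cs * C1 * C2 powr r * (N1 * N2) powr r"
      have W: "0 \<le> W" using cs0 C1 by (simp add: W_def)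
      have uj: "(\<integral>\<^sup>+x. u j x \<partial>lborel) \<le> ennreal (W * z ^ j)" for j
      proof -
        have "(\<integral>\<^sup>+x. u j x \<partial>lborel) = (\<integral>\<^sup>+x. ennreal (cs * 2 powr (real j * \<sigma> * r)) * ennreal (norm (T j f g x) powr r) \<partial>lborel)"
          unfolding u_def using cs0 by (intro nn_integral_cong) (simp add: powr_mult powr_powr ennreal_mult[symmetric] mult.assoc)
        also have "\<dots> = ennreal (cs * 2 powr (real j * \<sigma> * r)) * (\<integral>\<^sup>+x. ennreal (norm (T j f g x) powr r) \<partial>lborel)"
          by (rule nn_integral_cmult) measurable
        also have "\<dots> \<le> ennreal (cs * 2 powr (real j * \<sigma> * r)) * ennreal (C1 * (C2 * N1 * N2) powr r * 2 powr (- (real j * \<kappa> * r)))"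
          by (intro mult_left_mono Tj[OF if'(1) ig(1) fin(3,4) lq]) simp
        also have "\<dots> = ennreal (W * z ^ j)"
        proof -
          \<comment> \<open>The weight raises the exponent by \<open>\<sigma>\<close>, the piece
            lowers it by \<open>\<kappa>\<close>; what is left is the ratio \<open>z\<close> of a
            geometric series.\<close>
          have "2 powr (real j * \<sigma> * r) * 2 powr (- (real j * \<kappa> * r)) = 2 powr (real j * r * (\<sigma> - \<kappa>))"
            unfolding powr_add[symmetric] by (simp add: algebra_simps)
          also have "\<dots> = z ^ j"
            unfolding \<sigma>(2) by (simp add: z_def powr_realpow[symmetric] powr_powr mult_ac)
          finally have ex: "2 powr (real j * \<sigma> * r) * 2 powr (- (real j * \<kappa> * r)) = z ^ j" .
          have "cs * 2 powr (real j * \<sigma> * r) * (C1 * (C2 * N1 * N2) powr r * 2 powr (- (real j * \<kappa> * r))) =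
              cs * C1 * (C2 * N1 * N2) powr r * (2 powr (real j * \<sigma> * r) * 2 powr (- (real j * \<kappa> * r)))" by (simp only: mult_ac)
          also have "\<dots> = W * z ^ j" unfolding ex by (simp add: W_def powr_mult)
          finally show ?thesis using cs0 C1 by (subst ennreal_mult[symmetric]) auto
        qed
        finally show ?thesis .
      qed
      have "I \<le> (\<integral>\<^sup>+x. (\<Sum>j. u j x) \<partial>lborel)" unfolding I_def by (intro nn_integral_mono pw)
      also have "\<dots> = (\<Sum>j. \<integral>\<^sup>+x. u j x \<partial>lborel)" by (rule nn_integral_suminf) (simp add: u_def)
      also have "\<dots> \<le> (\<Sum>j. ennreal (W * z ^ j))" by (intro suminf_le uj) auto
      also have "\<dots> = ennreal (W * (1 / (1 - z)))"
      proof -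
        have "(\<lambda>j. W * z ^ j) sums (W * (1 / (1 - z)))"
          using z by (intro sums_mult geometric_sums) auto
        then show ?thesis using W z by (intro suminf_ennreal_eq) auto
      qed
      also have "\<dots> \<le> ennreal ((D * (N1 * N2)) powr r)"
      proof (rule ennreal_leI)
        have "W * (1 / (1 - z)) \<le> (cs * C1 * C2 powr r * (1 / (1 - z)) + 1) * (N1 * N2) powr r"
          by (simp add: W_def algebra_simps)
        also have "\<dots> = (D * (N1 * N2)) powr r"
          using D0 r(1) by (simp add: D_def powr_mult powr_powr)
        finally show "W * (1 / (1 - z)) \<le> (D * (N1 * N2)) powr r" .
      qed
      finally have I: "I \<le> ennreal ((D * (N1 * N2)) powr r)" .
      then have If: "I \<noteq> \<infinity>" by (auto simp: top_unique)
      have "enn2real I \<le> (D * (N1 * N2)) powr r"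
        using I by (metis enn2real_leI powr_ge_zero)
      then have "enn2real I powr (1 / r) \<le> ((D * (N1 * N2)) powr r) powr (1 / r)"
        using r(1) by (intro powr_mono2) auto
      also have "\<dots> = D * (N1 * N2)" using r(1) D fin(3,4) by (simp add: powr_powr)
      finally have "ennreal (enn2real I powr (1 / r)) \<le> ennreal (D * (N1 * N2))" by (rule ennreal_leI)
      also have "\<dots> = ennreal D * Lnorm q1 f * Lnorm q2 g"
        using D fin by (simp add: ennreal_mult mult.assoc)
      finally show ?thesis using If by (simp add: Lr)
    qed
  qed
qed

end
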